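(* In the setting described in the context, let $b\colon\mathbb{N}\to\mathbb{H}$ be a bijective function, let $\delta\in\mathbb{R}$, $i\in\{1,2\}$, assume that for all $n\in\mathbb{N}$ it holds that $\lambda_{b_n}=-\pi^2n^2$ and $\mu_{b_n}=|\lambda_{b_n}|^\delta$, and let $\varphi\colon H\to\mathbb{R}$ satisfy $\varphi(v)=\exp(-\|v\|_H^2)$ for all $v\in H$. Then $\varphi\in C^5_b(H,\mathbb{R})$, $B\in\bigcap_{r\in(-\infty,-\delta-1/4)}HS(H,H_r)$, and $$\mathbb{E}[\varphi(Y_i)]-\mathbb{E}[\varphi(X)]\ge\left[\frac{(1-e^{-T})(1-e^{-1})\,T^{(1/2+2\delta)^+}\,\pi^{4\delta}}{4^{1+2\delta^-}\,(3+4\delta^-)\,\exp\!\big(12\pi^2T+6\,\mathbb{E}[\|X\|_H^2]\big)}\right]h^{\min\{1/2-2\delta,\,1\}}>0.$$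
   Context: Notation: $\mathbb{N}=\{1,2,\dots\}$; $a^+=\max\{a,0\}$, $a^-=\max\{-a,0\}$; $\lfloor t\rfloor_h=\max((-\infty,t]\cap\{0,h,-h,2h,-2h,\dots\})$; $HS(H,E)$ denotes Hilbert–Schmidt operators from $H$ to $E$; $C^5_b(H,\mathbb{R})$ is the set of five times continuously Fréchet differentiable functions whose derivatives of orders $1,\dots,5$ are globally bounded. Setting. Let $(H,\langle\cdot,\cdot\rangle_H,\|\cdot\|_H)$ be a separable $\mathbb{R}$-Hilbert space with $H\ne\{0\}$, let $\mathbb{H}\subseteq H$ be an orthonormal basis of $H$, let $h\in(0,\infty)$, $T\in\{h,2h,3h,\dots\}$, $\beta\in[0,\frac12)$, let $\lambda,\mu\colon\mathbb{H}\to\mathbb{R}$ be functions with $\sup_{b\in\mathbb{H}}\lambda_b<0$ and $\sum_{b\in\mathbb{H}}|\mu_b|^2|\lambda_b|^{-2\beta}<\infty$. Let $A\colon D(A)\subseteq H\to H$ be the linear operator with $D(A)=\{v\in H\colon\sum_{b\in\mathbb{H}}|\lambda_b\langle b,v\rangle_H|^2<\infty\}$ and $Av=\sum_{b\in\mathbb{H}}\lambda_b\langle b,v\rangle_Hb$. Let $(H_r,\|\cdot\|_{H_r})$, $r\in\mathbb{R}$, be interpolation spaces associated to $-A$ (for $r\ge0$, $H_r=D((-A)^r)$ with $\|v\|_{H_r}=\|(-A)^rv\|_H$; for $r<0$, the completion of $H$ w.r.t. $\|(-A)^r\cdot\|_H$). Let $(\Omega,\mathcal{F},\mathbb{P},(\mathcal{F}_t)_{t\in[0,T]})$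 be a stochastic basis (filtered probability space satisfying the usual conditions), $(W_t)_{t\in[0,T]}$ a cylindrical $\mathrm{Id}_H$-Wiener process w.r.t. $(\mathcal{F}_t)$, and let $B\in HS(H,H_{-\beta})$ satisfy $Bv=\sum_{b\in\mathbb{H}}\mu_b\langle b,v\rangle_Hb$ for all $v\in H$. Let $X,Y_1,Y_2\colon\Omega\to H$ be $\mathcal{F}/\mathcal{B}(H)$-measurable with, $\mathbb{P}$-a.s., $X=\int_0^Te^{(T-s)A}B\,dW_s$, $Y_1=\int_0^Te^{(T-\lfloor s\rfloor_h)A}B\,dW_s$, and $Y_2=\int_0^T(\mathrm{Id}_H-hA)^{-(T-\lfloor s\rfloor_h)/h}B\,dW_s$ (such $X,Y_1,Y_2$ exist because $\beta<\frac12$, $\sup_{b\in\mathbb{H}}\lambda_b<0$, and $\sum_{b\in\mathbb{H}}|\mu_b|^2|\lambda_b|^{-2\beta}<\infty$). *)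

theory Defs
  imports "HOL-Probability.Probability"
begin

section \<open>Orthonormal bases and diagonal operators\<close>

definition orthonormal_basis :: "'a::real_inner set \<Rightarrow> bool" where
  "orthonormal_basis HH \<longleftrightarrow>
     (\<forall>b\<in>HH. \<forall>c\<in>HH. b \<bullet> c = (if b = c then 1 else 0)) \<and> closure (span HH) = UNIV"

text \<open>
  The possibly unbounded operator v |-> sum over b in HH of g b * (b, v) * b on its natural
  domain. Taking g = lam, g = (- lam) powr r and g = exp (t * lam) gives the operator A, the
  fractional powers of -A and the semigroup generated by A, respectively. Outside the domain
  the value of \<^term>\<open>infsum\<close> is irrelevant.
\<close>

definition diag_dom :: "'a::real_inner set \<Rightarrow> ('a \<Rightarrow> real) \<Rightarrow> 'a set" where
  "diag_dom HH g = {v. (\<lambda>b. \<bar>g b * (b \<bullet> v)\<bar>\<^sup>2) summable_on HH}"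

definition diag_op :: "'a::real_inner set \<Rightarrow> ('a \<Rightarrow> real) \<Rightarrow> 'a \<Rightarrow> 'a" where
  "diag_op HH g v = (\<Sum>\<^sub>\<infinity>b\<in>HH. (g b * (b \<bullet> v)) *\<^sub>R b)"

definition frac_power_dom :: "'a::real_inner set \<Rightarrow> ('a \<Rightarrow> real) \<Rightarrow> real \<Rightarrow> 'a set" where
  "frac_power_dom HH lam r = diag_dom HH (\<lambda>b. (- lam b) powr r)"

definition frac_power :: "'a::real_inner set \<Rightarrow> ('a \<Rightarrow> real) \<Rightarrow> real \<Rightarrow> 'a \<Rightarrow> 'a" where
  "frac_power HH lam r = diag_op HH (\<lambda>b. (- lam b) powr r)"

definition semigroup_op :: "'a::real_inner set \<Rightarrow> ('a \<Rightarrow> real) \<Rightarrow> real \<Rightarrow> 'a \<Rightarrow> 'a" where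
  "semigroup_op HH lam t = diag_op HH (\<lambda>b. exp (t * lam b))"

definition resolvent_op :: "'a::real_inner set \<Rightarrow> ('a \<Rightarrow> real) \<Rightarrow> real \<Rightarrow> 'a \<Rightarrow> 'a" where
  "resolvent_op HH lam h = inv_into (diag_dom HH lam) (\<lambda>v. v - h *\<^sub>R diag_op HH lam v)"


section \<open>Interpolation spaces\<close>

text \<open>
  All spaces of the scale live in one ambient real vector space \<^typ>\<open>'v\<close>; \<open>j\<close> embeds H into it.
  A space of the scale is a carrier set together with a norm that is meaningful on the carrier
  only.
\<close>

definition completion_of ::
  "('a::real_vector \<Rightarrow> 'v::real_vector) \<Rightarrow> ('a \<Rightarrow> real) \<Rightarrow> 'v set \<Rightarrow> ('v \<Rightarrow> real) \<Rightarrow> bool" where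
  "completion_of j p E nE \<longleftrightarrow>
     subspace E \<and>
     (\<forall>x\<in>E. 0 \<le> nE x \<and> (nE x = 0 \<longleftrightarrow> x = 0)) \<and>
     (\<forall>x\<in>E. \<forall>c. nE (c *\<^sub>R x) = \<bar>c\<bar> * nE x) \<and>
     (\<forall>x\<in>E. \<forall>y\<in>E. nE (x + y) \<le> nE x + nE y) \<and>
     range j \<subseteq> E \<and>
     (\<forall>v. nE (j v) = p v) \<and>
     (\<forall>x\<in>E. \<forall>\<epsilon>>0. \<exists>v. nE (x - j v) < \<epsilon>) \<and>
     (\<forall>x::nat \<Rightarrow> 'v. range x \<subseteq> E \<longrightarrow>
        (\<forall>\<epsilon>>0. \<exists>N. \<forall>m\<ge>N. \<forall>n\<ge>N. nE (x m - x n) < \<epsilon>) \<longrightarrow>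
        (\<exists>y\<in>E. (\<lambda>n. nE (x n - y)) \<longlonglongrightarrow> 0))"

text \<open>
  The last conjunct expresses that the completions for different negative exponents are
  identified with each other in the usual way, i.e. that the scale is nested with continuous
  inclusions.
\<close>

definition interpolation_spaces ::
  "'a::real_inner set \<Rightarrow> ('a \<Rightarrow> real) \<Rightarrow> ('a \<Rightarrow> 'v::real_vector) \<Rightarrow>
     (real \<Rightarrow> 'v set) \<Rightarrow> (real \<Rightarrow> 'v \<Rightarrow> real) \<Rightarrow> bool" where
  "interpolation_spaces HH lam j E nE \<longleftrightarrow>
     linear j \<and> inj j \<and>
     (\<forall>r\<ge>0. E r = j ` frac_power_dom HH lam r \<and>
        (\<forall>v\<in>frac_power_dom HH lam r. nE r (j v) = norm (frac_power HH lam r v))) \<and>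
     (\<forall>r<0. completion_of j (\<lambda>v. norm (frac_power HH lam r v)) (E r) (nE r)) \<and>
     (\<forall>r s. s \<le> r \<longrightarrow> E r \<subseteq> E s \<and> (\<exists>C. \<forall>x\<in>E r. nE s x \<le> C * nE r x))"

text \<open>
  Value at x of the continuous extension of an operator S on H to a completion of H with norm
  \<open>nE\<close>, the extension taking values in H.
\<close>

definition cont_extension ::
  "('a::real_normed_vector \<Rightarrow> 'v::real_vector) \<Rightarrow> ('v \<Rightarrow> real) \<Rightarrow> ('a \<Rightarrow> 'a) \<Rightarrow> 'v \<Rightarrow> 'a" where
  "cont_extension j nE S x =
     (THE w. \<forall>v::nat \<Rightarrow> 'a. (\<lambda>n. nE (j (v n) - x)) \<longlonglongrightarrow> 0 \<longrightarrow> (\<lambda>n. S (v n)) \<longlonglongrightarrow> w)"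

definition has_sum_wrt ::
  "('v::real_vector \<Rightarrow> real) \<Rightarrow> ('i \<Rightarrow> 'v) \<Rightarrow> 'i set \<Rightarrow> 'v \<Rightarrow> bool" where
  "has_sum_wrt nE f I x \<longleftrightarrow>
     (\<forall>\<epsilon>>0. \<exists>F0. finite F0 \<and> F0 \<subseteq> I \<and>
        (\<forall>F. finite F \<and> F0 \<subseteq> F \<and> F \<subseteq> I \<longrightarrow> nE (sum f F - x) < \<epsilon>))"

definition hilbert_schmidt ::
  "'a::real_inner set \<Rightarrow> 'v::real_vector set \<Rightarrow> ('v \<Rightarrow> real) \<Rightarrow> ('a \<Rightarrow> 'v) set" where
  "hilbert_schmidt HH E nE =
     {L. linear L \<and> range L \<subseteq> E \<and> (\<exists>C. \<forall>v. nE (L v) \<le> C * norm v) \<and>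
         (\<lambda>b. (nE (L b))\<^sup>2) summable_on HH}"


section \<open>Stochastic integration\<close>

definition stochastic_basis :: "'w measure \<Rightarrow> (real \<Rightarrow> 'w measure) \<Rightarrow> real \<Rightarrow> bool" where
  "stochastic_basis M F T \<longleftrightarrow>
     prob_space M \<and>
     (\<forall>t\<in>{0..T}. subalgebra M (F t)) \<and>
     (\<forall>s\<in>{0..T}. \<forall>t\<in>{0..T}. s \<le> t \<longrightarrow> sets (F s) \<subseteq> sets (F t)) \<and>
     (\<forall>N\<in>sets M. emeasure M N = 0 \<longrightarrow> N \<in> sets (F 0)) \<and>
     (\<forall>t\<in>{0..<T}. sets (F t) = (\<Inter>s\<in>{t<..T}. sets (F s)))"

text \<open>
  A cylindrical Id-Wiener process is a family of real random variables \<open>W t v\<close> (formally the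
  inner product of the Wiener process at time t with v), linear in v up to null sets, such that
  each \<open>W \<cdot> v\<close> is a Brownian motion with respect to the filtration with variance
  \<open>(norm v)\<^sup>2\<close> per unit of time. The covariance structure follows by polarisation.
\<close>

definition cylindrical_wiener_process ::
  "'w measure \<Rightarrow> (real \<Rightarrow> 'w measure) \<Rightarrow> real \<Rightarrow> (real \<Rightarrow> 'a::real_inner \<Rightarrow> 'w \<Rightarrow> real) \<Rightarrow> bool"
where
  "cylindrical_wiener_process M F T W \<longleftrightarrow>
     (\<forall>t\<in>{0..T}. \<forall>v. W t v \<in> borel_measurable (F t)) \<and>
     (\<forall>t\<in>{0..T}. \<forall>c u v. AE \<omega> in M. W t (c *\<^sub>R u + v) \<omega> = c * W t u \<omega> + W t v \<omega>) \<and>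
     (\<forall>v. AE \<omega> in M. W 0 v \<omega> = 0) \<and>
     (\<forall>v. AE \<omega> in M. continuous_on {0..T} (\<lambda>t. W t v \<omega>)) \<and>
     (\<forall>s t v. 0 \<le> s \<longrightarrow> s < t \<longrightarrow> t \<le> T \<longrightarrow>
        prob_space.indep_set M (sets (F s))
          {(\<lambda>\<omega>. W t v \<omega> - W s v \<omega>) -` S \<inter> space M | S. S \<in> sets borel} \<and>
        (v \<noteq> 0 \<longrightarrow> distributed M lborel (\<lambda>\<omega>. W t v \<omega> - W s v \<omega>)
                     (normal_density 0 (norm v * sqrt (t - s)))))"

text \<open>
  A list of tuples (a, b, u, x) encodes the elementary operator-valued integrand which at time s
  is the sum of the rank one operators v |-> (u, v) x over all entries with s in (a, b]. Its
  stochastic integral is the sum of (W b u - W a u) x.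
\<close>

definition elem_integrand :: "(real \<times> real \<times> 'a::real_inner \<times> 'a) list \<Rightarrow> real \<Rightarrow> 'a \<Rightarrow> 'a" where
  "elem_integrand es s v =
     (\<Sum>(a, b, u, x)\<leftarrow>es. if s \<in> {a<..b} then (u \<bullet> v) *\<^sub>R x else 0)"

definition elem_integral ::
  "(real \<Rightarrow> 'a::real_inner \<Rightarrow> 'w \<Rightarrow> real) \<Rightarrow> (real \<times> real \<times> 'a \<times> 'a) list \<Rightarrow> 'w \<Rightarrow> 'a" where
  "elem_integral W es \<omega> = (\<Sum>(a, b, u, x)\<leftarrow>es. (W b u \<omega> - W a u \<omega>) *\<^sub>R x)"

definition elem_on :: "real \<Rightarrow> (real \<times> real \<times> 'a \<times> 'a) list \<Rightarrow> bool" where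
  "elem_on T es \<longleftrightarrow> (\<forall>(a, b, u, x)\<in>set es. 0 \<le> a \<and> a \<le> b \<and> b \<le> T)"

text \<open>
  \<open>has_stochastic_integral HH M W T \<Phi> X\<close>: the random variable X is a version of the stochastic
  integral over [0,T] of the deterministic Hilbert-Schmidt valued integrand \<open>\<Phi>\<close> against W,
  defined by approximation with elementary integrands in the square-integrable functions from
  [0,T] to HS(H,H). By the Ito isometry X is determined up to a null set.
\<close>

definition has_stochastic_integral ::
  "'a::{real_inner,banach,second_countable_topology} set \<Rightarrow> 'w measure \<Rightarrow>
     (real \<Rightarrow> 'a \<Rightarrow> 'w \<Rightarrow> real) \<Rightarrow> real \<Rightarrow> (real \<Rightarrow> 'a \<Rightarrow> 'a) \<Rightarrow> ('w \<Rightarrow> 'a) \<Rightarrow> bool" where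
  "has_stochastic_integral HH M W T \<Phi> X \<longleftrightarrow>
     X \<in> borel_measurable M \<and>
     (\<forall>v. set_borel_measurable borel {0..T} (\<lambda>s. \<Phi> s v)) \<and>
     (AE s in lborel. s \<in> {0..T} \<longrightarrow> \<Phi> s \<in> hilbert_schmidt HH UNIV norm) \<and>
     (\<exists>es. (\<forall>n::nat. elem_on T (es n)) \<and>
        (\<lambda>n. \<integral>\<^sup>+ s\<in>{0..T}.
               (\<integral>\<^sup>+ b. ennreal ((norm (\<Phi> s b - elem_integrand (es n) s b))\<^sup>2) \<partial>count_space HH)
             \<partial>lborel) \<longlonglongrightarrow> 0 \<and>
        (\<lambda>n. \<integral>\<^sup>+ \<omega>. ennreal ((norm (X \<omega> - elem_integral W (es n) \<omega>))\<^sup>2) \<partial>M) \<longlonglongrightarrow> 0)"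

definition grid_floor :: "real \<Rightarrow> real \<Rightarrow> real" where
  "grid_floor h t = (GREATEST x. x \<le> t \<and> (\<exists>k::int. x = of_int k * h))"

text \<open>
  The three integrands, as operators from H to H; \<open>nB\<close> is the norm of the space in which B takes
  its values. They need not be meaningful at the single time s = T. In the last one the exponent
  is a natural number whenever T is a multiple of h, so that \<^term>\<open>floor\<close> does not round.
\<close>

definition exact_integrand ::
  "'a::{real_inner,banach} set \<Rightarrow> ('a \<Rightarrow> real) \<Rightarrow> ('a \<Rightarrow> 'v::real_vector) \<Rightarrow> ('v \<Rightarrow> real) \<Rightarrow>
     ('a \<Rightarrow> 'v) \<Rightarrow> real \<Rightarrow> real \<Rightarrow> 'a \<Rightarrow> 'a" where
  "exact_integrand HH lam j nB B T s v =
     cont_extension j nB (semigroup_op HH lam (T - s)) (B v)"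

definition exp_euler_integrand ::
  "'a::{real_inner,banach} set \<Rightarrow> ('a \<Rightarrow> real) \<Rightarrow> ('a \<Rightarrow> 'v::real_vector) \<Rightarrow> ('v \<Rightarrow> real) \<Rightarrow>
     ('a \<Rightarrow> 'v) \<Rightarrow> real \<Rightarrow> real \<Rightarrow> real \<Rightarrow> 'a \<Rightarrow> 'a" where
  "exp_euler_integrand HH lam j nB B h T s v =
     cont_extension j nB (semigroup_op HH lam (T - grid_floor h s)) (B v)"

definition impl_euler_integrand ::
  "'a::{real_inner,banach} set \<Rightarrow> ('a \<Rightarrow> real) \<Rightarrow> ('a \<Rightarrow> 'v::real_vector) \<Rightarrow> ('v \<Rightarrow> real) \<Rightarrow>
     ('a \<Rightarrow> 'v) \<Rightarrow> real \<Rightarrow> real \<Rightarrow> real \<Rightarrow> 'a \<Rightarrow> 'a" where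
  "impl_euler_integrand HH lam j nB B h T s v =
     cont_extension j nB (resolvent_op HH lam h ^^ nat \<lfloor>(T - grid_floor h s) / h\<rfloor>) (B v)"


section \<open>Test functions\<close>

text \<open>
  The witnesses f1, ..., f5 are the Frechet derivatives of orders 1 to 5, where the space of
  continuous k-linear forms is identified with nested bounded linear maps.
\<close>

definition C5b :: "('a::real_normed_vector \<Rightarrow> real) set" where
  "C5b = {f. \<exists>(f1 :: 'a \<Rightarrow> 'a \<Rightarrow>\<^sub>L real)
            (f2 :: 'a \<Rightarrow> 'a \<Rightarrow>\<^sub>L 'a \<Rightarrow>\<^sub>L real)
            (f3 :: 'a \<Rightarrow> 'a \<Rightarrow>\<^sub>L 'a \<Rightarrow>\<^sub>L 'a \<Rightarrow>\<^sub>L real)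
            (f4 :: 'a \<Rightarrow> 'a \<Rightarrow>\<^sub>L 'a \<Rightarrow>\<^sub>L 'a \<Rightarrow>\<^sub>L 'a \<Rightarrow>\<^sub>L real)
            (f5 :: 'a \<Rightarrow> 'a \<Rightarrow>\<^sub>L 'a \<Rightarrow>\<^sub>L 'a \<Rightarrow>\<^sub>L 'a \<Rightarrow>\<^sub>L 'a \<Rightarrow>\<^sub>L real).
        (\<forall>x. (f has_derivative blinfun_apply (f1 x)) (at x)) \<and>
        (\<forall>x. (f1 has_derivative blinfun_apply (f2 x)) (at x)) \<and>
        (\<forall>x. (f2 has_derivative blinfun_apply (f3 x)) (at x)) \<and>
        (\<forall>x. (f3 has_derivative blinfun_apply (f4 x)) (at x)) \<and>
        (\<forall>x. (f4 has_derivative blinfun_apply (f5 x)) (at x)) \<and>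
        continuous_on UNIV f5 \<and>
        bounded (range f1) \<and> bounded (range f2) \<and> bounded (range f3) \<and>
        bounded (range f4) \<and> bounded (range f5)}"

definition pos_part :: "real \<Rightarrow> real" where
  "pos_part a = max a 0"

definition neg_part :: "real \<Rightarrow> real" where
  "neg_part a = max (- a) 0"

end

(* For a basis vector with eigenvalue -a the coordinates of X, Y 1 and Y 2 are centred Gaussians with
   variances given by the Ito isometry, and E[exp(-(norm X)^2)] is the infinite product of the
   factors (1 + 2 q)^(-1/2) over these variances q. The Gaussian law is never needed jointly: an
   elementary integral is split at the end points of its steps, which yields the characteristic
   function of any linear functional, and exp(-x^2) = E[exp(i sqrt 2 Z x)] for a standard normal Z
   turns characteristic functions into the product formula. Both schemes shrink every variance at
   least by the factor 2 / (2 + a h). Comparing logarithms of the products bounds the weak error from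
   below by exp(-3 E[(norm X)^2]) times the sum of the variance gaps. For pi^2 h < 1 the terms with
   a h <= 1 of that sum already have the claimed order in h; otherwise its first term suffices. *)
theory Submission
  imports Defs
begin

section \<open>Gaussian functions have bounded derivatives\<close>

text \<open>The rate comes from counting modes: about h^(-1/2) of them satisfy a h <= 1, and the
  k-th contributes h k^(4 \<delta>) up to constants, which sums to h^(1/2 - 2 \<delta>). For
  \<delta> < -1/4 these contributions are summable, so the first mode alone already gives the
  saturated rate h. At the other end, the summability assumed of \<open>mu\<close> and
  \<open>lam\<close> together with \<beta> < 1/2 forces \<delta> < 1/4. The factor exp(12 pi^2 T) in
  the constant pays for the power of T in the numerator. The obstacle on the operator side is that B
  takes values in the negative space H_(-\<beta>), so the integrands are continuous extensions
  rather than compositions of operators on H. Tested on the basis this disappears: B maps a basis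
  vector to a multiple of itself inside H, where every operator involved is a scalar multiplier. The
  obstacle on the probabilistic side is that W is linear only up to null sets and that just its
  one-dimensional increments are given as Gaussian; independence of the past is what combines
  them.\<close>

definition Cb0 :: "('a::real_normed_vector \<Rightarrow> 'b::real_normed_vector) \<Rightarrow> bool" where
  "Cb0 f \<longleftrightarrow> continuous_on UNIV f \<and> bounded (range f)"

text \<open>
  The type of a derivative grows with its order, so the classes of order 0 to 5 cannot be one
  recursive definition; only the step from one order to the next is generic.
\<close>

definition Cb_step :: "(('a \<Rightarrow> 'a \<Rightarrow>\<^sub>L 'b) \<Rightarrow> bool) \<Rightarrow> ('a::real_normed_vector \<Rightarrow> 'b::real_normed_vector) \<Rightarrow> bool" where
  "Cb_step P f \<longleftrightarrow> bounded (range f) \<and> (\<exists>f'. (\<forall>x. (f has_derivative blinfun_apply (f' x)) (at x)) \<and> P f')"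

definition Cb1 :: "('a::real_normed_vector \<Rightarrow> 'b::real_normed_vector) \<Rightarrow> bool" where
  "Cb1 = Cb_step Cb0"

definition Cb2 :: "('a::real_normed_vector \<Rightarrow> 'b::real_normed_vector) \<Rightarrow> bool" where
  "Cb2 = Cb_step Cb1"

definition Cb3 :: "('a::real_normed_vector \<Rightarrow> 'b::real_normed_vector) \<Rightarrow> bool" where
  "Cb3 = Cb_step Cb2"

definition Cb4 :: "('a::real_normed_vector \<Rightarrow> 'b::real_normed_vector) \<Rightarrow> bool" where
  "Cb4 = Cb_step Cb3"

definition Cb5 :: "('a::real_normed_vector \<Rightarrow> 'b::real_normed_vector) \<Rightarrow> bool" where
  "Cb5 = Cb_step Cb4"

lemma Cb5_imp_C5b: "Cb5 f \<Longrightarrow> f \<in> C5b"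
  unfolding C5b_def Cb5_def Cb4_def Cb3_def Cb2_def Cb1_def Cb0_def Cb_step_def mem_Collect_eq
  by (elim conjE exE, intro exI conjI) assumption+

lemma Cb_stepI:
  "bounded (range f) \<Longrightarrow> (\<And>x. (f has_derivative blinfun_apply (f' x)) (at x)) \<Longrightarrow> P f' \<Longrightarrow> Cb_step P f"
  unfolding Cb_step_def by blast

lemma Cb_step_mono: "Cb_step P f \<Longrightarrow> (\<And>f'. P f' \<Longrightarrow> Q f') \<Longrightarrow> Cb_step Q f"
  unfolding Cb_step_def by blast

section \<open>Stability of the bounded smooth classes under sums and bilinear products\<close>

lemma bounded_range_bilinear:
  fixes f :: "'x \<Rightarrow> 'a::real_normed_vector" and g :: "'x \<Rightarrow> 'b::real_normed_vector"
  assumes "bounded_bilinear pr" "bounded (range f)" "bounded (range g)"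
  shows "bounded (range (\<lambda>x. pr (f x) (g x)))"
proof -
  interpret bounded_bilinear "pr" by fact
  obtain K where K: "\<And>a b. norm (pr a b) \<le> norm a * norm b * K" "K \<ge> 0"
    using nonneg_bounded by blast
  obtain Bf Bg where B: "\<And>x. norm (f x) \<le> Bf" "\<And>x. norm (g x) \<le> Bg"
    using assms(2,3) unfolding bounded_iff by (metis rangeI)
  have "norm (pr (f x) (g x)) \<le> Bf * Bg * K" for x
    by (rule order_trans[OF K(1)]) (intro mult_right_mono mult_mono B K norm_ge_zero order_trans[OF norm_ge_zero B(1)])
  then show ?thesis unfolding bounded_iff by blast
qed

lemma bounded_range_add:
  fixes f g :: "'x \<Rightarrow> 'a::real_normed_vector"
  assumes "bounded (range f)" "bounded (range g)"
  shows "bounded (range (\<lambda>x. f x + g x))"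
proof -
  obtain Bf Bg where B: "\<And>x. norm (f x) \<le> Bf" "\<And>x. norm (g x) \<le> Bg"
    using assms unfolding bounded_iff by (metis rangeI)
  show ?thesis unfolding bounded_iff
    by (auto intro!: exI[of _ "Bf + Bg"] norm_triangle_mono B)
qed

lemma blinfun_derivative_add:
  assumes "(f has_derivative blinfun_apply f') (at x)" "(g has_derivative blinfun_apply g') (at x)"
  shows "((\<lambda>x. f x + g x) has_derivative blinfun_apply (f' + g')) (at x)"
  using has_derivative_add[OF assms] by (simp add: plus_blinfun.rep_eq)

lemma Cb_step_add:
  assumes "Cb_step P f" "Cb_step P g" and add: "\<And>f' g'. P f' \<Longrightarrow> P g' \<Longrightarrow> P (\<lambda>x. f' x + g' x)"
  shows "Cb_step P (\<lambda>x. f x + g x)"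
proof -
  from assms(1) obtain f' where f': "bounded (range f)" "\<And>x. (f has_derivative blinfun_apply (f' x)) (at x)" "P f'"
    unfolding Cb_step_def by blast
  from assms(2) obtain g' where g': "bounded (range g)" "\<And>x. (g has_derivative blinfun_apply (g' x)) (at x)" "P g'"
    unfolding Cb_step_def by blast
  show ?thesis
  proof (rule Cb_stepI)
    show "bounded (range (\<lambda>x. f x + g x))" by (rule bounded_range_add) fact+
    show "((\<lambda>x. f x + g x) has_derivative blinfun_apply (f' x + g' x)) (at x)" for x
      by (rule blinfun_derivative_add) fact+
    show "P (\<lambda>x. f' x + g' x)" by (rule add) fact+
  qed
qed

lemma Cb0_add: "Cb0 f \<Longrightarrow> Cb0 g \<Longrightarrow> Cb0 (\<lambda>x. f x + g x)"
  unfolding Cb0_def by (auto intro!: continuous_intros bounded_range_add)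

lemma Cb1_add:
  assumes "Cb1 f" "Cb1 g"
  shows "Cb1 (\<lambda>x. f x + g x)"
  unfolding Cb1_def
proof (rule Cb_step_add)
  show "Cb_step Cb0 f" "Cb_step Cb0 g" using assms unfolding Cb1_def .
qed (rule Cb0_add)

lemma Cb2_add:
  assumes "Cb2 f" "Cb2 g"
  shows "Cb2 (\<lambda>x. f x + g x)"
  unfolding Cb2_def
proof (rule Cb_step_add)
  show "Cb_step Cb1 f" "Cb_step Cb1 g" using assms unfolding Cb2_def .
qed (rule Cb1_add)

lemma Cb3_add:
  assumes "Cb3 f" "Cb3 g"
  shows "Cb3 (\<lambda>x. f x + g x)"
  unfolding Cb3_def
proof (rule Cb_step_add)
  show "Cb_step Cb2 f" "Cb_step Cb2 g" using assms unfolding Cb3_def .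
qed (rule Cb2_add)

text \<open>In the product rule, the summand that differentiates the first factor is again a bounded
  bilinear expression, now in that derivative and the second factor. Stability under products can
  therefore be shown order by order for all bilinear maps at once.\<close>

lemma bounded_bilinear_left_factor:
  fixes pr :: "'b::real_normed_vector \<Rightarrow> 'c::real_normed_vector \<Rightarrow> 'd::real_normed_vector"
  assumes "bounded_bilinear pr"
  shows "bounded_bilinear (\<lambda>(F :: 'a::real_normed_vector \<Rightarrow>\<^sub>L 'b) c. bounded_bilinear.prod_left pr c o\<^sub>L F)"
proof -
  interpret comp: bounded_bilinear "\<lambda>(F :: 'a \<Rightarrow>\<^sub>L 'b) (K :: 'b \<Rightarrow>\<^sub>L 'd). K o\<^sub>L F"
    by (rule bounded_bilinear.flip[OF bounded_bilinear_blinfun_compose])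
  show ?thesis
    by (rule comp.comp[OF bounded_linear_ident bounded_bilinear.bounded_linear_prod_left[OF assms]])
qed

lemma bounded_bilinear_right_factor:
  fixes pr :: "'b::real_normed_vector \<Rightarrow> 'c::real_normed_vector \<Rightarrow> 'd::real_normed_vector"
  assumes "bounded_bilinear pr"
  shows "bounded_bilinear (\<lambda>b (G :: 'a::real_normed_vector \<Rightarrow>\<^sub>L 'c). bounded_bilinear.prod_right pr b o\<^sub>L G)"
proof -
  interpret comp: bounded_bilinear "\<lambda>(K :: 'c \<Rightarrow>\<^sub>L 'd) (G :: 'a \<Rightarrow>\<^sub>L 'c). K o\<^sub>L G"
    by (rule bounded_bilinear_blinfun_compose)
  show ?thesis
    by (rule comp.comp1[OF bounded_bilinear.bounded_linear_prod_right[OF assms]])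
qed

lemma blinfun_derivative_bilinear:
  fixes f' :: "'a::real_normed_vector \<Rightarrow>\<^sub>L 'b::real_normed_vector" and g' :: "'a \<Rightarrow>\<^sub>L 'c::real_normed_vector"
  assumes p: "bounded_bilinear pr"
    and "(f has_derivative blinfun_apply f') (at x)" "(g has_derivative blinfun_apply g') (at x)"
  shows "((\<lambda>x. pr (f x) (g x)) has_derivative blinfun_apply
    ((bounded_bilinear.prod_left pr (g x) o\<^sub>L f') + (bounded_bilinear.prod_right pr (f x) o\<^sub>L g'))) (at x)"
  using bounded_bilinear.FDERIV[OF assms]
  by (rule has_derivative_eq_rhs)
    (auto simp: fun_eq_iff plus_blinfun.rep_eq bounded_bilinear.prod_left.rep_eq[OF p]
        bounded_bilinear.prod_right.rep_eq[OF p] add.commute)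

lemma Cb0_bilinear:
  assumes "bounded_bilinear pr" "Cb0 f" "Cb0 g"
  shows "Cb0 (\<lambda>x. pr (f x) (g x))"
  unfolding Cb0_def
proof
  show "continuous_on UNIV (\<lambda>x. pr (f x) (g x))"
    by (rule bounded_bilinear.continuous_on[OF assms(1)]) (use assms in \<open>simp_all add: Cb0_def\<close>)
  show "bounded (range (\<lambda>x. pr (f x) (g x)))"
    by (rule bounded_range_bilinear[OF assms(1)]) (use assms in \<open>simp_all add: Cb0_def\<close>)
qed

text \<open>The three predicates \<open>Pf\<close>, \<open>Pg\<close> and \<open>P\<close> stand for
  one class at three different types of derivatives. Closedness of \<open>P\<close> under addition
  joins the two summands of the product rule.\<close>

lemma Cb_step_bilinear:
  fixes f :: "'a::real_normed_vector \<Rightarrow> 'b::real_normed_vector" and g :: "'a \<Rightarrow> 'c::real_normed_vector"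
  assumes p: "bounded_bilinear pr" and f: "Cb_step Pf f" and g: "Cb_step Pg g"
    and L: "\<And>f'. Pf f' \<Longrightarrow> P (\<lambda>x. bounded_bilinear.prod_left pr (g x) o\<^sub>L f' x)"
    and R: "\<And>g'. Pg g' \<Longrightarrow> P (\<lambda>x. bounded_bilinear.prod_right pr (f x) o\<^sub>L g' x)"
    and add: "\<And>F G. P F \<Longrightarrow> P G \<Longrightarrow> P (\<lambda>x. F x + G x)"
  shows "Cb_step P (\<lambda>x. pr (f x) (g x))"
proof -
  from f obtain f' where f': "bounded (range f)" "\<And>x. (f has_derivative blinfun_apply (f' x)) (at x)" "Pf f'"
    unfolding Cb_step_def by blast
  from g obtain g' where g': "bounded (range g)" "\<And>x. (g has_derivative blinfun_apply (g' x)) (at x)" "Pg g'"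
    unfolding Cb_step_def by blast
  show ?thesis
  proof (rule Cb_stepI)
    show "bounded (range (\<lambda>x. pr (f x) (g x)))" by (rule bounded_range_bilinear) fact+
    show "((\<lambda>x. pr (f x) (g x)) has_derivative blinfun_apply ((bounded_bilinear.prod_left pr (g x) o\<^sub>L f' x)
        + (bounded_bilinear.prod_right pr (f x) o\<^sub>L g' x))) (at x)" for x
      by (rule blinfun_derivative_bilinear) fact+
    show "P (\<lambda>x. (bounded_bilinear.prod_left pr (g x) o\<^sub>L f' x) + (bounded_bilinear.prod_right pr (f x) o\<^sub>L g' x))"
      by (intro add L R f'(3) g'(3))
  qed
qed

text \<open>The product rule pairs the derivative of one factor with the other factor
  undifferentiated, so the latter has to be demoted by one order.\<close>

lemma Cb1_imp_Cb0: "Cb1 f \<Longrightarrow> Cb0 f"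
  unfolding Cb1_def Cb_step_def Cb0_def
  by (meson continuous_at_imp_continuous_on has_derivative_continuous)

lemma Cb2_imp_Cb1:
  assumes "Cb2 f"
  shows "Cb1 f"
  unfolding Cb1_def
proof (rule Cb_step_mono)
  show "Cb_step Cb1 f" using assms unfolding Cb2_def .
qed (rule Cb1_imp_Cb0)

lemma Cb3_imp_Cb2:
  assumes "Cb3 f"
  shows "Cb2 f"
  unfolding Cb2_def
proof (rule Cb_step_mono)
  show "Cb_step Cb2 f" using assms unfolding Cb3_def .
qed (rule Cb2_imp_Cb1)

lemma Cb4_imp_Cb3:
  assumes "Cb4 f"
  shows "Cb3 f"
  unfolding Cb3_def
proof (rule Cb_step_mono)
  show "Cb_step Cb3 f" using assms unfolding Cb4_def .
qed (rule Cb3_imp_Cb2)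

lemma Cb1_bilinear:
  fixes f :: "'a::real_normed_vector \<Rightarrow> 'b::real_normed_vector" and g :: "'a \<Rightarrow> 'c::real_normed_vector"
  assumes p: "bounded_bilinear pr" and f: "Cb1 f" and g: "Cb1 g"
  shows "Cb1 (\<lambda>x. pr (f x) (g x))"
  unfolding Cb1_def
proof (rule Cb_step_bilinear[OF p])
  show "Cb_step Cb0 f" "Cb_step Cb0 g" using f g unfolding Cb1_def .
  show "Cb0 (\<lambda>x. bounded_bilinear.prod_left pr (g x) o\<^sub>L f' x)" if "Cb0 f'" for f' :: "'a \<Rightarrow> 'a \<Rightarrow>\<^sub>L 'b"
    by (rule Cb0_bilinear[OF bounded_bilinear_left_factor[OF p] that Cb1_imp_Cb0[OF g]])
  show "Cb0 (\<lambda>x. bounded_bilinear.prod_right pr (f x) o\<^sub>L g' x)" if "Cb0 g'" for g' :: "'a \<Rightarrow> 'a \<Rightarrow>\<^sub>L 'c"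
    by (rule Cb0_bilinear[OF bounded_bilinear_right_factor[OF p] Cb1_imp_Cb0[OF f] that])
qed (rule Cb0_add)

lemma Cb2_bilinear:
  fixes f :: "'a::real_normed_vector \<Rightarrow> 'b::real_normed_vector" and g :: "'a \<Rightarrow> 'c::real_normed_vector"
  assumes p: "bounded_bilinear pr" and f: "Cb2 f" and g: "Cb2 g"
  shows "Cb2 (\<lambda>x. pr (f x) (g x))"
  unfolding Cb2_def
proof (rule Cb_step_bilinear[OF p])
  show "Cb_step Cb1 f" "Cb_step Cb1 g" using f g unfolding Cb2_def .
  show "Cb1 (\<lambda>x. bounded_bilinear.prod_left pr (g x) o\<^sub>L f' x)" if "Cb1 f'" for f' :: "'a \<Rightarrow> 'a \<Rightarrow>\<^sub>L 'b"
    by (rule Cb1_bilinear[OF bounded_bilinear_left_factor[OF p] that Cb2_imp_Cb1[OF g]])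
  show "Cb1 (\<lambda>x. bounded_bilinear.prod_right pr (f x) o\<^sub>L g' x)" if "Cb1 g'" for g' :: "'a \<Rightarrow> 'a \<Rightarrow>\<^sub>L 'c"
    by (rule Cb1_bilinear[OF bounded_bilinear_right_factor[OF p] Cb2_imp_Cb1[OF f] that])
qed (rule Cb1_add)

lemma Cb3_bilinear:
  fixes f :: "'a::real_normed_vector \<Rightarrow> 'b::real_normed_vector" and g :: "'a \<Rightarrow> 'c::real_normed_vector"
  assumes p: "bounded_bilinear pr" and f: "Cb3 f" and g: "Cb3 g"
  shows "Cb3 (\<lambda>x. pr (f x) (g x))"
  unfolding Cb3_def
proof (rule Cb_step_bilinear[OF p])
  show "Cb_step Cb2 f" "Cb_step Cb2 g" using f g unfolding Cb3_def .
  show "Cb2 (\<lambda>x. bounded_bilinear.prod_left pr (g x) o\<^sub>L f' x)" if "Cb2 f'" for f' :: "'a \<Rightarrow> 'a \<Rightarrow>\<^sub>L 'b"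
    by (rule Cb2_bilinear[OF bounded_bilinear_left_factor[OF p] that Cb3_imp_Cb2[OF g]])
  show "Cb2 (\<lambda>x. bounded_bilinear.prod_right pr (f x) o\<^sub>L g' x)" if "Cb2 g'" for g' :: "'a \<Rightarrow> 'a \<Rightarrow>\<^sub>L 'c"
    by (rule Cb2_bilinear[OF bounded_bilinear_right_factor[OF p] Cb3_imp_Cb2[OF f] that])
qed (rule Cb2_add)

lemma Cb4_bilinear:
  fixes f :: "'a::real_normed_vector \<Rightarrow> 'b::real_normed_vector" and g :: "'a \<Rightarrow> 'c::real_normed_vector"
  assumes p: "bounded_bilinear pr" and f: "Cb4 f" and g: "Cb4 g"
  shows "Cb4 (\<lambda>x. pr (f x) (g x))"
  unfolding Cb4_def
proof (rule Cb_step_bilinear[OF p])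
  show "Cb_step Cb3 f" "Cb_step Cb3 g" using f g unfolding Cb4_def .
  show "Cb3 (\<lambda>x. bounded_bilinear.prod_left pr (g x) o\<^sub>L f' x)" if "Cb3 f'" for f' :: "'a \<Rightarrow> 'a \<Rightarrow>\<^sub>L 'b"
    by (rule Cb3_bilinear[OF bounded_bilinear_left_factor[OF p] that Cb4_imp_Cb3[OF g]])
  show "Cb3 (\<lambda>x. bounded_bilinear.prod_right pr (f x) o\<^sub>L g' x)" if "Cb3 g'" for g' :: "'a \<Rightarrow> 'a \<Rightarrow>\<^sub>L 'c"
    by (rule Cb3_bilinear[OF bounded_bilinear_right_factor[OF p] Cb4_imp_Cb3[OF f] that])
qed (rule Cb3_add)

lemma Cb_step_const:
  assumes "P (\<lambda>_. 0)"
  shows "Cb_step P (\<lambda>_. c)"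
proof (rule Cb_stepI)
  show "((\<lambda>_. c) has_derivative blinfun_apply 0) (at x)" for x
    by (rule has_derivative_eq_rhs[OF has_derivative_const]) (simp add: fun_eq_iff)
  show "P (\<lambda>_. 0)" by fact
qed (simp add: image_constant_conv)

lemma Cb0_const: "Cb0 (\<lambda>_. c)"
  unfolding Cb0_def by (auto simp: image_constant_conv)

lemma Cb1_const: "Cb1 (\<lambda>_. c)"
  unfolding Cb1_def by (rule Cb_step_const) (rule Cb0_const)

lemma Cb2_const: "Cb2 (\<lambda>_. c)"
  unfolding Cb2_def by (rule Cb_step_const) (rule Cb1_const)

lemma Cb3_const: "Cb3 (\<lambda>_. c)"
  unfolding Cb3_def by (rule Cb_step_const) (rule Cb2_const)

lemma Cb4_const: "Cb4 (\<lambda>_. c)"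
  unfolding Cb4_def by (rule Cb_step_const) (rule Cb3_const)

section \<open>Gaussian functions and their gradients\<close>

definition gauss :: "real \<Rightarrow> 'a::real_inner \<Rightarrow> real" where
  "gauss c x = exp (- c * (norm x)\<^sup>2)"

text \<open>Up to a constant this is the gradient of \<open>gauss c\<close>. Differentiating
  \<open>gauss\<close> and this field produces nothing but bilinear combinations of the two, so the
  pair is closed under the induction on the order.\<close>

definition gauss_id :: "real \<Rightarrow> 'a::real_inner \<Rightarrow> 'a" where
  "gauss_id c x = gauss c x *\<^sub>R x"

lift_definition inner_blinfun :: "'a::real_inner \<Rightarrow> 'a \<Rightarrow>\<^sub>L real" is inner
  by (rule bounded_linear_inner_right)

lemma bounded_linear_inner_blinfun: "bounded_linear inner_blinfun"
  by transfer (rule bounded_bilinear_inner)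

lemma bounded_bilinear_scaleR_inner: "bounded_bilinear (\<lambda>c x. c *\<^sub>R inner_blinfun x)"
  by (rule bounded_bilinear.flip[OF bounded_bilinear.comp1[OF
        bounded_bilinear.flip[OF bounded_bilinear_scaleR] bounded_linear_inner_blinfun]])

lemma bounded_bilinear_rank_one:
  "bounded_bilinear (\<lambda>x y. blinfun_scaleR_left y o\<^sub>L inner_blinfun (x::'a::real_inner) :: 'a \<Rightarrow>\<^sub>L 'a)"
  by (rule bounded_bilinear.flip[OF bounded_bilinear.comp[OF bounded_bilinear_blinfun_compose
     bounded_linear_blinfun_scaleR_left bounded_linear_inner_blinfun]])

lemma has_derivative_gauss:
  fixes x :: "'a::real_inner"
  shows "(gauss c has_derivative blinfun_apply ((- 2 * c) *\<^sub>R inner_blinfun (gauss_id c x))) (at x)"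
proof -
  have "((\<lambda>x. exp (- c * (x \<bullet> x))) has_derivative blinfun_apply ((- 2 * c) *\<^sub>R inner_blinfun (gauss_id c x))) (at x)"
    by (auto intro!: derivative_eq_intros simp: fun_eq_iff blinfun.bilinear_simps inner_blinfun.rep_eq
        gauss_id_def gauss_def power2_norm_eq_inner inner_commute algebra_simps)
  moreover have "gauss c = (\<lambda>x::'a. exp (- c * (x \<bullet> x)))"
    by (simp add: fun_eq_iff gauss_def power2_norm_eq_inner)
  ultimately show ?thesis by simp
qed

text \<open>The product rule yields the rank one operator formed from x twice, times the Gaussian.
  As x alone is unbounded, the Gaussian is split into two factors with parameter
  \<open>c / 2\<close>, one for each x.\<close>

lemma has_derivative_gauss_id:
  "(gauss_id c has_derivative blinfun_apply (gauss c x *\<^sub>R id_blinfun +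
     (- 2 * c) *\<^sub>R (blinfun_scaleR_left (gauss_id (c / 2) x) o\<^sub>L inner_blinfun (gauss_id (c / 2) x)))) (at x)"
proof -
  have sq: "gauss (c / 2) x * gauss (c / 2) x = gauss c x" for x :: 'a
    by (simp add: gauss_def flip: exp_add)
  have eq: "gauss_id c = (\<lambda>x::'a. gauss c x *\<^sub>R x)"
    by (simp add: fun_eq_iff gauss_id_def)
  show ?thesis
    unfolding eq
    by (rule has_derivative_eq_rhs, rule has_derivative_scaleR[OF has_derivative_gauss has_derivative_ident])
      (simp add: fun_eq_iff blinfun.bilinear_simps inner_blinfun.rep_eq gauss_id_def sq[symmetric] mult.assoc)
qed

lemma gauss_bounded: "0 < c \<Longrightarrow> bounded (range (gauss c))"
  unfolding bounded_iff by (auto intro!: exI[of _ 1] simp: gauss_def)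

text \<open>The linear factor loses against the Gaussian: the norm is at most 1 + |x|^2, hence at
  most (1 + 1/c) (1 + c |x|^2), and the last bracket is below exp(c |x|^2).\<close>

lemma gauss_id_bounded:
  assumes c: "0 < c"
  shows "bounded (range (gauss_id c :: 'a::real_inner \<Rightarrow> 'a))"
  unfolding bounded_iff
proof (intro exI ballI, safe)
  fix x :: 'a
  have "2 * norm x \<le> 1 + (norm x)\<^sup>2"
    using zero_le_power2[of "norm x - 1"] by (simp add: power2_eq_square algebra_simps)
  moreover have "1 + (norm x)\<^sup>2 \<le> (1 + 1 / c) * (1 + c * (norm x)\<^sup>2)"
    using c by (simp add: field_simps)
  ultimately have "norm x \<le> (1 + 1 / c) * (1 + c * (norm x)\<^sup>2)"
    using norm_ge_zero[of x] by linarith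
  also have "\<dots> \<le> (1 + 1 / c) * exp (c * (norm x)\<^sup>2)"
    using c by (intro mult_left_mono exp_ge_add_one_self) auto
  finally have "norm x \<le> (1 + 1 / c) * exp (c * (norm x)\<^sup>2)" .
  then show "norm (gauss_id c x) \<le> 1 + 1 / c"
    by (simp add: gauss_id_def gauss_def exp_minus field_simps)
qed

lemma Cb_step_gauss:
  assumes "0 < c" "P (\<lambda>x. (- 2 * c) *\<^sub>R inner_blinfun (gauss_id c x))"
  shows "Cb_step P (gauss c)"
  using assms by (intro Cb_stepI[OF gauss_bounded has_derivative_gauss])

lemma Cb_step_gauss_id:
  assumes "0 < c"
    and "P (\<lambda>x. gauss c x *\<^sub>R id_blinfun +
     (- 2 * c) *\<^sub>R (blinfun_scaleR_left (gauss_id (c / 2) x) o\<^sub>L inner_blinfun (gauss_id (c / 2) x)))"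
  shows "Cb_step P (gauss_id c)"
  using assms by (intro Cb_stepI[OF gauss_id_bounded has_derivative_gauss_id])

lemma Cb0_gauss:
  assumes "0 < c"
  shows "Cb0 (gauss c :: 'a::real_inner \<Rightarrow> real)" "Cb0 (gauss_id c :: 'a \<Rightarrow> 'a)"
  unfolding Cb0_def
  using assms gauss_bounded gauss_id_bounded has_derivative_continuous[OF has_derivative_gauss]
    has_derivative_continuous[OF has_derivative_gauss_id] continuous_at_imp_continuous_on
  by (metis UNIV_I)+

text \<open>Both claims go together and for every positive parameter: the derivative of
  \<open>gauss\<close> involves \<open>gauss_id\<close>, that of \<open>gauss_id\<close> involves
  \<open>gauss\<close> and also \<open>gauss_id\<close> at half the parameter. The higher orders
  repeat this argument.\<close>

lemma Cb1_gauss: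
  assumes "0 < c"
  shows "Cb1 (gauss c :: 'a::real_inner \<Rightarrow> real)" "Cb1 (gauss_id c :: 'a \<Rightarrow> 'a)"
proof -
  have "Cb0 (\<lambda>x::'a. (- 2 * c) *\<^sub>R inner_blinfun (gauss_id c x))"
    by (rule Cb0_bilinear[OF bounded_bilinear_scaleR_inner Cb0_const Cb0_gauss(2)[OF assms]])
  then show "Cb1 (gauss c :: 'a \<Rightarrow> real)"
    unfolding Cb1_def by (rule Cb_step_gauss[OF assms])
  have "Cb0 (\<lambda>x::'a. gauss c x *\<^sub>R (id_blinfun :: 'a \<Rightarrow>\<^sub>L 'a))"
    by (rule Cb0_bilinear[OF bounded_bilinear_scaleR Cb0_gauss(1)[OF assms] Cb0_const])
  moreover have "Cb0 (\<lambda>x::'a. blinfun_scaleR_left (gauss_id (c / 2) x) o\<^sub>L inner_blinfun (gauss_id (c / 2) x))"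
    by (rule Cb0_bilinear[OF bounded_bilinear_rank_one]) (rule Cb0_gauss(2), use assms in simp)+
  then have "Cb0 (\<lambda>x::'a. (- 2 * c) *\<^sub>R (blinfun_scaleR_left (gauss_id (c / 2) x) o\<^sub>L inner_blinfun (gauss_id (c / 2) x)))"
    by (rule Cb0_bilinear[OF bounded_bilinear_scaleR Cb0_const])
  ultimately have "Cb0 (\<lambda>x::'a. gauss c x *\<^sub>R id_blinfun +
      (- 2 * c) *\<^sub>R (blinfun_scaleR_left (gauss_id (c / 2) x) o\<^sub>L inner_blinfun (gauss_id (c / 2) x)))"
    by (rule Cb0_add)
  then show "Cb1 (gauss_id c :: 'a \<Rightarrow> 'a)"
    unfolding Cb1_def by (rule Cb_step_gauss_id[OF assms])
qed

lemma Cb2_gauss: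
  assumes "0 < c"
  shows "Cb2 (gauss c :: 'a::real_inner \<Rightarrow> real)" "Cb2 (gauss_id c :: 'a \<Rightarrow> 'a)"
proof -
  have "Cb1 (\<lambda>x::'a. (- 2 * c) *\<^sub>R inner_blinfun (gauss_id c x))"
    by (rule Cb1_bilinear[OF bounded_bilinear_scaleR_inner Cb1_const Cb1_gauss(2)[OF assms]])
  then show "Cb2 (gauss c :: 'a \<Rightarrow> real)"
    unfolding Cb2_def by (rule Cb_step_gauss[OF assms])
  have "Cb1 (\<lambda>x::'a. gauss c x *\<^sub>R (id_blinfun :: 'a \<Rightarrow>\<^sub>L 'a))"
    by (rule Cb1_bilinear[OF bounded_bilinear_scaleR Cb1_gauss(1)[OF assms] Cb1_const])
  moreover have "Cb1 (\<lambda>x::'a. blinfun_scaleR_left (gauss_id (c / 2) x) o\<^sub>L inner_blinfun (gauss_id (c / 2) x))"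
    by (rule Cb1_bilinear[OF bounded_bilinear_rank_one]) (rule Cb1_gauss(2), use assms in simp)+
  then have "Cb1 (\<lambda>x::'a. (- 2 * c) *\<^sub>R (blinfun_scaleR_left (gauss_id (c / 2) x) o\<^sub>L inner_blinfun (gauss_id (c / 2) x)))"
    by (rule Cb1_bilinear[OF bounded_bilinear_scaleR Cb1_const])
  ultimately have "Cb1 (\<lambda>x::'a. gauss c x *\<^sub>R id_blinfun +
      (- 2 * c) *\<^sub>R (blinfun_scaleR_left (gauss_id (c / 2) x) o\<^sub>L inner_blinfun (gauss_id (c / 2) x)))"
    by (rule Cb1_add)
  then show "Cb2 (gauss_id c :: 'a \<Rightarrow> 'a)"
    unfolding Cb2_def by (rule Cb_step_gauss_id[OF assms])
qed

lemma Cb3_gauss: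
  assumes "0 < c"
  shows "Cb3 (gauss c :: 'a::real_inner \<Rightarrow> real)" "Cb3 (gauss_id c :: 'a \<Rightarrow> 'a)"
proof -
  have "Cb2 (\<lambda>x::'a. (- 2 * c) *\<^sub>R inner_blinfun (gauss_id c x))"
    by (rule Cb2_bilinear[OF bounded_bilinear_scaleR_inner Cb2_const Cb2_gauss(2)[OF assms]])
  then show "Cb3 (gauss c :: 'a \<Rightarrow> real)"
    unfolding Cb3_def by (rule Cb_step_gauss[OF assms])
  have "Cb2 (\<lambda>x::'a. gauss c x *\<^sub>R (id_blinfun :: 'a \<Rightarrow>\<^sub>L 'a))"
    by (rule Cb2_bilinear[OF bounded_bilinear_scaleR Cb2_gauss(1)[OF assms] Cb2_const])
  moreover have "Cb2 (\<lambda>x::'a. blinfun_scaleR_left (gauss_id (c / 2) x) o\<^sub>L inner_blinfun (gauss_id (c / 2) x))"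
    by (rule Cb2_bilinear[OF bounded_bilinear_rank_one]) (rule Cb2_gauss(2), use assms in simp)+
  then have "Cb2 (\<lambda>x::'a. (- 2 * c) *\<^sub>R (blinfun_scaleR_left (gauss_id (c / 2) x) o\<^sub>L inner_blinfun (gauss_id (c / 2) x)))"
    by (rule Cb2_bilinear[OF bounded_bilinear_scaleR Cb2_const])
  ultimately have "Cb2 (\<lambda>x::'a. gauss c x *\<^sub>R id_blinfun +
      (- 2 * c) *\<^sub>R (blinfun_scaleR_left (gauss_id (c / 2) x) o\<^sub>L inner_blinfun (gauss_id (c / 2) x)))"
    by (rule Cb2_add)
  then show "Cb3 (gauss_id c :: 'a \<Rightarrow> 'a)"
    unfolding Cb3_def by (rule Cb_step_gauss_id[OF assms])
qed

lemma Cb4_gauss: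
  assumes "0 < c"
  shows "Cb4 (gauss c :: 'a::real_inner \<Rightarrow> real)" "Cb4 (gauss_id c :: 'a \<Rightarrow> 'a)"
proof -
  have "Cb3 (\<lambda>x::'a. (- 2 * c) *\<^sub>R inner_blinfun (gauss_id c x))"
    by (rule Cb3_bilinear[OF bounded_bilinear_scaleR_inner Cb3_const Cb3_gauss(2)[OF assms]])
  then show "Cb4 (gauss c :: 'a \<Rightarrow> real)"
    unfolding Cb4_def by (rule Cb_step_gauss[OF assms])
  have "Cb3 (\<lambda>x::'a. gauss c x *\<^sub>R (id_blinfun :: 'a \<Rightarrow>\<^sub>L 'a))"
    by (rule Cb3_bilinear[OF bounded_bilinear_scaleR Cb3_gauss(1)[OF assms] Cb3_const])
  moreover have "Cb3 (\<lambda>x::'a. blinfun_scaleR_left (gauss_id (c / 2) x) o\<^sub>L inner_blinfun (gauss_id (c / 2) x))"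
    by (rule Cb3_bilinear[OF bounded_bilinear_rank_one]) (rule Cb3_gauss(2), use assms in simp)+
  then have "Cb3 (\<lambda>x::'a. (- 2 * c) *\<^sub>R (blinfun_scaleR_left (gauss_id (c / 2) x) o\<^sub>L inner_blinfun (gauss_id (c / 2) x)))"
    by (rule Cb3_bilinear[OF bounded_bilinear_scaleR Cb3_const])
  ultimately have "Cb3 (\<lambda>x::'a. gauss c x *\<^sub>R id_blinfun +
      (- 2 * c) *\<^sub>R (blinfun_scaleR_left (gauss_id (c / 2) x) o\<^sub>L inner_blinfun (gauss_id (c / 2) x)))"
    by (rule Cb3_add)
  then show "Cb4 (gauss_id c :: 'a \<Rightarrow> 'a)"
    unfolding Cb4_def by (rule Cb_step_gauss_id[OF assms])
qed

lemma gauss_in_C5b: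
  assumes "0 < c"
  shows "(gauss c :: 'a::real_inner \<Rightarrow> real) \<in> C5b"
proof (rule Cb5_imp_C5b)
  have "Cb4 (\<lambda>x::'a. (- 2 * c) *\<^sub>R inner_blinfun (gauss_id c x))"
    by (rule Cb4_bilinear[OF bounded_bilinear_scaleR_inner Cb4_const Cb4_gauss(2)[OF assms]])
  then show "Cb5 (gauss c :: 'a \<Rightarrow> real)"
    unfolding Cb5_def by (rule Cb_step_gauss[OF assms])
qed

section \<open>Orthonormal bases and diagonal operators\<close>

locale onb =
  fixes HH :: "'a::{real_inner,banach} set"
  assumes basis: "orthonormal_basis HH"
begin

lemma inner_basis: "c \<in> HH \<Longrightarrow> d \<in> HH \<Longrightarrow> c \<bullet> d = (if c = d then 1 else 0)"
  using basis unfolding orthonormal_basis_def by blast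

lemma inner_finite_sum:
  assumes "finite F" "F \<subseteq> HH" "c \<in> HH"
  shows "c \<bullet> (\<Sum>d\<in>F. f d *\<^sub>R d) = (if c \<in> F then f c else 0)"
proof -
  have "c \<bullet> (\<Sum>d\<in>F. f d *\<^sub>R d) = (\<Sum>d\<in>F. if d = c then f c else 0)"
    unfolding inner_sum_right using assms by (intro sum.cong) (auto simp: inner_basis subset_iff)
  then show ?thesis using assms by simp
qed

lemma norm_finite_sum:
  assumes "finite F" "F \<subseteq> HH"
  shows "(norm (\<Sum>d\<in>F. f d *\<^sub>R d))\<^sup>2 = (\<Sum>d\<in>F. (f d)\<^sup>2)"
proof -
  have "(norm (\<Sum>d\<in>F. f d *\<^sub>R d))\<^sup>2 = (\<Sum>c\<in>F. f c * (c \<bullet> (\<Sum>d\<in>F. f d *\<^sub>R d)))"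
    unfolding power2_norm_eq_inner inner_sum_left by simp
  also have "\<dots> = (\<Sum>d\<in>F. (f d)\<^sup>2)"
    using assms by (intro sum.cong) (auto simp: inner_finite_sum subset_iff power2_eq_square)
  finally show ?thesis .
qed

lemma bessel:
  assumes "finite F" "F \<subseteq> HH"
  shows "(\<Sum>c\<in>F. (c \<bullet> v)\<^sup>2) \<le> (norm v)\<^sup>2"
proof -
  define w where "w = (\<Sum>c\<in>F. (c \<bullet> v) *\<^sub>R c)"
  have "w \<bullet> v = (\<Sum>c\<in>F. (c \<bullet> v)\<^sup>2)"
    unfolding w_def inner_sum_left by (simp add: power2_eq_square)
  moreover have "(norm w)\<^sup>2 = (\<Sum>c\<in>F. (c \<bullet> v)\<^sup>2)"
    unfolding w_def using assms by (rule norm_finite_sum)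
  moreover have "(norm (v - w))\<^sup>2 = (norm v)\<^sup>2 - 2 * (w \<bullet> v) + (norm w)\<^sup>2"
    by (simp add: power2_norm_eq_inner inner_diff inner_commute algebra_simps)
  ultimately show ?thesis
    using zero_le_power2[of "norm (v - w)"] by linarith
qed

lemma summable_coeffs: "(\<lambda>c. (c \<bullet> v)\<^sup>2) summable_on HH"
  by (rule nonneg_bdd_above_summable_on) (auto simp: bdd_above_def intro!: exI[of _ "(norm v)\<^sup>2"] bessel)

text \<open>By Pythagoras the squared distance of two nested partial sums is a piece of the tail of
  the square series. So the net of partial sums is Cauchy, and completeness of the space gives a
  limit.\<close>

lemma summable_orthogonal:
  assumes f: "(\<lambda>c. (f c)\<^sup>2) summable_on HH"
  shows "(\<lambda>c. f c *\<^sub>R c) summable_on HH"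
proof -
  let ?s = "\<lambda>F. \<Sum>c\<in>F. f c *\<^sub>R c"
  let ?at = "finite_subsets_at_top HH"
  have "cauchy_filter (filtermap ?s ?at)"
    unfolding cauchy_filter_metric_filtermap
  proof (intro allI impI)
    fix e :: real assume e: "e > 0"
    from f obtain S where S: "((\<lambda>c. (f c)\<^sup>2) has_sum S) HH"
      by (auto simp: summable_on_def)
    obtain F0 where F0: "finite F0" "F0 \<subseteq> HH" "dist (sum (\<lambda>c. (f c)\<^sup>2) F0) S \<le> (e / 3)\<^sup>2"
      using has_sum_finite_approximation[OF S, of "(e / 3)\<^sup>2"] e by auto
    have close: "dist (?s F) (?s F0) < e / 2" if F: "finite F" "F \<subseteq> HH" "F0 \<subseteq> F" for F
    proof -
      have "?s F - ?s F0 = ?s (F - F0)"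
        using F F0 by (simp add: sum_diff)
      then have "(dist (?s F) (?s F0))\<^sup>2 = (\<Sum>c\<in>F - F0. (f c)\<^sup>2)"
        using F by (simp add: dist_norm norm_finite_sum subset_iff)
      also have "\<dots> = sum (\<lambda>c. (f c)\<^sup>2) F - sum (\<lambda>c. (f c)\<^sup>2) F0"
        using F F0 by (simp add: sum_diff)
      also have "\<dots> \<le> S - sum (\<lambda>c. (f c)\<^sup>2) F0"
        using finite_sum_le_has_sum[OF S F(1,2)] by simp
      also have "\<dots> \<le> (e / 3)\<^sup>2"
        using F0 by (simp add: dist_real_def)
      finally have "dist (?s F) (?s F0) \<le> e / 3"
        by (rule power2_le_imp_le) (use e in simp)
      then show ?thesis using e by linarith
    qed
    have "eventually (\<lambda>F. finite F \<and> F0 \<subseteq> F \<and> F \<subseteq> HH) ?at"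
      unfolding eventually_finite_subsets_at_top using F0 by blast
    moreover have "dist (?s F) (?s G) < e" if "finite F \<and> F0 \<subseteq> F \<and> F \<subseteq> HH" "finite G \<and> F0 \<subseteq> G \<and> G \<subseteq> HH" for F G
      using close[of F] close[of G] that dist_triangle2[of "?s F" "?s G" "?s F0"] by auto
    ultimately show "\<exists>P. eventually P ?at \<and> (\<forall>F G. P F \<and> P G \<longrightarrow> dist (?s F) (?s G) < e)"
      by (intro exI[of _ "\<lambda>F. finite F \<and> F0 \<subseteq> F \<and> F \<subseteq> HH"] conjI allI impI) (auto simp del: dist_norm)
  qed
  then obtain L where "filtermap ?s ?at \<le> nhds L"
    using cauchy_filter_convergent[of "filtermap ?s ?at"] by (auto simp: convergent_filter_iff filtermap_bot_iff)
  then have "(?s \<longlongrightarrow> L) ?at"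
    by (simp add: filterlim_def)
  then show ?thesis
    using summable_on_def has_sum_def by blast
qed

lemma inner_infsum_orthogonal:
  assumes "(\<lambda>c. (f c)\<^sup>2) summable_on HH" "c \<in> HH"
  shows "c \<bullet> (\<Sum>\<^sub>\<infinity>d\<in>HH. f d *\<^sub>R d) = f c"
proof -
  have "((\<lambda>d. f d *\<^sub>R d) has_sum (\<Sum>\<^sub>\<infinity>d\<in>HH. f d *\<^sub>R d)) HH"
    using summable_orthogonal[OF assms(1)] by simp
  then have "((\<lambda>d. c \<bullet> (f d *\<^sub>R d)) has_sum (c \<bullet> (\<Sum>\<^sub>\<infinity>d\<in>HH. f d *\<^sub>R d))) HH"
    by (rule has_sum_bounded_linear[OF bounded_linear_inner_right])
  moreover have "((\<lambda>d. c \<bullet> (f d *\<^sub>R d)) has_sum f c) HH"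
    by (rule has_sum_finite_neutralI[where B="{c}"]) (use assms(2) in \<open>auto simp: inner_basis\<close>)
  ultimately show ?thesis
    by (rule has_sum_unique)
qed

text \<open>The orthogonal complement of v is a closed subspace containing the basis, hence
  everything, hence v itself.\<close>

lemma eq_zeroI:
  assumes "\<And>c. c \<in> HH \<Longrightarrow> c \<bullet> v = 0"
  shows "v = 0"
proof -
  have "subspace {w. w \<bullet> v = 0}"
    by (auto simp: subspace_def inner_add_left)
  then have "span HH \<subseteq> {w. w \<bullet> v = 0}"
    using assms by (intro span_minimal) auto
  moreover have "closed {w. w \<bullet> v = 0}"
    by (intro closed_Collect_eq continuous_intros)
  ultimately have "closure (span HH) \<subseteq> {w. w \<bullet> v = 0}"
    by (rule closure_minimal)
  then have "v \<in> {w. w \<bullet> v = 0}"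
    using basis unfolding orthonormal_basis_def by blast
  then show ?thesis by simp
qed

lemma eqI:
  assumes "\<And>c. c \<in> HH \<Longrightarrow> c \<bullet> v = c \<bullet> w"
  shows "v = w"
  using eq_zeroI[of "v - w"] assms by (simp add: inner_diff_right)

lemma expansion: "((\<lambda>c. (c \<bullet> v) *\<^sub>R c) has_sum v) HH"
proof -
  have "(\<Sum>\<^sub>\<infinity>d\<in>HH. (d \<bullet> v) *\<^sub>R d) = v"
    by (rule eqI) (simp add: inner_infsum_orthogonal summable_coeffs)
  then show ?thesis
    using summable_orthogonal[OF summable_coeffs[of v]] by (metis has_sum_infsum)
qed

lemma parseval: "((\<lambda>c. (c \<bullet> v)\<^sup>2) has_sum (norm v)\<^sup>2) HH"
proof -
  have "((\<lambda>c. v \<bullet> ((c \<bullet> v) *\<^sub>R c)) has_sum v \<bullet> v) HH"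
    by (rule has_sum_bounded_linear[OF bounded_linear_inner_right expansion])
  then show ?thesis
    by (simp add: power2_norm_eq_inner inner_commute flip: power2_eq_square)
qed

lemma norm_mono:
  assumes "\<And>c. c \<in> HH \<Longrightarrow> \<bar>c \<bullet> v\<bar> \<le> \<bar>c \<bullet> w\<bar>"
  shows "norm v \<le> norm w"
proof -
  have "(norm v)\<^sup>2 \<le> (norm w)\<^sup>2"
    using has_sum_mono[OF parseval parseval] assms abs_le_square_iff by blast
  then show ?thesis by simp
qed

lemma inner_diag_op: "v \<in> diag_dom HH g \<Longrightarrow> c \<in> HH \<Longrightarrow> c \<bullet> diag_op HH g v = g c * (c \<bullet> v)"
  unfolding diag_dom_def diag_op_def by (rule inner_infsum_orthogonal) auto

lemma bounded_diag_dom: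
  assumes "\<And>c. c \<in> HH \<Longrightarrow> \<bar>g c\<bar> \<le> C"
  shows "v \<in> diag_dom HH g"
proof -
  have "(\<lambda>c. C\<^sup>2 * (c \<bullet> v)\<^sup>2) summable_on HH"
    by (intro summable_on_cmult_right summable_coeffs)
  moreover have "\<bar>g c * (c \<bullet> v)\<bar>\<^sup>2 \<le> C\<^sup>2 * (c \<bullet> v)\<^sup>2" if "c \<in> HH" for c
    using power_mono[OF assms[OF that], of 2] by (simp add: power_mult_distrib mult_right_mono)
  ultimately show ?thesis
    unfolding diag_dom_def mem_Collect_eq by (rule summable_on_comparison_test) auto
qed

lemma diag_dom_basis: "c \<in> HH \<Longrightarrow> c \<in> diag_dom HH g"
  unfolding diag_dom_def mem_Collect_eq
  by (rule summable_on_cong_neutral[THEN iffD1, OF _ _ _ summable_on_finite[of "{c}" "\<lambda>d. \<bar>g d * (d \<bullet> c)\<bar>\<^sup>2"]])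
     (auto simp: inner_basis)

lemma diag_dom_linear:
  assumes "v \<in> diag_dom HH g" "w \<in> diag_dom HH g"
  shows "a *\<^sub>R v + w \<in> diag_dom HH g"
proof -
  have "(\<lambda>c. 2 * a\<^sup>2 * \<bar>g c * (c \<bullet> v)\<bar>\<^sup>2 + 2 * \<bar>g c * (c \<bullet> w)\<bar>\<^sup>2) summable_on HH"
    using assms unfolding diag_dom_def by (intro summable_on_add summable_on_cmult_right) auto
  moreover have "\<bar>g c * (c \<bullet> (a *\<^sub>R v + w))\<bar>\<^sup>2 \<le> 2 * a\<^sup>2 * \<bar>g c * (c \<bullet> v)\<bar>\<^sup>2 + 2 * \<bar>g c * (c \<bullet> w)\<bar>\<^sup>2" for c
    using zero_le_power2[of "a * (g c * (c \<bullet> v)) - g c * (c \<bullet> w)"]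
    by (simp add: inner_add_right power2_eq_square algebra_simps)
  ultimately show ?thesis
    unfolding diag_dom_def mem_Collect_eq by (rule summable_on_comparison_test) auto
qed

lemma diag_op_linear:
  assumes "v \<in> diag_dom HH g" "w \<in> diag_dom HH g"
  shows "diag_op HH g (a *\<^sub>R v + w) = a *\<^sub>R diag_op HH g v + diag_op HH g w"
  using diag_dom_linear[OF assms]
  by (intro eqI) (simp add: inner_diag_op assms inner_add_right distrib_left mult.left_commute)

lemma diag_op_compose:
  assumes f: "\<And>c. c \<in> HH \<Longrightarrow> \<bar>f c\<bar> \<le> C" and g: "\<And>c. c \<in> HH \<Longrightarrow> \<bar>g c\<bar> \<le> D"
  shows "diag_op HH f (diag_op HH g v) = diag_op HH (\<lambda>c. f c * g c) v"
proof -
  have "\<bar>f c * g c\<bar> \<le> C * D" if "c \<in> HH" for c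
    unfolding abs_mult using f[OF that] g[OF that] by (intro mult_mono) auto
  then show ?thesis
    by (intro eqI) (simp add: inner_diag_op bounded_diag_dom[of _ C] bounded_diag_dom[of _ D]
      bounded_diag_dom[of _ "C * D"] f g)
qed

lemma diag_op_funpow:
  assumes "\<And>c. c \<in> HH \<Longrightarrow> \<bar>g c\<bar> \<le> 1"
  shows "(diag_op HH g ^^ k) v = diag_op HH (\<lambda>c. g c ^ k) v"
proof (induction k)
  case 0
  show ?case by (rule eqI) (simp add: inner_diag_op bounded_diag_dom[of _ 1])
next
  case (Suc k)
  have "\<bar>g c ^ k\<bar> \<le> 1" if "c \<in> HH" for c
    using assms[OF that] by (simp add: power_abs power_le_one)
  then show ?case
    using Suc diag_op_compose[where f=g and g="\<lambda>c. g c ^ k" and C=1 and D=1] assms by simp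
qed

text \<open>The resolvent inverts an unbounded operator on its domain. Besides injectivity, the
  candidate value must be shown to lie in that domain; this holds because the multiplier
  \<open>lam c / (1 - h * lam c)\<close> is bounded by \<open>1 / h\<close>.\<close>

lemma resolvent_op_eq:
  assumes h: "h > 0" and lam: "\<And>c. c \<in> HH \<Longrightarrow> lam c \<le> 0"
  shows "resolvent_op HH lam h v = diag_op HH (\<lambda>c. 1 / (1 - h * lam c)) v"
proof -
  let ?g = "\<lambda>c. 1 / (1 - h * lam c)"
  let ?f = "\<lambda>v. v - h *\<^sub>R diag_op HH lam v"
  have pos: "1 - h * lam c \<ge> 1" if "c \<in> HH" for c
    using mult_nonneg_nonpos[of h "lam c"] h lam[OF that] by auto
  have g: "\<bar>?g c\<bar> \<le> 1" if "c \<in> HH" for c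
    using pos[OF that] by simp
  have lg: "\<bar>lam c * ?g c\<bar> \<le> 1 / h" if "c \<in> HH" for c
    using pos[OF that] h lam[OF that] by (simp add: field_simps)
  have inner_f: "c \<bullet> ?f w = (1 - h * lam c) * (c \<bullet> w)" if "w \<in> diag_dom HH lam" "c \<in> HH" for c w
    using that by (simp add: inner_diff_right inner_diag_op algebra_simps)
  have "inj_on ?f (diag_dom HH lam)"
  proof (rule inj_onI)
    fix w z assume "w \<in> diag_dom HH lam" "z \<in> diag_dom HH lam" "?f w = ?f z"
    then show "w = z"
      using inner_f[of w] inner_f[of z] pos by (intro eqI) (metis mult_cancel_left not_one_le_zero)
  qed
  moreover have dom: "diag_op HH ?g v \<in> diag_dom HH lam"
  proof -
    have "v \<in> diag_dom HH (\<lambda>c. lam c * ?g c)"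
      by (rule bounded_diag_dom[OF lg])
    then have "(\<lambda>c. \<bar>lam c * ?g c * (c \<bullet> v)\<bar>\<^sup>2) summable_on HH"
      by (simp add: diag_dom_def)
    also have "?this \<longleftrightarrow> (\<lambda>c. \<bar>lam c * (c \<bullet> diag_op HH ?g v)\<bar>\<^sup>2) summable_on HH"
      by (rule summable_on_cong) (simp add: inner_diag_op bounded_diag_dom[OF g])
    finally show ?thesis
      by (simp add: diag_dom_def)
  qed
  moreover have "?f (diag_op HH ?g v) = v"
  proof (rule eqI)
    fix c assume c: "c \<in> HH"
    show "c \<bullet> ?f (diag_op HH ?g v) = c \<bullet> v"
      using pos[OF c] by (simp add: inner_f[OF dom c] inner_diag_op[OF bounded_diag_dom[OF g] c])
  qed
  ultimately show ?thesis
    unfolding resolvent_op_def by (rule inv_into_f_eq)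
qed

end

section \<open>Interpolation spaces\<close>

text \<open>The common source of smoothing for both schemes: for x >= 0, the bound 1 + x is below
  exp x and below each power (1 + x)^k with k >= 1.\<close>

lemma powr_le_one_plus:
  fixes x p :: real
  assumes "0 \<le> x" "0 \<le> p" "p \<le> 1"
  shows "x powr p \<le> 1 + x"
proof (cases "x \<le> 1")
  case True
  then show ?thesis using powr_mono2[of p x 1] assms by simp
next
  case False
  then show ?thesis using powr_mono[of p 1 x] assms by simp
qed

lemma has_sum_wrt_iff_tendsto:
  assumes "\<And>F. finite F \<Longrightarrow> F \<subseteq> I \<Longrightarrow> 0 \<le> n (sum f F - x)"
  shows "has_sum_wrt n f I x \<longleftrightarrow> ((\<lambda>F. n (sum f F - x)) \<longlongrightarrow> 0) (finite_subsets_at_top I)"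
  unfolding has_sum_wrt_def tendsto_iff eventually_finite_subsets_at_top
  using assms by (auto simp: dist_real_def)

locale hilbert_scale = onb HH for HH :: "'a::{real_inner,banach} set" +
  fixes lam :: "'a \<Rightarrow> real" and j :: "'a \<Rightarrow> 'v::real_vector"
    and Hr :: "real \<Rightarrow> 'v set" and nr :: "real \<Rightarrow> 'v \<Rightarrow> real" and \<epsilon> :: real
  assumes interp: "interpolation_spaces HH lam j Hr nr"
    and eps: "\<epsilon> > 0" and lam: "\<And>c. c \<in> HH \<Longrightarrow> lam c \<le> - \<epsilon>"
begin

lemma lam_neg: "c \<in> HH \<Longrightarrow> lam c < 0"
  using lam eps by force

lemma linear_j: "linear j"
  using interp unfolding interpolation_spaces_def by blast

lemma inj_j: "inj j"
  using interp unfolding interpolation_spaces_def by blast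

lemmas j_simps = linear_add[OF linear_j] linear_diff[OF linear_j] linear_cmul[OF linear_j]
  linear_0[OF linear_j] linear_sum[OF linear_j]

lemma scale_nested: "s \<le> r \<Longrightarrow> Hr r \<subseteq> Hr s"
  using interp unfolding interpolation_spaces_def by blast

lemma neg_completion: "r < 0 \<Longrightarrow> completion_of j (\<lambda>v. norm (frac_power HH lam r v)) (Hr r) (nr r)"
  using interp unfolding interpolation_spaces_def by blast

lemma nonneg_space: "r \<ge> 0 \<Longrightarrow> Hr r = j ` frac_power_dom HH lam r"
  using interp unfolding interpolation_spaces_def by blast

lemma nonpos_dom: "r \<le> 0 \<Longrightarrow> v \<in> frac_power_dom HH lam r"
  unfolding frac_power_dom_def
proof (rule bounded_diag_dom)
  fix c assume "r \<le> 0" "c \<in> HH"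
  then have "(- lam c) powr r \<le> \<epsilon> powr r"
    using lam[of c] eps by (intro powr_mono2') auto
  then show "\<bar>(- lam c) powr r\<bar> \<le> \<epsilon> powr r" by simp
qed

lemma nr_j: "v \<in> frac_power_dom HH lam r \<Longrightarrow> nr r (j v) = norm (frac_power HH lam r v)"
  using interp neg_completion[of r] unfolding interpolation_spaces_def completion_of_def
  by (cases "r < 0") auto

lemma frac_power_0: "frac_power HH lam 0 v = v"
  using nonpos_dom[of 0 v]
  by (intro eqI) (auto simp: frac_power_def frac_power_dom_def inner_diag_op dest: lam_neg)

lemma inner_frac_power:
  "v \<in> frac_power_dom HH lam r \<Longrightarrow> c \<in> HH \<Longrightarrow> c \<bullet> frac_power HH lam r v = (- lam c) powr r * (c \<bullet> v)"
  unfolding frac_power_dom_def frac_power_def by (rule inner_diag_op)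

lemma j_mem: "v \<in> frac_power_dom HH lam r \<Longrightarrow> j v \<in> Hr r"
proof (cases "r < 0")
  case True
  then show ?thesis using neg_completion[of r] by (auto simp: completion_of_def)
qed (auto simp: nonneg_space)

lemma subspace_dom: "subspace (frac_power_dom HH lam r)"
  unfolding subspace_def
proof (intro conjI ballI allI)
  show zero: "0 \<in> frac_power_dom HH lam r"
    by (simp add: frac_power_dom_def diag_dom_def)
  show "x + y \<in> frac_power_dom HH lam r" if "x \<in> frac_power_dom HH lam r" "y \<in> frac_power_dom HH lam r" for x y
    using diag_dom_linear[of x _ y 1] that by (simp add: frac_power_dom_def)
  show "c *\<^sub>R x \<in> frac_power_dom HH lam r" if "x \<in> frac_power_dom HH lam r" for c x
    using diag_dom_linear[of x _ 0 c] that zero by (simp add: frac_power_dom_def)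
qed

lemma basis_dom: "c \<in> HH \<Longrightarrow> c \<in> frac_power_dom HH lam r"
  by (simp add: frac_power_dom_def diag_dom_basis)

lemma finite_sum_dom: "F \<subseteq> HH \<Longrightarrow> (\<Sum>c\<in>F. f c *\<^sub>R c) \<in> frac_power_dom HH lam r"
  by (intro subspace_sum subspace_scale subspace_dom basis_dom) auto

lemma frac_power_finite_sum:
  assumes "finite F" "F \<subseteq> HH"
  shows "frac_power HH lam r (\<Sum>c\<in>F. f c *\<^sub>R c) = (\<Sum>c\<in>F. (f c * (- lam c) powr r) *\<^sub>R c)"
  by (rule eqI) (auto simp: inner_frac_power finite_sum_dom inner_finite_sum assms)

lemma frac_power_linear:
  "v \<in> frac_power_dom HH lam r \<Longrightarrow> w \<in> frac_power_dom HH lam r \<Longrightarrow>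
    frac_power HH lam r (a *\<^sub>R v + w) = a *\<^sub>R frac_power HH lam r v + frac_power HH lam r w"
  unfolding frac_power_dom_def frac_power_def by (rule diag_op_linear)

lemma frac_power_diff:
  "v \<in> frac_power_dom HH lam r \<Longrightarrow> w \<in> frac_power_dom HH lam r \<Longrightarrow>
    frac_power HH lam r (v - w) = frac_power HH lam r v - frac_power HH lam r w"
  using frac_power_linear[of w r v "- 1"] by simp

text \<open>For r < 0 the norm axioms belong to the notion of completion, for r = 0 they are carried
  over from H by the injective map \<open>j\<close>. Any two spaces of the scale embed into one with
  nonpositive index, so comparisons can be made here.\<close>

lemma nonpos_norm:
  assumes r: "r \<le> 0"
  shows "subspace (Hr r)"
    and "x \<in> Hr r \<Longrightarrow> 0 \<le> nr r x"
    and "x \<in> Hr r \<Longrightarrow> nr r x = 0 \<longleftrightarrow> x = 0"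
    and "x \<in> Hr r \<Longrightarrow> nr r (c *\<^sub>R x) = \<bar>c\<bar> * nr r x"
    and "x \<in> Hr r \<Longrightarrow> y \<in> Hr r \<Longrightarrow> nr r (x + y) \<le> nr r x + nr r y"
proof -
  have "subspace (Hr r) \<and> (x \<in> Hr r \<longrightarrow> 0 \<le> nr r x \<and> (nr r x = 0 \<longleftrightarrow> x = 0) \<and> nr r (c *\<^sub>R x) = \<bar>c\<bar> * nr r x) \<and>
     (x \<in> Hr r \<longrightarrow> y \<in> Hr r \<longrightarrow> nr r (x + y) \<le> nr r x + nr r y)"
  proof (cases "r < 0")
    case True
    then show ?thesis using neg_completion[of r] unfolding completion_of_def by blast
  next
    case False
    then have r0: "r = 0" using r by simp
    have E: "Hr 0 = range j" and n: "nr 0 (j v) = norm v" for v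
      using nonneg_space[of 0] nonpos_dom[of 0] nr_j[of v 0] by (auto simp: frac_power_0)
    have "x = j v \<Longrightarrow> x = 0 \<longleftrightarrow> v = 0" for v
      using inj_j by (metis injD linear_0[OF linear_j])
    moreover have "nr 0 (c *\<^sub>R j v) = \<bar>c\<bar> * nr 0 (j v)" "nr 0 (j v + j w) \<le> nr 0 (j v) + nr 0 (j w)" for v w
      using n[of "c *\<^sub>R v"] n[of "v + w"] norm_triangle_ineq[of v w] by (simp_all add: n j_simps)
    moreover have "subspace (range j)"
      by (rule linear_subspace_image[OF linear_j subspace_UNIV])
    moreover have "nr 0 0 = 0"
      using n[of 0] by (simp add: j_simps)
    ultimately show ?thesis unfolding r0 E
      by (auto simp: n)
  qed
  then show "subspace (Hr r)" "x \<in> Hr r \<Longrightarrow> 0 \<le> nr r x"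
    "x \<in> Hr r \<Longrightarrow> nr r x = 0 \<longleftrightarrow> x = 0" "x \<in> Hr r \<Longrightarrow> nr r (c *\<^sub>R x) = \<bar>c\<bar> * nr r x"
    "x \<in> Hr r \<Longrightarrow> y \<in> Hr r \<Longrightarrow> nr r (x + y) \<le> nr r x + nr r y" by blast+
qed

lemma nr_nonneg: "x \<in> Hr r \<Longrightarrow> 0 \<le> nr r x"
proof (cases "r < 0")
  case True
  then show "x \<in> Hr r \<Longrightarrow> 0 \<le> nr r x" using nonpos_norm(2)[of r x] by simp
next
  case False
  then show "x \<in> Hr r \<Longrightarrow> 0 \<le> nr r x" using nr_j[of _ r] by (auto simp: nonneg_space)
qed

lemma subspace_Hr: "subspace (Hr r)"
  using nonpos_norm(1)[of r] linear_subspace_image[OF linear_j subspace_dom]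
  by (cases "r < 0") (auto simp: nonneg_space)

lemma nr_nested:
  assumes "s \<le> r"
  shows "\<exists>C. \<forall>x\<in>Hr r. nr s x \<le> C * nr r x"
proof -
  have "\<forall>r s. s \<le> r \<longrightarrow> Hr r \<subseteq> Hr s \<and> (\<exists>C. \<forall>x\<in>Hr r. nr s x \<le> C * nr r x)"
    using interp unfolding interpolation_spaces_def by (elim conjE)
  then show ?thesis
    using assms by blast
qed

text \<open>The two limits are compared in a space that contains both and whose index is
  nonpositive, so that \<open>nr\<close> is known to be a norm there. This is how B v, given as a
  sum in H_(-\<beta>), is recognised as a sum in another space of the scale.\<close>

lemma has_sum_wrt_scale_unique:
  assumes x: "has_sum_wrt (nr r) f I x" "x \<in> Hr r" and y: "has_sum_wrt (nr s) f I y" "y \<in> Hr s"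
    and f: "\<And>i. i \<in> I \<Longrightarrow> f i \<in> Hr r" "\<And>i. i \<in> I \<Longrightarrow> f i \<in> Hr s"
  shows "x = y"
proof -
  define q where "q = min 0 (min r s)"
  have q: "q \<le> 0" "q \<le> r" "q \<le> s" by (auto simp: q_def)
  let ?F = "finite_subsets_at_top I"
  have inr: "sum f F - x \<in> Hr r" and ins: "sum f F - y \<in> Hr s" if "F \<subseteq> I" for F
    using that f x(2) y(2) by (auto intro!: subspace_diff[OF subspace_Hr] subspace_sum[OF subspace_Hr])
  have tx: "((\<lambda>F. nr r (sum f F - x)) \<longlongrightarrow> 0) ?F"
    using x(1) by (subst (asm) has_sum_wrt_iff_tendsto) (auto intro: nr_nonneg inr)
  have ty: "((\<lambda>F. nr s (sum f F - y)) \<longlongrightarrow> 0) ?F"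
    using y(1) by (subst (asm) has_sum_wrt_iff_tendsto) (auto intro: nr_nonneg ins)
  from nr_nested[OF q(2)] obtain C where C: "\<And>x. x \<in> Hr r \<Longrightarrow> nr q x \<le> C * nr r x"
    by blast
  from nr_nested[OF q(3)] obtain D where D: "\<And>x. x \<in> Hr s \<Longrightarrow> nr q x \<le> D * nr s x"
    by blast
  have "nr q (x - y) \<le> C * nr r (sum f F - x) + D * nr s (sum f F - y)" if "F \<subseteq> I" for F
  proof -
    have m: "sum f F - x \<in> Hr q" "sum f F - y \<in> Hr q"
      using inr[OF that] ins[OF that] scale_nested q by blast+
    have "nr q ((- 1) *\<^sub>R (sum f F - x) + (sum f F - y)) \<le> nr q ((- 1) *\<^sub>R (sum f F - x)) + nr q (sum f F - y)"
      using m by (intro nonpos_norm(5) q subspace_scale[OF subspace_Hr])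
    also have "nr q ((- 1) *\<^sub>R (sum f F - x)) = nr q (sum f F - x)"
      using nonpos_norm(4)[OF q(1) m(1), of "- 1"] by simp
    finally show ?thesis
      using C[OF inr[OF that]] D[OF ins[OF that]] by simp
  qed
  then have ev: "eventually (\<lambda>F. nr q (x - y) \<le> C * nr r (sum f F - x) + D * nr s (sum f F - y)) ?F"
    by (intro eventually_finite_subsets_at_top_weakI)
  have "((\<lambda>F. C * nr r (sum f F - x) + D * nr s (sum f F - y)) \<longlongrightarrow> C * 0 + D * 0) ?F"
    by (intro tendsto_intros tx ty)
  then have "nr q (x - y) \<le> C * 0 + D * 0"
    by (rule tendsto_lowerbound[OF _ ev]) simp
  moreover have "x - y \<in> Hr q"
    using x(2) y(2) scale_nested q by (intro subspace_diff[OF subspace_Hr]) blast+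
  ultimately show ?thesis
    using nonpos_norm(2,3)[OF q(1)] by fastforce
qed

text \<open>The weights turn the series isometrically into an orthogonal series in H with sum
  \<open>U\<close>. For r >= 0 the spectral gap makes the unweighted coefficients square summable,
  so the sum exists in H; for r < 0 it has to come from completeness of H_r.\<close>

lemma scale_series:
  assumes u: "(\<lambda>c. (p c * (- lam c) powr r)\<^sup>2) summable_on HH"
  defines "U \<equiv> (\<Sum>\<^sub>\<infinity>c\<in>HH. (p c * (- lam c) powr r) *\<^sub>R c)"
  obtains y where "y \<in> Hr r" "has_sum_wrt (nr r) (\<lambda>c. p c *\<^sub>R j c) HH y" "nr r y \<le> norm U"
proof -
  let ?u = "\<lambda>c. p c * (- lam c) powr r"
  let ?S = "\<lambda>F. \<Sum>c\<in>F. ?u c *\<^sub>R c"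
  have U: "((\<lambda>c. ?u c *\<^sub>R c) has_sum U) HH"
    unfolding U_def using summable_orthogonal[OF u] by (rule has_sum_infsum)
  have sum_j: "(\<Sum>c\<in>F. p c *\<^sub>R j c) = j (\<Sum>c\<in>F. p c *\<^sub>R c)" for F
    by (simp add: j_simps)
  have approx: "\<exists>F. finite F \<and> F \<subseteq> HH \<and> norm (?S F - U) < e" if "e > 0" for e
  proof -
    obtain F where "finite F" "F \<subseteq> HH" "dist (?S F) U \<le> e / 2"
      using has_sum_finite_approximation[OF U, of "e / 2"] \<open>e > 0\<close> half_gt_zero by blast
    then show ?thesis using that by (intro exI[of _ F]) (auto simp: dist_norm)
  qed
  show thesis
  proof (cases "r < 0")
    case False
    have "(\<lambda>c. (p c)\<^sup>2) summable_on HH"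
    proof (rule summable_on_comparison_test)
      show "(\<lambda>c. \<epsilon> powr (- 2 * r) * (?u c)\<^sup>2) summable_on HH"
        by (intro summable_on_cmult_right u)
      fix c assume c: "c \<in> HH"
      have "\<epsilon> powr (2 * r) \<le> (- lam c) powr (2 * r)"
        using lam[OF c] eps False by (intro powr_mono2) auto
      then have "1 \<le> \<epsilon> powr (- 2 * r) * (- lam c) powr (2 * r)"
        using eps by (simp add: powr_minus field_simps)
      moreover have "((- lam c) powr r)\<^sup>2 = (- lam c) powr (2 * r)"
        by (simp add: power2_eq_square flip: powr_add)
      ultimately show "(p c)\<^sup>2 \<le> \<epsilon> powr (- 2 * r) * (?u c)\<^sup>2"
        using mult_left_mono[of 1 "\<epsilon> powr (- 2 * r) * (- lam c) powr (2 * r)" "(p c)\<^sup>2"]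
        by (simp add: power_mult_distrib algebra_simps)
    qed simp
    then have w: "c \<bullet> (\<Sum>\<^sub>\<infinity>c\<in>HH. p c *\<^sub>R c) = p c" if "c \<in> HH" for c
      using that by (rule inner_infsum_orthogonal)
    define w where "w = (\<Sum>\<^sub>\<infinity>c\<in>HH. p c *\<^sub>R c)"
    have wc: "c \<bullet> w = p c" if "c \<in> HH" for c
      using w[OF that] by (simp add: w_def)
    have dom: "w \<in> frac_power_dom HH lam r"
      using u unfolding frac_power_dom_def diag_dom_def
      by (subst mem_Collect_eq, subst summable_on_cong[where g="\<lambda>c. (?u c)\<^sup>2"]) (auto simp: wc mult.commute)
    have fw: "frac_power HH lam r w = U"
      unfolding U_def by (rule eqI) (simp add: inner_frac_power dom wc inner_infsum_orthogonal u)
    have nj: "nr r (sum (\<lambda>c. p c *\<^sub>R j c) F - j w) = norm (?S F - U)" if "finite F" "F \<subseteq> HH" for F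
    proof -
      have "sum (\<lambda>c. p c *\<^sub>R j c) F - j w = j ((\<Sum>c\<in>F. p c *\<^sub>R c) - w)"
        by (simp add: sum_j j_simps(2))
      then show ?thesis
        using that by (simp add: nr_j subspace_diff[OF subspace_dom] finite_sum_dom dom frac_power_diff frac_power_finite_sum fw)
    qed
    show thesis
    proof (rule that)
      show "j w \<in> Hr r" by (rule j_mem[OF dom])
      show "nr r (j w) \<le> norm U" by (simp add: nr_j dom fw)
      have "((\<lambda>F. norm (?S F - U)) \<longlongrightarrow> 0) (finite_subsets_at_top HH)"
        using U unfolding has_sum_def by (simp add: LIM_zero tendsto_norm_zero)
      then have "((\<lambda>F. nr r (sum (\<lambda>c. p c *\<^sub>R j c) F - j w)) \<longlongrightarrow> 0) (finite_subsets_at_top HH)"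
        by (rule Lim_transform_eventually) (auto intro!: eventually_finite_subsets_at_top_weakI simp: nj)
      then show "has_sum_wrt (nr r) (\<lambda>c. p c *\<^sub>R j c) HH (j w)"
        by (subst has_sum_wrt_iff_tendsto) (auto simp: nj)
    qed
  next
    case True
    then have r: "r \<le> 0" by simp
    note N = nonpos_norm[OF r]
    have mem: "(\<Sum>c\<in>F. p c *\<^sub>R j c) \<in> Hr r" if "F \<subseteq> HH" for F
      unfolding sum_j using that by (intro j_mem finite_sum_dom)
    have nS: "nr r (\<Sum>c\<in>F. p c *\<^sub>R j c) = norm (?S F)" if "finite F" "F \<subseteq> HH" for F
      unfolding sum_j using that by (simp add: nr_j finite_sum_dom frac_power_finite_sum)
    have nD: "nr r ((\<Sum>c\<in>F. p c *\<^sub>R j c) - (\<Sum>c\<in>G. p c *\<^sub>R j c)) = norm (?S F - ?S G)"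
      if "finite F" "F \<subseteq> HH" "finite G" "G \<subseteq> HH" for F G
      unfolding sum_j using that
      by (simp add: nr_j finite_sum_dom frac_power_finite_sum frac_power_diff subspace_diff[OF subspace_dom]
          flip: j_simps(2))
    \<comment> \<open>Completeness of H_r is stated for sequences, so the limit is first taken along
      one sequence of finite sets; \<open>bound\<close> below then returns to the net of all finite
      sets.\<close>
    have "\<forall>n. \<exists>F. finite F \<and> F \<subseteq> HH \<and> norm (?S F - U) < inverse (real (Suc n))"
      by (intro allI approx) simp
    from choice[OF this] obtain G
      where G: "\<And>n. finite (G n)" "\<And>n. G n \<subseteq> HH" "\<And>n. norm (?S (G n) - U) < inverse (real (Suc n))"
      by blast
    have lim: "(\<lambda>n. norm (?S (G n) - U)) \<longlonglongrightarrow> 0"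
      by (rule tendsto_sandwich[OF _ _ tendsto_const LIMSEQ_inverse_real_of_nat])
        (use G(3) in \<open>auto intro!: always_eventually less_imp_le\<close>)
    then have "(\<lambda>n. ?S (G n)) \<longlonglongrightarrow> U"
      using LIM_zero_iff tendsto_norm_zero_iff by blast
    then have "Cauchy (\<lambda>n. ?S (G n))" by (rule LIMSEQ_imp_Cauchy)
    then have cau: "\<forall>e>0. \<exists>N. \<forall>m\<ge>N. \<forall>n\<ge>N.
        nr r ((\<Sum>c\<in>G m. p c *\<^sub>R j c) - (\<Sum>c\<in>G n. p c *\<^sub>R j c)) < e"
      unfolding Cauchy_def by (simp add: nD G dist_norm)
    have "range (\<lambda>n. \<Sum>c\<in>G n. p c *\<^sub>R j c) \<subseteq> Hr r"
      using mem G(2) by blast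
    moreover have "\<forall>x::nat \<Rightarrow> 'v. range x \<subseteq> Hr r \<longrightarrow>
        (\<forall>\<epsilon>>0. \<exists>N. \<forall>m\<ge>N. \<forall>n\<ge>N. nr r (x m - x n) < \<epsilon>) \<longrightarrow> (\<exists>y\<in>Hr r. (\<lambda>n. nr r (x n - y)) \<longlonglongrightarrow> 0)"
      using neg_completion[OF True] unfolding completion_of_def by (elim conjE)
    ultimately obtain y where y: "y \<in> Hr r" "(\<lambda>n. nr r ((\<Sum>c\<in>G n. p c *\<^sub>R j c) - y)) \<longlonglongrightarrow> 0"
      using cau by (elim allE[of _ "\<lambda>n. \<Sum>c\<in>G n. p c *\<^sub>R j c"] impE bexE) auto
    have bound: "nr r ((\<Sum>c\<in>F. p c *\<^sub>R j c) - y) \<le> norm (?S F - U)" if F: "finite F" "F \<subseteq> HH" for F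
    proof (rule LIMSEQ_le_const)
      show "(\<lambda>n. norm (?S F - U) + norm (?S (G n) - U) + nr r ((\<Sum>c\<in>G n. p c *\<^sub>R j c) - y)) \<longlonglongrightarrow> norm (?S F - U)"
        using tendsto_add[OF tendsto_add[OF tendsto_const lim] y(2)] by simp
      have "nr r ((\<Sum>c\<in>F. p c *\<^sub>R j c) - y) \<le> norm (?S F - U) + norm (?S (G n) - U) + nr r ((\<Sum>c\<in>G n. p c *\<^sub>R j c) - y)" for n
      proof -
        have "nr r ((\<Sum>c\<in>F. p c *\<^sub>R j c) - y) \<le> nr r ((\<Sum>c\<in>F. p c *\<^sub>R j c) - (\<Sum>c\<in>G n. p c *\<^sub>R j c)) + nr r ((\<Sum>c\<in>G n. p c *\<^sub>R j c) - y)"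
          using N(5)[OF subspace_diff[OF N(1) mem[OF F(2)] mem[OF G(2)[of n]]] subspace_diff[OF N(1) mem[OF G(2)[of n]] y(1)]]
          by simp
        also have "nr r ((\<Sum>c\<in>F. p c *\<^sub>R j c) - (\<Sum>c\<in>G n. p c *\<^sub>R j c)) \<le> norm (?S F - U) + norm (?S (G n) - U)"
          using F G by (simp add: nD norm_triangle_le_diff norm_diff_triangle_le[of "?S F" U _ "?S (G n)"] norm_minus_commute)
        finally show ?thesis by simp
      qed
      then show "\<exists>N. \<forall>n\<ge>N. nr r ((\<Sum>c\<in>F. p c *\<^sub>R j c) - y) \<le> norm (?S F - U) + norm (?S (G n) - U) + nr r ((\<Sum>c\<in>G n. p c *\<^sub>R j c) - y)"
        by blast
    qed
    show thesis
    proof (rule that)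
      show "y \<in> Hr r" by fact
      have "((\<lambda>F. norm (?S F - U)) \<longlongrightarrow> 0) (finite_subsets_at_top HH)"
        using U unfolding has_sum_def by (simp add: LIM_zero tendsto_norm_zero)
      then have "((\<lambda>F. nr r ((\<Sum>c\<in>F. p c *\<^sub>R j c) - y)) \<longlongrightarrow> 0) (finite_subsets_at_top HH)"
        by (rule tendsto_sandwich[OF _ _ tendsto_const, rotated -1])
          (auto intro!: eventually_finite_subsets_at_top_weakI bound N(2) subspace_diff[OF N(1)] mem y(1))
      then show "has_sum_wrt (nr r) (\<lambda>c. p c *\<^sub>R j c) HH y"
        by (subst has_sum_wrt_iff_tendsto) (auto intro!: N(2) subspace_diff[OF N(1)] mem y(1))
      \<comment> \<open>The empty partial sum turns the approximation bound into a bound for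
        y.\<close>
      have "nr r ((- 1) *\<^sub>R y) \<le> norm U"
        using bound[of "{}"] by simp
      then show "nr r y \<le> norm U"
        using N(4)[OF y(1), of "- 1"] by simp
    qed
  qed
qed

end

section \<open>The noise operator, and the extensions of semigroup and resolvent to negative
  spaces\<close>

context hilbert_scale
begin

text \<open>At a basis vector the series of B has a single term that can be nonzero. So B c lies in
  the image of H, although B as a whole may lead out of it.\<close>

lemma diag_on_basis:
  assumes B: "B \<in> hilbert_schmidt HH (Hr s) (nr s)"
    and B_diag: "\<And>v. has_sum_wrt (nr s) (\<lambda>c. (mu c * (c \<bullet> v)) *\<^sub>R j c) HH (B v)"
    and c: "c \<in> HH"
  shows "B c = j (mu c *\<^sub>R c)"
proof (rule has_sum_wrt_scale_unique[OF B_diag])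
  show "B c \<in> Hr s"
    using B by (auto simp: hilbert_schmidt_def)
  have "(\<Sum>d\<in>F. (mu d * (d \<bullet> c)) *\<^sub>R j d) = j (mu c *\<^sub>R c)" if "finite F" "{c} \<subseteq> F" "F \<subseteq> HH" for F
  proof -
    have "(\<Sum>d\<in>F. (mu d * (d \<bullet> c)) *\<^sub>R j d) = (\<Sum>d\<in>{c}. (mu d * (d \<bullet> c)) *\<^sub>R j d)"
      using that c by (intro sum.mono_neutral_right) (auto simp: inner_basis subset_iff)
    then show ?thesis using c by (simp add: inner_basis j_simps)
  qed
  moreover have "nr s 0 = 0"
    using nr_j[of 0 s] subspace_0[OF subspace_dom] frac_power_diff[of 0 s 0] by (simp add: j_simps)
  ultimately show "has_sum_wrt (nr s) (\<lambda>d. (mu d * (d \<bullet> c)) *\<^sub>R j d) HH (j (mu c *\<^sub>R c))"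
    unfolding has_sum_wrt_def using c by (intro allI impI exI[of _ "{c}"]) auto
  show "j (mu c *\<^sub>R c) \<in> Hr s"
    by (intro subspace_scale[OF subspace_dom] j_mem basis_dom c)
qed (auto intro!: subspace_scale[OF subspace_Hr] j_mem basis_dom)

text \<open>A square summable weight dominates the coefficients of every B v, so its series
  converges in H_r as well; uniqueness of limits across the scale identifies the new sum with B v.
  The operator bound \<open>sqrt S\<close> is the Hilbert-Schmidt norm.\<close>

lemma hilbert_schmidt_diag:
  assumes B: "B \<in> hilbert_schmidt HH (Hr s) (nr s)"
    and B_diag: "\<And>v. has_sum_wrt (nr s) (\<lambda>c. (mu c * (c \<bullet> v)) *\<^sub>R j c) HH (B v)"
    and mu: "(\<lambda>c. (mu c * (- lam c) powr r)\<^sup>2) summable_on HH"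
  shows "B \<in> hilbert_schmidt HH (Hr r) (nr r)"
proof -
  let ?w = "\<lambda>c. mu c * (- lam c) powr r"
  obtain S where S: "((\<lambda>c. (?w c)\<^sup>2) has_sum S) HH"
    using mu by (auto simp: summable_on_def)
  have S0: "S \<ge> 0" by (rule has_sum_nonneg[OF S]) simp
  have B_mem: "B v \<in> Hr s" for v
    using B by (auto simp: hilbert_schmidt_def)
  have *: "B v \<in> Hr r \<and> nr r (B v) \<le> sqrt S * norm v" for v
  proof -
    have le: "(mu c * (c \<bullet> v) * (- lam c) powr r)\<^sup>2 \<le> (norm v)\<^sup>2 * (?w c)\<^sup>2" if c: "c \<in> HH" for c
    proof -
      have "norm c = 1" using inner_basis[OF c c] by (simp add: norm_eq_sqrt_inner)
      then have "\<bar>c \<bullet> v\<bar> \<le> norm v" using Cauchy_Schwarz_ineq2[of c v] by simp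
      then have "(c \<bullet> v)\<^sup>2 \<le> (norm v)\<^sup>2" by (simp add: power2_le_iff_abs_le)
      from mult_right_mono[OF this, of "(?w c)\<^sup>2"] show ?thesis
        by (simp add: power_mult_distrib mult_ac)
    qed
    have bd: "((\<lambda>c. (norm v)\<^sup>2 * (?w c)\<^sup>2) has_sum (norm v)\<^sup>2 * S) HH"
      by (rule has_sum_cmult_right[OF S])
    have u: "(\<lambda>c. (mu c * (c \<bullet> v) * (- lam c) powr r)\<^sup>2) summable_on HH"
      by (rule summable_on_comparison_test[OF has_sum_imp_summable[OF bd] le]) auto
    let ?U = "\<Sum>\<^sub>\<infinity>c\<in>HH. (mu c * (c \<bullet> v) * (- lam c) powr r) *\<^sub>R c"
    obtain y where y: "y \<in> Hr r" "has_sum_wrt (nr r) (\<lambda>c. (mu c * (c \<bullet> v)) *\<^sub>R j c) HH y" "nr r y \<le> norm ?U"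
      using scale_series[OF u] by blast
    have j_basis: "a *\<^sub>R j c \<in> Hr q" if "c \<in> HH" for a c q
      by (intro subspace_scale[OF subspace_Hr] j_mem basis_dom that)
    have "y = B v"
      by (rule has_sum_wrt_scale_unique[OF y(2,1) B_diag B_mem]) (auto intro: j_basis)
    moreover have "(norm ?U)\<^sup>2 \<le> (norm v)\<^sup>2 * S"
    proof (rule has_sum_mono[OF parseval bd])
      fix c assume "c \<in> HH"
      then show "(c \<bullet> ?U)\<^sup>2 \<le> (norm v)\<^sup>2 * (?w c)\<^sup>2"
        using le by (simp add: inner_infsum_orthogonal[OF u])
    qed
    then have "(norm ?U)\<^sup>2 \<le> (sqrt S * norm v)\<^sup>2"
      by (simp add: power_mult_distrib S0 mult.commute)
    then have "norm ?U \<le> sqrt S * norm v"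
      by (rule power2_le_imp_le) (simp add: S0)
    ultimately show ?thesis using y by auto
  qed
  note B_basis = diag_on_basis[OF B B_diag]
  have nB: "(nr r (B c))\<^sup>2 = (?w c)\<^sup>2" if c: "c \<in> HH" for c
  proof -
    have "nr r (B c) = norm (frac_power HH lam r (\<Sum>d\<in>{c}. mu d *\<^sub>R d))"
      unfolding B_basis[OF c] using subspace_scale[OF subspace_dom basis_dom[OF c]]
      by (subst nr_j) simp_all
    also have "\<dots> = norm (\<Sum>d\<in>{c}. (mu d * (- lam d) powr r) *\<^sub>R d)"
      using c by (subst frac_power_finite_sum) auto
    finally show ?thesis
      using norm_finite_sum[of "{c}" ?w] c by simp
  qed
  show ?thesis
    unfolding hilbert_schmidt_def mem_Collect_eq
  proof (intro conjI)
    show "linear B" using B by (simp add: hilbert_schmidt_def)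
    show "range B \<subseteq> Hr r" using * by blast
    show "\<exists>C. \<forall>v. nr r (B v) \<le> C * norm v"
      using * by (intro exI[of _ "sqrt S"]) blast
    show "(\<lambda>b. (nr r (B b))\<^sup>2) summable_on HH"
      using mu by (subst summable_on_cong[OF nB])
  qed
qed

text \<open>Decay of the multiplier like the power -\<beta> of the eigenvalues makes the operator
  bounded from the norm of H_(-\<beta>) to H, so the extension agrees with the operator on H. Points
  of the form \<open>j u\<close> are enough because B maps basis vectors to such points.\<close>

lemma cont_extension_diag_op:
  assumes \<beta>: "\<beta> \<ge> 0" and g: "\<And>c. c \<in> HH \<Longrightarrow> \<bar>g c\<bar> \<le> C * (- lam c) powr (- \<beta>)"
  shows "cont_extension j (nr (- \<beta>)) (diag_op HH g) (j u) = diag_op HH g u"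
  unfolding cont_extension_def
proof (rule the_equality)
  have bounded: "\<bar>g c\<bar> \<le> \<bar>C\<bar> * \<epsilon> powr (- \<beta>)" if c: "c \<in> HH" for c
  proof -
    have "(- lam c) powr (- \<beta>) \<le> \<epsilon> powr (- \<beta>)"
      using lam[OF c] eps \<beta> by (intro powr_mono2') auto
    then have "C * (- lam c) powr (- \<beta>) \<le> \<bar>C\<bar> * \<epsilon> powr (- \<beta>)"
      by (intro mult_mono) auto
    then show ?thesis using g[OF c] by simp
  qed
  note dom = bounded_diag_dom[OF bounded]
  have pdom: "w \<in> frac_power_dom HH lam (- \<beta>)" for w
    using \<beta> by (intro nonpos_dom) simp
  have bound: "norm (diag_op HH g w) \<le> \<bar>C\<bar> * nr (- \<beta>) (j w)" for w
  proof -
    have "norm (diag_op HH g w) \<le> norm (C *\<^sub>R frac_power HH lam (- \<beta>) w)"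
    proof (rule norm_mono)
      fix c assume c: "c \<in> HH"
      have "C * (- lam c) powr (- \<beta>) \<le> \<bar>C\<bar> * (- lam c) powr (- \<beta>)"
        by (intro mult_right_mono) auto
      then have "\<bar>g c\<bar> * \<bar>c \<bullet> w\<bar> \<le> \<bar>C\<bar> * (- lam c) powr (- \<beta>) * \<bar>c \<bullet> w\<bar>"
        using g[OF c] by (intro mult_right_mono) auto
      then show "\<bar>c \<bullet> diag_op HH g w\<bar> \<le> \<bar>c \<bullet> C *\<^sub>R frac_power HH lam (- \<beta>) w\<bar>"
        using c by (simp add: inner_diag_op[OF dom] inner_frac_power[OF pdom] abs_mult mult.assoc)
    qed
    then show ?thesis using pdom by (simp add: nr_j)
  qed
  show "\<forall>v. (\<lambda>n. nr (- \<beta>) (j (v n) - j u)) \<longlonglongrightarrow> 0 \<longrightarrow> (\<lambda>n. diag_op HH g (v n)) \<longlonglongrightarrow> diag_op HH g u"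
  proof (intro allI impI)
    fix v :: "nat \<Rightarrow> 'a" assume lim: "(\<lambda>n. nr (- \<beta>) (j (v n) - j u)) \<longlonglongrightarrow> 0"
    have "diag_op HH g (v n) - diag_op HH g u = diag_op HH g (v n - u)" for n
      using diag_op_linear[OF dom dom, where a="- 1" and v=u and w="v n"] by simp
    then have le: "norm (diag_op HH g (v n) - diag_op HH g u) \<le> \<bar>C\<bar> * nr (- \<beta>) (j (v n) - j u)" for n
      using bound[of "v n - u"] by (simp add: j_simps)
    have "(\<lambda>n. diag_op HH g (v n) - diag_op HH g u) \<longlonglongrightarrow> 0"
      by (rule Lim_null_comparison[OF _ tendsto_mult_right_zero[OF lim]]) (rule always_eventually, use le in blast)
    then show "(\<lambda>n. diag_op HH g (v n)) \<longlonglongrightarrow> diag_op HH g u"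
      by (rule LIM_zero_cancel)
  qed
  fix w assume "\<forall>v. (\<lambda>n. nr (- \<beta>) (j (v n) - j u)) \<longlonglongrightarrow> 0 \<longrightarrow> (\<lambda>n. diag_op HH g (v n)) \<longlonglongrightarrow> w"
  \<comment> \<open>The constant sequence u is one of the admissible approximations and pins down
    w.\<close>
  from this[THEN spec, of "\<lambda>_. u"] show "w = diag_op HH g u"
    using nr_j[OF pdom, of 0] bound[of 0] frac_power_diff[OF pdom pdom, of 0 0]
    by (auto simp: j_simps LIMSEQ_const_iff)
qed

text \<open>With a = - lam c, the decay follows from (t a)^\<beta> <= exp(t a). The constant
  t^(-\<beta>) reflects that the smoothing gets lost as t tends to 0.\<close>

lemma cont_extension_exp:
  assumes "0 \<le> \<beta>" "\<beta> \<le> 1" "t > 0"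
  shows "cont_extension j (nr (- \<beta>)) (semigroup_op HH lam t) (j u) = diag_op HH (\<lambda>c. exp (t * lam c)) u"
  unfolding semigroup_op_def
proof (rule cont_extension_diag_op[OF assms(1), where C="t powr (- \<beta>)"])
  fix c assume c: "c \<in> HH"
  let ?a = "- lam c"
  have a: "?a > 0" using lam_neg[OF c] by simp
  have "(t * ?a) powr \<beta> \<le> exp (t * ?a)"
    using powr_le_one_plus[of "t * ?a" \<beta>] exp_ge_add_one_self[of "t * ?a"] assms a
    by (smt (verit) mult_nonneg_nonneg)
  then have "inverse (exp (t * ?a)) \<le> inverse ((t * ?a) powr \<beta>)"
    using a assms(3) by (intro le_imp_inverse_le) auto
  then have "exp (t * lam c) \<le> (t * ?a) powr (- \<beta>)"
    by (simp add: exp_minus powr_minus flip: exp_minus)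
  also have "\<dots> = t powr - \<beta> * ?a powr - \<beta>"
    by (rule powr_mult)
  finally show "\<bar>exp (t * lam c)\<bar> \<le> t powr - \<beta> * ?a powr - \<beta>"
    by simp
qed

text \<open>One resolvent factor already decays fast enough and the remaining ones are at most 1,
  whence the condition k >= 1.\<close>

lemma cont_extension_resolvent:
  assumes "0 \<le> \<beta>" "\<beta> \<le> 1" "h > 0" "k \<ge> 1"
  shows "cont_extension j (nr (- \<beta>)) (resolvent_op HH lam h ^^ k) (j u)
    = diag_op HH (\<lambda>c. (1 / (1 - h * lam c)) ^ k) u"
proof -
  have pos: "1 - h * lam c \<ge> 1" if "c \<in> HH" for c
    using mult_nonneg_nonpos[of h "lam c"] assms lam_neg[OF that] by auto
  have "resolvent_op HH lam h = diag_op HH (\<lambda>c. 1 / (1 - h * lam c))"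
    using assms(3) lam_neg by (intro ext resolvent_op_eq) (auto intro: less_imp_le)
  moreover have "diag_op HH (\<lambda>c. 1 / (1 - h * lam c)) ^^ k = diag_op HH (\<lambda>c. (1 / (1 - h * lam c)) ^ k)"
    using pos by (intro ext diag_op_funpow) (fastforce simp: divide_le_eq)
  moreover have "cont_extension j (nr (- \<beta>)) (diag_op HH (\<lambda>c. (1 / (1 - h * lam c)) ^ k)) (j u)
      = diag_op HH (\<lambda>c. (1 / (1 - h * lam c)) ^ k) u"
  proof (rule cont_extension_diag_op[OF assms(1), where C="h powr (- \<beta>)"])
    fix c assume c: "c \<in> HH"
    let ?a = "- lam c"
    have a: "?a > 0" using lam_neg[OF c] by simp
    have "(h * ?a) powr \<beta> \<le> 1 - h * lam c"
      using powr_le_one_plus[of "h * ?a" \<beta>] assms a mult_pos_pos[of h ?a] by simp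
    also have "\<dots> \<le> (1 - h * lam c) ^ k"
      using pos[OF c] assms(4) by (intro self_le_power) auto
    finally have "1 / (1 - h * lam c) ^ k \<le> 1 / (h * ?a) powr \<beta>"
      using a assms(3) pos[OF c] by (intro divide_left_mono mult_pos_pos) auto
    also have "\<dots> = (h * ?a) powr (- \<beta>)"
      by (simp add: powr_minus divide_inverse)
    also have "\<dots> = h powr - \<beta> * ?a powr - \<beta>"
      by (rule powr_mult)
    finally show "\<bar>(1 / (1 - h * lam c)) ^ k\<bar> \<le> h powr - \<beta> * ?a powr - \<beta>"
      using pos[OF c] by (simp add: power_one_over)
  qed
  ultimately show ?thesis by simp
qed

end

lemma grid_floor_eq:
  assumes "h > 0"
  shows "grid_floor h t = of_int \<lfloor>t / h\<rfloor> * h"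
  unfolding grid_floor_def
proof (rule Greatest_equality)
  show "of_int \<lfloor>t / h\<rfloor> * h \<le> t \<and> (\<exists>k. of_int \<lfloor>t / h\<rfloor> * h = of_int k * h)"
    using assms by (auto simp flip: pos_le_divide_eq)
  fix y assume y: "y \<le> t \<and> (\<exists>k::int. y = of_int k * h)"
  then obtain k :: int where k: "y = of_int k * h" by blast
  with y assms have "of_int k \<le> t / h" by (simp add: pos_le_divide_eq)
  then have "k \<le> \<lfloor>t / h\<rfloor>" by (simp add: le_floor_iff)
  then show "y \<le> of_int \<lfloor>t / h\<rfloor> * h" using assms k by (simp add: mult_right_mono)
qed

section \<open>Characteristic functions of stochastic integrals\<close>

lemma (in prob_space) char_normal:
  assumes X: "distributed M lborel X (normal_density 0 \<sigma>)" and \<sigma>: "\<sigma> > 0"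
  shows "char (distr M borel X) t = exp (- (\<sigma> * t)\<^sup>2 / 2)"
proof -
  have X_rv [measurable]: "X \<in> borel_measurable M"
    using distributed_measurable[OF X] by simp
  have "distributed M lborel (\<lambda>x. (X x - 0) / \<sigma>) std_normal_density"
    using normal_standard_normal_convert[OF \<sigma>, of X 0] X by blast
  then have "distr M borel (\<lambda>x. X x / \<sigma>) = std_normal_distribution"
    by (simp add: distributed_distr_eq_density[symmetric] cong: distr_cong)
  then have "char (distr M borel (\<lambda>x. X x / \<sigma>)) (\<sigma> * t) = exp (- (\<sigma> * t)\<^sup>2 / 2)"
    by (simp add: char_std_normal_distribution)
  moreover have "char (distr M borel (\<lambda>x. X x / \<sigma>)) (\<sigma> * t) = char (distr M borel X) t"
    unfolding char_def using \<sigma> by (simp add: integral_distr)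
  ultimately show ?thesis by simp
qed

text \<open>The preimages under D already form a sigma-algebra, and the one generated by Z lies in
  F. So the given independence is independence of the two variables, and characteristic functions
  multiply.\<close>

lemma (in prob_space) char_add_indep:
  assumes F: "subalgebra M F" and Z: "Z \<in> borel_measurable F" and D: "D \<in> borel_measurable M"
    and ind: "indep_set (sets F) {D -` S \<inter> space M | S. S \<in> sets borel}"
  shows "char (distr M borel (\<lambda>\<omega>. Z \<omega> + D \<omega>)) t = char (distr M borel Z) t * char (distr M borel D) t"
proof -
  have ZM: "Z \<in> borel_measurable M"
    by (rule measurable_from_subalg[OF F Z])
  have space: "space F = space M" using F by (simp add: subalgebra_def)
  have "sigma_sets (space M) {Z -` A \<inter> space M | A. A \<in> sets borel} \<subseteq> sets F"
    unfolding space[symmetric] using Z by (intro sets.sigma_sets_subset) (auto intro: measurable_sets)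
  moreover have "sigma_sets (space M) {D -` A \<inter> space M | A. A \<in> sets borel} = {D -` A \<inter> space M | A. A \<in> sets borel}"
    using sets_vimage_algebra[of "space M" D borel] sets_vimage_algebra2[of D "space M" borel] by simp
  ultimately have "indep_var borel Z borel D"
    unfolding indep_var_eq using ZM D ind unfolding indep_set_def
    by (auto elim!: indep_sets_mono_sets split: bool.splits dest: subsetD)
  then show ?thesis by (rule char_distr_add)
qed

text \<open>The adjoint of \<open>elem_integrand es s\<close> applied to v, see
  \<open>step_fun_inner\<close>. The elementary integral tested against v is the scalar Wiener
  integral of this step function.\<close>

definition step_fun :: "(real \<times> real \<times> 'a::real_inner \<times> 'a) list \<Rightarrow> 'a \<Rightarrow> real \<Rightarrow> 'a" where
  "step_fun es v s = (\<Sum>(a, b, u, x)\<leftarrow>es. if s \<in> {a<..b} then (x \<bullet> v) *\<^sub>R u else 0)"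

lemma step_fun_simps [simp]:
  "step_fun [] v s = 0"
  "step_fun ((a, b, u, x) # es) v s = (if s \<in> {a<..b} then (x \<bullet> v) *\<^sub>R u else 0) + step_fun es v s"
  by (simp_all add: step_fun_def)

lemma step_fun_inner: "step_fun es v s \<bullet> c = elem_integrand es s c \<bullet> v"
  by (induction es) (auto simp: elem_integrand_def inner_add_left)

lemma step_fun_measurable [measurable]:
  "step_fun es (v :: 'a::{real_inner,second_countable_topology}) \<in> borel_measurable borel"
proof (induction es)
  case Nil
  have "step_fun [] v = (\<lambda>_. 0)" by (simp add: fun_eq_iff)
  then show ?case by simp
next
  case (Cons e es)
  obtain a b u x where e: "e = (a, b, u, x)" by (cases e)
  have "step_fun (e # es) v = (\<lambda>s. (if s \<in> {a<..b} then (x \<bullet> v) *\<^sub>R u else 0) + step_fun es v s)"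
    by (simp add: fun_eq_iff e)
  then show ?case using Cons by simp
qed

lemma step_fun_bounded: "\<exists>C. \<forall>s. norm (step_fun es v s) \<le> C"
proof (induction es)
  case (Cons e es)
  then obtain C where C: "\<And>s. norm (step_fun es v s) \<le> C" by blast
  obtain a b u x where e: "e = (a, b, u, x)" by (cases e)
  have "norm (step_fun (e # es) v s) \<le> norm ((x \<bullet> v) *\<^sub>R u) + C" for s
    unfolding e step_fun_simps by (rule norm_triangle_mono[OF _ C]) auto
  then show ?case by blast
qed auto

text \<open>The elementary integral stopped at time t and tested against v: the adapted process
  along which the induction over time runs.\<close>

definition elem_partial ::
  "(real \<Rightarrow> 'a::real_inner \<Rightarrow> 'w \<Rightarrow> real) \<Rightarrow> (real \<times> real \<times> 'a \<times> 'a) list \<Rightarrow> 'a \<Rightarrow> real \<Rightarrow> 'w \<Rightarrow> real" where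
  "elem_partial W es v t \<omega> = (\<Sum>(a, b, u, x)\<leftarrow>es. (x \<bullet> v) * (W (min b t) u \<omega> - W (min a t) u \<omega>))"

lemma elem_partial_simps [simp]:
  "elem_partial W [] v t \<omega> = 0"
  "elem_partial W ((a, b, u, x) # es) v t \<omega> =
    (x \<bullet> v) * (W (min b t) u \<omega> - W (min a t) u \<omega>) + elem_partial W es v t \<omega>"
  by (simp_all add: elem_partial_def)

lemma elem_partial_end:
  "elem_on T es \<Longrightarrow> elem_partial W es v T \<omega> = elem_integral W es \<omega> \<bullet> v"
proof (induction es)
  case (Cons e es)
  then show ?case
    by (cases e) (auto simp: elem_on_def elem_integral_def inner_add_left min_def algebra_simps)
qed (simp add: elem_integral_def)

section \<open>Elementary integrals against the Wiener process\<close>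

locale wiener_setting =
  fixes M :: "'w measure" and F :: "real \<Rightarrow> 'w measure" and T :: real
    and W :: "real \<Rightarrow> 'a::{real_inner,second_countable_topology} \<Rightarrow> 'w \<Rightarrow> real"
  assumes stoch_basis: "stochastic_basis M F T"
    and wiener: "cylindrical_wiener_process M F T W"
    and T_pos: "T > 0"
begin

sublocale prob_space M
  using stoch_basis by (simp add: stochastic_basis_def)

lemma subalg: "0 \<le> t \<Longrightarrow> t \<le> T \<Longrightarrow> subalgebra M (F t)"
  using stoch_basis by (simp add: stochastic_basis_def)

lemma filtration: "0 \<le> s \<Longrightarrow> s \<le> t \<Longrightarrow> t \<le> T \<Longrightarrow> subalgebra (F t) (F s)"
  using stoch_basis subalg[of s] subalg[of t] by (simp add: stochastic_basis_def subalgebra_def)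

lemma W_adapted: "0 \<le> t \<Longrightarrow> t \<le> T \<Longrightarrow> W t v \<in> borel_measurable (F t)"
  using wiener by (simp add: cylindrical_wiener_process_def)

lemma W_measurable: "0 \<le> t \<Longrightarrow> t \<le> T \<Longrightarrow> W t v \<in> borel_measurable M"
  by (rule measurable_from_subalg[OF subalg W_adapted])

lemma W_linear: "0 \<le> t \<Longrightarrow> t \<le> T \<Longrightarrow> AE \<omega> in M. W t (c *\<^sub>R u + v) \<omega> = c * W t u \<omega> + W t v \<omega>"
  using wiener by (simp add: cylindrical_wiener_process_def)

lemma W_zero: 
  assumes t: "0 \<le> t" "t \<le> T"
  shows "AE \<omega> in M. W t 0 \<omega> = 0"
  using W_linear[OF t, of "- 1" 0 0] by (auto elim!: eventually_mono)

lemma W_indep: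
  "0 \<le> s \<Longrightarrow> s < t \<Longrightarrow> t \<le> T \<Longrightarrow>
    indep_set (sets (F s)) {(\<lambda>\<omega>. W t v \<omega> - W s v \<omega>) -` S \<inter> space M | S. S \<in> sets borel}"
  using wiener unfolding cylindrical_wiener_process_def by blast

text \<open>The argument 1 is general enough, since scaling can be moved into v. The increment in
  direction 0 has no density and is treated apart: it vanishes almost surely by linearity.\<close>

lemma W_char:
  assumes t: "0 \<le> s" "s < t" "t \<le> T"
  shows "char (distr M borel (\<lambda>\<omega>. W t v \<omega> - W s v \<omega>)) 1 = exp (- ((norm v)\<^sup>2 * (t - s)) / 2)"
proof (cases "v = 0")
  case True
  have "AE \<omega> in M. W t v \<omega> - W s v \<omega> = 0"
    using W_zero[of t] W_zero[of s] t True by auto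
  moreover have "(\<lambda>\<omega>. W t v \<omega> - W s v \<omega>) \<in> borel_measurable M"
    using t by (intro borel_measurable_diff W_measurable) auto
  ultimately have "distr M borel (\<lambda>\<omega>. W t v \<omega> - W s v \<omega>) = distr M borel (\<lambda>_. 0)"
    by (intro distr_cong_AE) auto
  then show ?thesis
    using True by (simp add: char_def integral_return)
next
  case False
  then have "distributed M lborel (\<lambda>\<omega>. W t v \<omega> - W s v \<omega>) (normal_density 0 (norm v * sqrt (t - s)))"
    using wiener t unfolding cylindrical_wiener_process_def by blast
  then show ?thesis
    using False t by (subst char_normal) (auto simp: power_mult_distrib)
qed

lemma elem_partial_measurable:
  assumes "elem_on T es" "0 \<le> t" "t \<le> T"
  shows "elem_partial W es v t \<in> borel_measurable (F t)"
  using assms(1)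
proof (induction es)
  case Nil
  have "elem_partial W [] v t = (\<lambda>_. 0)" by (simp add: fun_eq_iff)
  then show ?case by simp
next
  case (Cons e es)
  obtain a b u x where e: "e = (a, b, u, x)" by (cases e)
  have ab: "0 \<le> a" "a \<le> b" "b \<le> T" and es: "elem_on T es"
    using Cons.prems by (auto simp: elem_on_def e)
  have m: "W (min r t) u \<in> borel_measurable (F t)" if "0 \<le> r" for r
    using that assms by (intro measurable_from_subalg[OF filtration W_adapted]) auto
  have "elem_partial W (e # es) v t = (\<lambda>\<omega>. (x \<bullet> v) * (W (min b t) u \<omega> - W (min a t) u \<omega>) + elem_partial W es v t \<omega>)"
    by (simp add: fun_eq_iff e)
  then show ?case
    using Cons.IH[OF es] m[of a] m[of b] ab by simp
qed

text \<open>As no entry starts or ends strictly between s and t, each is either active throughout or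
  does not change. Linearity of W, valid up to null sets, collects the active entries into the
  single direction \<open>step_fun es v t\<close>.\<close>

lemma elem_partial_increment:
  assumes "elem_on T es" "0 \<le> s" "s < t" "t \<le> T"
    and "\<And>a b u x. (a, b, u, x) \<in> set es \<Longrightarrow> (a \<le> s \<or> t \<le> a) \<and> (b \<le> s \<or> t \<le> b)"
  shows "AE \<omega> in M. elem_partial W es v t \<omega> =
      elem_partial W es v s \<omega> + (W t (step_fun es v t) \<omega> - W s (step_fun es v t) \<omega>)"
  using assms(1,5)
proof (induction es)
  case Nil
  then show ?case using W_zero[of s] W_zero[of t] assms by auto
next
  case (Cons e es)
  obtain a b u x where e: "e = (a, b, u, x)" by (cases e)
  have ab: "0 \<le> a" "a \<le> b" "b \<le> T" and es: "elem_on T es"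
    using Cons.prems by (auto simp: elem_on_def e)
  have cases: "a \<le> s \<or> t \<le> a" "b \<le> s \<or> t \<le> b"
    using Cons.prems(2)[of a b u x] by (auto simp: e)
  have IH: "AE \<omega> in M. elem_partial W es v t \<omega> =
      elem_partial W es v s \<omega> + (W t (step_fun es v t) \<omega> - W s (step_fun es v t) \<omega>)"
    using Cons.prems(2) by (intro Cons.IH es) auto
  show ?case
  proof (cases "a \<le> s \<and> t \<le> b")
    case True
    then have "step_fun (e # es) v t = (x \<bullet> v) *\<^sub>R u + step_fun es v t"
      using assms by (auto simp: e)
    moreover have "min b t = t" "min b s = s" "min a t = a" "min a s = a"
      using True assms by auto
    ultimately show ?thesis
      using IH W_linear[of t "x \<bullet> v" u "step_fun es v t"] W_linear[of s "x \<bullet> v" u "step_fun es v t"] assms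
      by (auto simp: e algebra_simps)
  next
    case False
    then have "step_fun (e # es) v t = step_fun es v t"
      using cases ab assms by (auto simp: e)
    moreover have "W (min b t) u \<omega> - W (min a t) u \<omega> = W (min b s) u \<omega> - W (min a s) u \<omega>" for \<omega>
    proof -
      consider "a \<le> s" "b \<le> s" | "t \<le> a" "t \<le> b"
        using False cases ab by linarith
      then show ?thesis using assms by cases (auto simp: min_def)
    qed
    ultimately show ?thesis
      using IH by (simp add: e)
  qed
qed

lemma step_fun_const:
  assumes "\<And>a b u x. (a, b, u, x) \<in> set es \<Longrightarrow> (a \<le> s \<or> t \<le> a) \<and> (b \<le> s \<or> t \<le> b)"
    and "s < r" "r \<le> t"
  shows "step_fun es v r = step_fun es v t"
  using assms(1)
proof (induction es)
  case (Cons e es)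
  obtain a b u x where e: "e = (a, b, u, x)" by (cases e)
  have "(a \<le> s \<or> t \<le> a) \<and> (b \<le> s \<or> t \<le> b)" using Cons.prems[of a b u x] by (simp add: e)
  then have "r \<in> {a<..b} \<longleftrightarrow> t \<in> {a<..b}" using assms(2,3) by auto
  moreover have "step_fun es v r = step_fun es v t"
    using Cons.prems by (intro Cons.IH) auto
  ultimately show ?case by (simp add: e)
qed simp

lemma step_fun_sq_integrable: "set_integrable lborel {p<..q} (\<lambda>r. (norm (step_fun es (v::'a) r))\<^sup>2)"
proof -
  obtain C where C: "\<And>s. norm (step_fun es v s) \<le> C" using step_fun_bounded by blast
  have "(norm (step_fun es v r))\<^sup>2 \<le> C\<^sup>2" for r using C[of r] by (simp add: power_mono)
  moreover have "emeasure lborel {p<..q} < \<infinity>"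
    by (cases "p \<le> q") auto
  ultimately show ?thesis
    unfolding set_integrable_def
    by (intro integrableI_bounded_set_indicator[where B="C\<^sup>2"]) auto
qed

text \<open>Between consecutive end points the stopped integral grows by a Wiener increment in a
  fixed direction, independent of the past. So the characteristic functions multiply, and their
  exponents add up to the integral of the squared step function.\<close>

lemma elem_integral_char:
  assumes es: "elem_on T es"
  shows "(CLINT \<omega>|M. iexp (elem_integral W es \<omega> \<bullet> v)) =
    exp (- (LINT r:{0<..T}|lborel. (norm (step_fun es v r))\<^sup>2) / 2)"
proof -
  define I where "I = (\<lambda>t. LINT r:{0<..t}|lborel. (norm (step_fun es v r))\<^sup>2)"
  define P where "P = {0, T} \<union> (\<Union>(a, b, u, x)\<in>set es. {a, b})"
  have P: "finite P" "P \<subseteq> {0..T}"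
    using es T_pos by (auto simp: P_def elem_on_def)
  have endpoints: "a \<in> P \<and> b \<in> P" if "(a, b, u, x) \<in> set es" for a b u x
    using that by (force simp: P_def)
  have "char (distr M borel (elem_partial W es v t)) 1 = exp (- I t / 2)" if "t \<in> P" for t
    using that
  \<comment> \<open>The number of end points before t is the induction measure; the preceding
    instance is the largest end point below t.\<close>
  proof (induction "card {p \<in> P. p < t}" arbitrary: t rule: less_induct)
    case less
    have t: "0 \<le> t" "t \<le> T" using less.prems P by auto
    show ?case
    proof (cases "t = 0")
      case True
      have "elem_partial W es v 0 \<omega> = 0" for \<omega>
        using es by (induction es) (auto simp: elem_on_def min_absorb2)
      then have "elem_partial W es v 0 = (\<lambda>_. 0)" by (simp add: fun_eq_iff)
      moreover have "I 0 = 0" by (simp add: I_def set_lebesgue_integral_def)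
      ultimately show ?thesis using True by (simp add: char_def integral_return)
    next
      case False
      define s where "s = Max {p \<in> P. p < t}"
      have "0 \<in> P" by (simp add: P_def)
      then have ne: "finite {p \<in> P. p < t}" "{p \<in> P. p < t} \<noteq> {}" using P False t by auto
      then have s: "s \<in> P" "s < t" using Max_in[OF ne] by (auto simp: s_def)
      have s0: "0 \<le> s" using s P by auto
      have gap: "p \<le> s \<or> t \<le> p" if "p \<in> P" for p
        using Max_ge[OF ne(1), of p] that by (auto simp: s_def not_le)
      have "card {p \<in> P. p < s} < card {p \<in> P. p < t}"
        using s by (intro psubset_card_mono ne) auto
      from less.hyps[OF this s(1)]
      have IH: "char (distr M borel (elem_partial W es v s)) 1 = exp (- I s / 2)" .
      let ?w = "step_fun es v t"
      have sep: "(a \<le> s \<or> t \<le> a) \<and> (b \<le> s \<or> t \<le> b)" if "(a, b, u, x) \<in> set es" for a b u x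
        using gap endpoints[OF that] by blast
      have Dm: "(\<lambda>\<omega>. W t ?w \<omega> - W s ?w \<omega>) \<in> borel_measurable M"
        using s s0 t by (intro borel_measurable_diff W_measurable) auto
      have Zs: "elem_partial W es v s \<in> borel_measurable (F s)"
        using s s0 t by (intro elem_partial_measurable es) auto
      have Fs: "subalgebra M (F s)" using s s0 t by (intro subalg) auto
      have "distr M borel (elem_partial W es v t) =
          distr M borel (\<lambda>\<omega>. elem_partial W es v s \<omega> + (W t ?w \<omega> - W s ?w \<omega>))"
      proof (rule distr_cong_AE)
        show "AE \<omega> in M. elem_partial W es v t \<omega> = elem_partial W es v s \<omega> + (W t ?w \<omega> - W s ?w \<omega>)"
          by (rule elem_partial_increment[OF es s0 s(2) t(2) sep])
        show "elem_partial W es v t \<in> borel_measurable M"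
          by (rule measurable_from_subalg[OF subalg[OF t] elem_partial_measurable[OF es t]])
        show "(\<lambda>\<omega>. elem_partial W es v s \<omega> + (W t ?w \<omega> - W s ?w \<omega>)) \<in> borel_measurable M"
          by (rule borel_measurable_add[OF measurable_from_subalg[OF Fs Zs] Dm])
      qed auto
      then have "char (distr M borel (elem_partial W es v t)) 1 =
          char (distr M borel (elem_partial W es v s)) 1 * char (distr M borel (\<lambda>\<omega>. W t ?w \<omega> - W s ?w \<omega>)) 1"
        using char_add_indep[OF Fs Zs Dm W_indep[OF s0 s(2) t(2)]] by simp
      also have "\<dots> = exp (- I s / 2) * exp (- ((norm ?w)\<^sup>2 * (t - s)) / 2)"
        unfolding IH W_char[OF s0 s(2) t(2)] by simp
      also have "\<dots> = exp (- (I s + (norm ?w)\<^sup>2 * (t - s)) / 2)"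
        by (simp only: exp_add[symmetric] of_real_mult[symmetric] minus_add_distrib add_divide_distrib diff_conv_add_uminus)
      also have "I s + (norm ?w)\<^sup>2 * (t - s) = I t"
      proof -
        have un: "{0<..t} = {0<..s} \<union> {s<..t}" using s s0 by auto
        have "I t = I s + (LINT r:{s<..t}|lborel. (norm (step_fun es v r))\<^sup>2)"
          unfolding I_def un by (rule set_integral_Un) (auto intro: step_fun_sq_integrable)
        also have "(LINT r:{s<..t}|lborel. (norm (step_fun es v r))\<^sup>2) = (LINT r:{s<..t}|lborel. (norm ?w)\<^sup>2)"
        proof (rule set_lebesgue_integral_cong)
          show "\<forall>r. r \<in> {s<..t} \<longrightarrow> (norm (step_fun es v r))\<^sup>2 = (norm ?w)\<^sup>2"
          proof (intro allI impI)
            fix r assume r: "r \<in> {s<..t}"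
            have "step_fun es v r = ?w"
            proof (rule step_fun_const)
              show "(a \<le> s \<or> t \<le> a) \<and> (b \<le> s \<or> t \<le> b)" if "(a, b, u, x) \<in> set es" for a b u x
                by (rule sep[OF that])
            qed (use r in auto)
            then show "(norm (step_fun es v r))\<^sup>2 = (norm ?w)\<^sup>2"
              by (rule arg_cong)
          qed
        qed simp
        also have "\<dots> = (norm ?w)\<^sup>2 * (t - s)"
          using s(2) by (simp add: set_lebesgue_integral_def)
        finally show ?thesis by simp
      qed
      finally show ?thesis .
    qed
  qed
  from this[of T] have "char (distr M borel (elem_partial W es v T)) 1 = exp (- I T / 2)"
    by (simp add: P_def)
  moreover have "elem_partial W es v T \<in> borel_measurable M"
    using T_pos by (intro measurable_from_subalg[OF subalg elem_partial_measurable[OF es]]) auto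
  ultimately show ?thesis
    unfolding char_def I_def by (simp add: integral_distr elem_partial_end[OF es])
qed

end

text \<open>Here \<open>f\<close> is arbitrary: it will be the squared Hilbert-Schmidt distance of
  two integrands as a function of time, for which measurability is not established. Simple functions
  below \<open>C * f\<close>, divided by C, are simple functions below \<open>f\<close>.\<close>

lemma nn_integral_cmult_le:
  assumes C: "C > 0"
  shows "(\<integral>\<^sup>+x. ennreal C * f x \<partial>M) \<le> ennreal C * (\<integral>\<^sup>+x. f x \<partial>M)"
  unfolding nn_integral_def[of M "\<lambda>x. ennreal C * f x"]
proof (rule SUP_least, safe)
  fix g assume g: "simple_function M g" "g \<le> (\<lambda>x. ennreal C * f x)"
  let ?k = "\<lambda>x. ennreal (1 / C) * g x"
  have inv: "ennreal C * (ennreal (1 / C) * y) = y" "ennreal (1 / C) * (ennreal C * y) = y" for y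
    using C by (simp_all add: mult.assoc[symmetric] ennreal_mult''[symmetric])
  have k: "simple_function M ?k" using g(1) by auto
  have "?k x \<le> f x" for x
    using mult_left_mono[OF le_funD[OF g(2), of x], of "ennreal (1 / C)"] by (simp add: inv)
  then have "integral\<^sup>S M ?k \<le> integral\<^sup>N M f"
    unfolding nn_integral_eq_simple_integral[OF k, symmetric] by (intro nn_integral_mono) auto
  moreover have "integral\<^sup>S M g = ennreal C * integral\<^sup>S M ?k"
    using simple_integral_mult[OF k, of "ennreal C"] by (simp add: inv)
  ultimately show "integral\<^sup>S M g \<le> ennreal C * integral\<^sup>N M f"
    by (simp add: mult_left_mono)
qed

text \<open>The factor C e may blow up as e tends to 0. One first fixes e to make the second summand
  small, and only then lets n grow.\<close>

lemma tendsto_via_absorption: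
  fixes x :: "nat \<Rightarrow> 'a::real_normed_vector"
  assumes d: "d \<longlonglongrightarrow> (0::real)"
    and le: "\<And>e. e > 0 \<Longrightarrow> \<forall>\<^sub>F n in sequentially. norm (x n - L) \<le> C e * d n + e * Q"
  shows "x \<longlonglongrightarrow> L"
proof (rule tendstoI)
  fix r :: real assume r: "r > 0"
  define e where "e = r / (2 * (\<bar>Q\<bar> + 1))"
  have e: "e > 0" using r by (simp add: e_def)
  have "e * Q \<le> e * (\<bar>Q\<bar> + 1)" using e by (intro mult_left_mono) auto
  also have "\<dots> = r / 2" by (simp add: e_def field_simps)
  finally have eQ: "e * Q \<le> r / 2" .
  have "(\<lambda>n. C e * d n) \<longlonglongrightarrow> 0" using tendsto_mult_right_zero[OF d] by simp
  then have "\<forall>\<^sub>F n in sequentially. C e * d n < r / 2"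
    using r by (intro order_tendstoD(2)) auto
  with le[OF e] show "\<forall>\<^sub>F n in sequentially. dist (x n) L < r"
    by eventually_elim (use eQ in \<open>simp add: dist_norm\<close>)
qed

text \<open>Young's inequality with weight e for the cross term 2 |y| |x - y|.\<close>

lemma square_diff_bound:
  fixes x y :: "'a::real_normed_vector"
  assumes e: "e > 0"
  shows "\<bar>(norm x)\<^sup>2 - (norm y)\<^sup>2\<bar> \<le> (1 + 1 / e) * (norm (x - y))\<^sup>2 + e * (norm y)\<^sup>2"
proof -
  let ?d = "norm (x - y)"
  have 1: "\<bar>norm x - norm y\<bar> \<le> ?d" by (rule norm_triangle_ineq3)
  have "\<bar>(norm x)\<^sup>2 - (norm y)\<^sup>2\<bar> = \<bar>norm x - norm y\<bar> * (norm x + norm y)"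
    by (simp add: power2_eq_square square_diff_square_factored abs_mult mult.commute)
  also have "\<dots> \<le> ?d * (2 * norm y + ?d)"
    using 1 by (intro mult_mono) auto
  also have "\<dots> = ?d\<^sup>2 + 2 * (norm y * ?d)"
    by (simp add: power2_eq_square algebra_simps)
  also have "2 * (norm y * ?d) \<le> ?d\<^sup>2 / e + e * (norm y)\<^sup>2"
  proof -
    have "0 \<le> (?d - e * norm y)\<^sup>2 / e" using e by simp
    also have "\<dots> = ?d\<^sup>2 / e + e * (norm y)\<^sup>2 - 2 * (norm y * ?d)"
      using e by (simp add: power2_eq_square field_simps)
    finally show ?thesis by simp
  qed
  finally show ?thesis by (simp add: algebra_simps)
qed

lemma norm_iexp_diff_le: "norm (iexp x - iexp y) \<le> \<bar>x - y\<bar>"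
proof -
  have "iexp x - iexp y = iexp y * (iexp (x - y) - 1)"
    by (simp add: algebra_simps flip: exp_add)
  then have "norm (iexp x - iexp y) = norm (iexp (x - y) - 1)"
    by (simp add: norm_mult)
  then show ?thesis
    using iexp_approx1[of "x - y" 0] by simp
qed

text \<open>Convergence in L^2 implies convergence of the squared L^2 norms. Boundedness on a set of
  finite measure supplies all the integrability.\<close>

lemma set_integral_square_tendsto:
  fixes f :: "nat \<Rightarrow> real \<Rightarrow> 'a::{real_inner,second_countable_topology}"
  assumes A [measurable]: "A \<in> sets borel" and fin: "emeasure lborel A < \<infinity>"
    and f [measurable]: "\<And>n. f n \<in> borel_measurable borel" and g [measurable]: "g \<in> borel_measurable borel"
    and bf: "\<And>n. \<exists>C. \<forall>s\<in>A. norm (f n s) \<le> C" and bg: "\<exists>C. \<forall>s\<in>A. norm (g s) \<le> C"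
    and lim: "(\<lambda>n. \<integral>\<^sup>+s\<in>A. ennreal ((norm (f n s - g s))\<^sup>2) \<partial>lborel) \<longlonglongrightarrow> 0"
  shows "(\<lambda>n. LINT s:A|lborel. (norm (f n s))\<^sup>2) \<longlonglongrightarrow> (LINT s:A|lborel. (norm (g s))\<^sup>2)"
proof -
  have int: "set_integrable lborel A (\<lambda>s. (norm (u s))\<^sup>2)"
    if [measurable]: "u \<in> borel_measurable borel" and b: "\<exists>C. \<forall>s\<in>A. norm (u s) \<le> C" for u :: "real \<Rightarrow> 'a"
  proof -
    from b obtain C where "\<And>s. s \<in> A \<Longrightarrow> norm (u s) \<le> C" by blast
    then have "(norm (u s))\<^sup>2 \<le> C\<^sup>2" if "s \<in> A" for s using that by (simp add: power_mono)
    then show ?thesis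
      unfolding set_integrable_def using fin
      by (intro integrableI_bounded_set_indicator[where B="C\<^sup>2"]) auto
  qed
  have bd: "\<exists>C. \<forall>s\<in>A. norm (f n s - g s) \<le> C" for n
  proof -
    obtain C D where "\<And>s. s \<in> A \<Longrightarrow> norm (f n s) \<le> C" "\<And>s. s \<in> A \<Longrightarrow> norm (g s) \<le> D"
      using bf[of n] bg by blast
    then show ?thesis by (intro exI[of _ "C + D"]) (meson add_mono norm_triangle_ineq4 order_trans)
  qed
  note i1 = int[OF f bf] and i2 = int[OF g bg]
  have i3: "set_integrable lborel A (\<lambda>s. (norm (f n s - g s))\<^sup>2)" for n
    by (rule int[OF _ bd]) simp
  define d where "d = (\<lambda>n. LINT s:A|lborel. (norm (f n s - g s))\<^sup>2)"
  have "(\<integral>\<^sup>+s\<in>A. ennreal ((norm (f n s - g s))\<^sup>2) \<partial>lborel) = ennreal (d n)" for n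
  proof -
    have "(\<integral>\<^sup>+s\<in>A. ennreal ((norm (f n s - g s))\<^sup>2) \<partial>lborel) =
        (\<integral>\<^sup>+s. ennreal (indicator A s *\<^sub>R (norm (f n s - g s))\<^sup>2) \<partial>lborel)"
      by (intro nn_integral_cong) (auto simp: indicator_def)
    also have "\<dots> = ennreal (d n)"
      unfolding d_def set_lebesgue_integral_def
      using i3[of n] by (intro nn_integral_eq_integral) (auto simp: set_integrable_def)
    finally show ?thesis .
  qed
  moreover have "d n \<ge> 0" for n
    unfolding d_def set_lebesgue_integral_def by (intro integral_nonneg_AE) auto
  ultimately have "d \<longlonglongrightarrow> 0"
    using lim by (simp add: ennreal_tendsto_0_iff)
  then show ?thesis
  proof (rule tendsto_via_absorption, intro always_eventually allI)
    fix e :: real and n assume e: "e > 0"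
    have "norm ((LINT s:A|lborel. (norm (f n s))\<^sup>2) - (LINT s:A|lborel. (norm (g s))\<^sup>2)) =
        norm (LINT s:A|lborel. (norm (f n s))\<^sup>2 - (norm (g s))\<^sup>2)"
      by (subst set_integral_diff) (auto intro: i1 i2)
    also have "\<dots> \<le> (LINT s:A|lborel. \<bar>(norm (f n s))\<^sup>2 - (norm (g s))\<^sup>2\<bar>)"
      unfolding set_lebesgue_integral_def
      by (rule order_trans[OF integral_norm_bound]) (simp add: abs_mult)
    also have "\<dots> \<le> (LINT s:A|lborel. (1 + 1 / e) * (norm (f n s - g s))\<^sup>2 + e * (norm (g s))\<^sup>2)"
      by (intro set_integral_mono set_integrable_abs set_integral_diff set_integral_add
          set_integrable_mult_right i1 i2 i3 square_diff_bound e)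
    also have "\<dots> = (1 + 1 / e) * d n + e * (LINT s:A|lborel. (norm (g s))\<^sup>2)"
      unfolding d_def
      by (subst set_integral_add) (auto intro: set_integrable_mult_right i1 i2 i3 simp: set_integral_mult_right)
    finally show "norm ((LINT s:A|lborel. (norm (f n s))\<^sup>2) - (LINT s:A|lborel. (norm (g s))\<^sup>2)) \<le>
        (\<lambda>e. 1 + 1 / e) e * d n + e * (LINT s:A|lborel. (norm (g s))\<^sup>2)" by simp
  qed
qed

text \<open>The function \<open>iexp\<close> is Lipschitz, so the error is at most the mean of t =
  |v| |X - Z n|. The inequality t <= t^2 / e + e replaces this first moment by the second moment
  that is known to tend to 0.\<close>

lemma (in prob_space) iexp_inner_tendsto:
  fixes X :: "'a \<Rightarrow> 'b::{real_inner,second_countable_topology}"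
  assumes X [measurable]: "X \<in> borel_measurable M" and Z [measurable]: "\<And>n. Z n \<in> borel_measurable M"
    and lim: "(\<lambda>n. \<integral>\<^sup>+\<omega>. ennreal ((norm (X \<omega> - Z n \<omega>))\<^sup>2) \<partial>M) \<longlonglongrightarrow> 0"
  shows "(\<lambda>n. CLINT \<omega>|M. iexp (Z n \<omega> \<bullet> v)) \<longlonglongrightarrow> (CLINT \<omega>|M. iexp (X \<omega> \<bullet> v))"
proof -
  define d where "d = (\<lambda>n. enn2real (\<integral>\<^sup>+\<omega>. ennreal ((norm (X \<omega> - Z n \<omega>))\<^sup>2) \<partial>M))"
  have d0: "d \<longlonglongrightarrow> 0"
    unfolding d_def using tendsto_enn2real[of _ 0] lim by simp
  \<comment> \<open>A sequence in \<open>ennreal\<close> tending to 0 may start with infinite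
    values, which \<open>enn2real\<close> maps to the default 0. The estimate with d is therefore
    made only eventually.\<close>
  have fin: "\<forall>\<^sub>F n in sequentially. (\<integral>\<^sup>+\<omega>. ennreal ((norm (X \<omega> - Z n \<omega>))\<^sup>2) \<partial>M) < \<infinity>"
    using lim by (intro order_tendstoD(2)) auto
  show ?thesis
  proof (rule tendsto_via_absorption[OF d0])
    fix e :: real assume e: "e > 0"
    show "\<forall>\<^sub>F n in sequentially. norm ((CLINT \<omega>|M. iexp (Z n \<omega> \<bullet> v)) - (CLINT \<omega>|M. iexp (X \<omega> \<bullet> v)))
        \<le> (\<lambda>e. (norm v)\<^sup>2 / e) e * d n + e * 1"
      using fin
    proof eventually_elim
      case (elim n)
      have int: "integrable M (\<lambda>\<omega>. (norm (X \<omega> - Z n \<omega>))\<^sup>2)"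
        using elim by (intro integrableI_nonneg) auto
      have d: "(LINT \<omega>|M. (norm (X \<omega> - Z n \<omega>))\<^sup>2) = d n"
        unfolding d_def by (intro integral_eq_nn_integral) auto
      have ie: "integrable M (\<lambda>\<omega>. iexp (U \<omega> \<bullet> v))" if [measurable]: "U \<in> borel_measurable M" for U :: "'a \<Rightarrow> 'b"
        by (intro integrable_const_bound[where B=1]) auto
      have "norm ((CLINT \<omega>|M. iexp (Z n \<omega> \<bullet> v)) - (CLINT \<omega>|M. iexp (X \<omega> \<bullet> v))) =
          norm (CLINT \<omega>|M. iexp (Z n \<omega> \<bullet> v) - iexp (X \<omega> \<bullet> v))"
        by (subst Bochner_Integration.integral_diff) (auto intro: ie X Z)
      also have "\<dots> \<le> (LINT \<omega>|M. norm (iexp (Z n \<omega> \<bullet> v) - iexp (X \<omega> \<bullet> v)))"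
        by (rule integral_norm_bound)
      also have "\<dots> \<le> (LINT \<omega>|M. (norm v)\<^sup>2 / e * (norm (X \<omega> - Z n \<omega>))\<^sup>2 + e)"
      proof (rule integral_mono)
        show "integrable M (\<lambda>\<omega>. norm (iexp (Z n \<omega> \<bullet> v) - iexp (X \<omega> \<bullet> v)))"
          by (intro integrable_norm Bochner_Integration.integrable_diff ie X Z)
        show "integrable M (\<lambda>\<omega>. (norm v)\<^sup>2 / e * (norm (X \<omega> - Z n \<omega>))\<^sup>2 + e)"
          by (intro Bochner_Integration.integrable_add integrable_mult_right int) auto
        fix \<omega>
        let ?t = "norm v * norm (X \<omega> - Z n \<omega>)"
        have "norm (iexp (Z n \<omega> \<bullet> v) - iexp (X \<omega> \<bullet> v)) \<le> \<bar>(X \<omega> - Z n \<omega>) \<bullet> v\<bar>"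
          using norm_iexp_diff_le[of "Z n \<omega> \<bullet> v" "X \<omega> \<bullet> v"] by (simp add: inner_diff_left)
        also have "\<dots> \<le> ?t"
          using Cauchy_Schwarz_ineq2[of "X \<omega> - Z n \<omega>" v] by (simp add: mult.commute)
        also have "\<dots> \<le> ?t\<^sup>2 / e + e"
        proof (cases "?t \<le> e")
          case False
          then have "?t * e \<le> ?t * ?t" using e by (intro mult_left_mono) auto
          then have "?t \<le> ?t\<^sup>2 / e" using e by (simp add: field_simps power2_eq_square)
          then show ?thesis using e by linarith
        qed (use e in \<open>auto intro: order_trans\<close>)
        finally show "norm (iexp (Z n \<omega> \<bullet> v) - iexp (X \<omega> \<bullet> v)) \<le> (norm v)\<^sup>2 / e * (norm (X \<omega> - Z n \<omega>))\<^sup>2 + e"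
          by (simp add: power_mult_distrib)
      qed
      also have "\<dots> = (norm v)\<^sup>2 / e * d n + e"
        by (subst Bochner_Integration.integral_add, intro integrable_mult_right int) (simp_all add: d prob_space)
      finally show ?case by simp
    qed
  qed
qed

text \<open>Parseval, with the sum over finite subsets exchanged for the \<open>count_space\<close>
  integral in which the approximation of stochastic integrals is formulated.\<close>

lemma (in onb) norm_le_nn_integral_coeffs:
  "ennreal ((norm u)\<^sup>2) \<le> (\<integral>\<^sup>+c. ennreal ((c \<bullet> u)\<^sup>2) \<partial>count_space HH)"
proof (rule tendsto_upperbound)
  show "((\<lambda>F. ennreal (\<Sum>c\<in>F. (c \<bullet> u)\<^sup>2)) \<longlongrightarrow> ennreal ((norm u)\<^sup>2)) (finite_subsets_at_top HH)"
    using parseval[of u] unfolding has_sum_def by (rule tendsto_ennrealI)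
  show "\<forall>\<^sub>F F in finite_subsets_at_top HH. ennreal (\<Sum>c\<in>F. (c \<bullet> u)\<^sup>2) \<le> (\<integral>\<^sup>+c. ennreal ((c \<bullet> u)\<^sup>2) \<partial>count_space HH)"
  proof (rule eventually_finite_subsets_at_top_weakI)
    fix F assume F: "finite F" "F \<subseteq> HH"
    have "ennreal (\<Sum>c\<in>F. (c \<bullet> u)\<^sup>2) = (\<Sum>c\<in>F. ennreal ((c \<bullet> u)\<^sup>2) * indicator F c)"
      by (simp add: sum_ennreal)
    also have "\<dots> = (\<integral>\<^sup>+c. ennreal ((c \<bullet> u)\<^sup>2) * indicator F c \<partial>count_space HH)"
      using F by (intro nn_integral_count_space'[symmetric]) auto
    also have "\<dots> \<le> (\<integral>\<^sup>+c. ennreal ((c \<bullet> u)\<^sup>2) \<partial>count_space HH)"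
      by (intro nn_integral_mono) (auto simp: indicator_def)
    finally show "ennreal (\<Sum>c\<in>F. (c \<bullet> u)\<^sup>2) \<le> (\<integral>\<^sup>+c. ennreal ((c \<bullet> u)\<^sup>2) \<partial>count_space HH)" .
  qed
qed simp

section \<open>Stochastic integrals of diagonal integrands\<close>

locale wiener_onb = wiener_setting M F T W + onb HH
  for M :: "'w measure" and F T and W :: "real \<Rightarrow> 'a::{real_inner,banach,second_countable_topology} \<Rightarrow> 'w \<Rightarrow> real"
    and HH :: "'a set"
begin

lemma elem_integral_measurable:
  assumes "elem_on T es"
  shows "elem_integral W es \<in> borel_measurable M"
  using assms
proof (induction es)
  case Nil
  have "elem_integral W [] = (\<lambda>_. 0)" by (simp add: fun_eq_iff elem_integral_def)
  then show ?case by simp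
next
  case (Cons e es)
  obtain a b u x where e: "e = (a, b, u, x)" by (cases e)
  have ab: "0 \<le> a" "a \<le> b" "b \<le> T" and es: "elem_on T es"
    using Cons.prems by (auto simp: elem_on_def e)
  have "elem_integral W (e # es) = (\<lambda>\<omega>. (W b u \<omega> - W a u \<omega>) *\<^sub>R x + elem_integral W es \<omega>)"
    by (simp add: fun_eq_iff e elem_integral_def)
  then show ?case
    using Cons.IH[OF es] W_measurable[of a u] W_measurable[of b u] ab by simp
qed

text \<open>Both sides of \<open>elem_integral_char\<close> pass to the limit: the left one because
  the integrals converge in mean square, the right one because the adjoints applied to v converge in
  L^2. Diagonality then splits the limiting variance over the basis vectors in K.\<close>

lemma stochastic_integral_char:
  assumes SI: "has_stochastic_integral HH M W T \<Phi> X"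
    and \<Phi>: "\<And>s c. 0 \<le> s \<Longrightarrow> s < T \<Longrightarrow> c \<in> HH \<Longrightarrow> \<Phi> s c = m c s *\<^sub>R c"
    and m [measurable]: "\<And>c. c \<in> HH \<Longrightarrow> m c \<in> borel_measurable borel"
    and mb: "\<And>c. c \<in> HH \<Longrightarrow> \<exists>C. \<forall>s\<in>{0<..T}. \<bar>m c s\<bar> \<le> C"
    and K: "finite K" "K \<subseteq> HH"
  shows "(CLINT \<omega>|M. iexp (X \<omega> \<bullet> (\<Sum>c\<in>K. z c *\<^sub>R c))) =
    exp (- (\<Sum>c\<in>K. (z c)\<^sup>2 * (LINT s:{0<..T}|lborel. (m c s)\<^sup>2)) / 2)"
proof -
  define v where "v = (\<Sum>c\<in>K. z c *\<^sub>R c)"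
  \<comment> \<open>On [0,T) this is the adjoint of \<open>\<Phi> s\<close> applied to v, hence the
    expected limit of the step functions.\<close>
  define g where "g = (\<lambda>s. \<Sum>c\<in>K. (z c * m c s) *\<^sub>R c)"
  from SI obtain es where es: "\<And>n. elem_on T (es n)"
    and lim1: "(\<lambda>n. \<integral>\<^sup>+ s\<in>{0..T}. (\<integral>\<^sup>+ b. ennreal ((norm (\<Phi> s b - elem_integrand (es n) s b))\<^sup>2) \<partial>count_space HH)
             \<partial>lborel) \<longlonglongrightarrow> 0"
    and lim2: "(\<lambda>n. \<integral>\<^sup>+ \<omega>. ennreal ((norm (X \<omega> - elem_integral W (es n) \<omega>))\<^sup>2) \<partial>M) \<longlonglongrightarrow> 0"
    and X: "X \<in> borel_measurable M"
    unfolding has_stochastic_integral_def by blast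
  have cv: "c \<bullet> v = (if c \<in> K then z c else 0)" if "c \<in> HH" for c
    unfolding v_def using K that by (rule inner_finite_sum)
  have cg: "c \<bullet> g s = m c s * (c \<bullet> v)" if "c \<in> HH" for c s
    unfolding g_def using K that by (simp add: inner_finite_sum cv)
  let ?A = "{0<..T}"
  \<comment> \<open>The Hilbert-Schmidt norm bounds the norm of the adjoint applied to v by its
    product with |v|. The added 1 keeps the factor positive when v = 0, as
    \<open>nn_integral_cmult_le\<close> requires.\<close>
  have pointwise: "ennreal ((norm (step_fun (es n) v s - g s))\<^sup>2) \<le>
      ennreal ((norm v)\<^sup>2 + 1) * (\<integral>\<^sup>+ b. ennreal ((norm (\<Phi> s b - elem_integrand (es n) s b))\<^sup>2) \<partial>count_space HH)"
    if s: "0 \<le> s" "s < T" for n s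
  proof -
    have "(c \<bullet> (step_fun (es n) v s - g s))\<^sup>2 \<le> ((norm v)\<^sup>2 + 1) * (norm (\<Phi> s c - elem_integrand (es n) s c))\<^sup>2"
      if c: "c \<in> HH" for c
    proof -
      have "c \<bullet> (step_fun (es n) v s - g s) = (elem_integrand (es n) s c - \<Phi> s c) \<bullet> v"
        using c s by (simp add: inner_diff_right inner_diff_left cg \<Phi> inner_commute[of c "step_fun _ _ _"] step_fun_inner)
      then have "\<bar>c \<bullet> (step_fun (es n) v s - g s)\<bar> \<le> norm v * norm (\<Phi> s c - elem_integrand (es n) s c)"
        using Cauchy_Schwarz_ineq2[of "elem_integrand (es n) s c - \<Phi> s c" v] by (simp add: mult.commute norm_minus_commute)
      then have "(c \<bullet> (step_fun (es n) v s - g s))\<^sup>2 \<le> (norm v * norm (\<Phi> s c - elem_integrand (es n) s c))\<^sup>2"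
        by (intro power2_le_iff_abs_le[THEN iffD2]) auto
      also have "\<dots> \<le> ((norm v)\<^sup>2 + 1) * (norm (\<Phi> s c - elem_integrand (es n) s c))\<^sup>2"
        by (simp add: power_mult_distrib mult_right_mono)
      finally show ?thesis .
    qed
    then have "(\<integral>\<^sup>+c. ennreal ((c \<bullet> (step_fun (es n) v s - g s))\<^sup>2) \<partial>count_space HH) \<le>
        (\<integral>\<^sup>+c. ennreal ((norm v)\<^sup>2 + 1) * ennreal ((norm (\<Phi> s c - elem_integrand (es n) s c))\<^sup>2) \<partial>count_space HH)"
      by (intro nn_integral_mono, subst ennreal_mult[symmetric]) (auto intro!: ennreal_leI)
    also have "\<dots> = ennreal ((norm v)\<^sup>2 + 1) * (\<integral>\<^sup>+c. ennreal ((norm (\<Phi> s c - elem_integrand (es n) s c))\<^sup>2) \<partial>count_space HH)"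
      by (intro nn_integral_cmult) auto
    finally show ?thesis
      by (rule order_trans[OF norm_le_nn_integral_coeffs])
  qed
  have le0: "(\<integral>\<^sup>+s\<in>?A. ennreal ((norm (step_fun (es n) v s - g s))\<^sup>2) \<partial>lborel) \<le>
      ennreal ((norm v)\<^sup>2 + 1) * (\<integral>\<^sup>+ s\<in>{0..T}. (\<integral>\<^sup>+ b. ennreal ((norm (\<Phi> s b - elem_integrand (es n) s b))\<^sup>2) \<partial>count_space HH) \<partial>lborel)" for n
  proof -
    let ?G = "\<lambda>s. \<integral>\<^sup>+ b. ennreal ((norm (\<Phi> s b - elem_integrand (es n) s b))\<^sup>2) \<partial>count_space HH"
    \<comment> \<open>The diagonal form of \<Phi> is given for s < T; the end point T is a null
      set.\<close>
    have "AE s in lborel. s \<noteq> T" by (rule AE_lborel_singleton)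
    then have "AE s in lborel. ennreal ((norm (step_fun (es n) v s - g s))\<^sup>2) * indicator ?A s \<le>
        ennreal ((norm v)\<^sup>2 + 1) * (?G s * indicator {0..T} s)"
      by eventually_elim (use pointwise in \<open>auto simp: indicator_def\<close>)
    then have "(\<integral>\<^sup>+s\<in>?A. ennreal ((norm (step_fun (es n) v s - g s))\<^sup>2) \<partial>lborel) \<le>
        (\<integral>\<^sup>+s. ennreal ((norm v)\<^sup>2 + 1) * (?G s * indicator {0..T} s) \<partial>lborel)"
      by (rule nn_integral_mono_AE)
    also have "\<dots> \<le> ennreal ((norm v)\<^sup>2 + 1) * (\<integral>\<^sup>+s\<in>{0..T}. ?G s \<partial>lborel)"
      by (rule nn_integral_cmult_le) (simp add: add_nonneg_pos)
    finally show ?thesis .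
  qed
  have up0: "(\<lambda>n. ennreal ((norm v)\<^sup>2 + 1) * (\<integral>\<^sup>+ s\<in>{0..T}. (\<integral>\<^sup>+ b. ennreal ((norm (\<Phi> s b - elem_integrand (es n) s b))\<^sup>2) \<partial>count_space HH) \<partial>lborel)) \<longlonglongrightarrow> 0"
    using ennreal_tendsto_cmult[OF _ lim1, of "ennreal ((norm v)\<^sup>2 + 1)"] by simp
  have lim0: "(\<lambda>n. \<integral>\<^sup>+s\<in>?A. ennreal ((norm (step_fun (es n) v s - g s))\<^sup>2) \<partial>lborel) \<longlonglongrightarrow> 0"
    by (rule tendsto_sandwich[OF _ always_eventually[OF allI[OF le0]] tendsto_const up0]) simp
  have "g \<in> borel_measurable borel"
    unfolding g_def using K m by (intro borel_measurable_sum borel_measurable_scaleR borel_measurable_times) auto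
  moreover have "\<exists>C. \<forall>s\<in>?A. norm (g s) \<le> C"
  proof -
    have "\<forall>c\<in>K. \<exists>C. \<forall>s\<in>?A. \<bar>m c s\<bar> \<le> C" using mb K by blast
    from bchoice[OF this] obtain C where C: "\<And>c s. c \<in> K \<Longrightarrow> s \<in> ?A \<Longrightarrow> \<bar>m c s\<bar> \<le> C c" by blast
    have "norm (g s) \<le> (\<Sum>c\<in>K. \<bar>z c\<bar> * C c * norm c)" if "s \<in> ?A" for s
      unfolding g_def using C that
      by (intro order_trans[OF norm_sum] sum_mono) (auto simp: abs_mult intro!: mult_right_mono mult_left_mono)
    then show ?thesis by blast
  qed
  ultimately have limI: "(\<lambda>n. LINT s:?A|lborel. (norm (step_fun (es n) v s))\<^sup>2) \<longlonglongrightarrow> (LINT s:?A|lborel. (norm (g s))\<^sup>2)"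
    using T_pos step_fun_bounded[of "es _" v]
    by (intro set_integral_square_tendsto[OF _ _ _ _ _ _ lim0]) (simp_all, blast)
  have "(\<lambda>n. CLINT \<omega>|M. iexp (elem_integral W (es n) \<omega> \<bullet> v)) \<longlonglongrightarrow> (CLINT \<omega>|M. iexp (X \<omega> \<bullet> v))"
    by (rule iexp_inner_tendsto[OF X elem_integral_measurable[OF es] lim2])
  moreover have "(\<lambda>n. CLINT \<omega>|M. iexp (elem_integral W (es n) \<omega> \<bullet> v)) \<longlonglongrightarrow>
      exp (- (LINT s:?A|lborel. (norm (g s))\<^sup>2) / 2)"
    unfolding elem_integral_char[OF es] by (intro tendsto_intros limI) simp
  ultimately have "(CLINT \<omega>|M. iexp (X \<omega> \<bullet> v)) = exp (- (LINT s:?A|lborel. (norm (g s))\<^sup>2) / 2)"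
    by (rule LIMSEQ_unique)
  also have "(LINT s:?A|lborel. (norm (g s))\<^sup>2) = (LINT s:?A|lborel. (\<Sum>c\<in>K. (z c)\<^sup>2 * (m c s)\<^sup>2))"
    unfolding g_def using K by (simp add: norm_finite_sum power_mult_distrib)
  also have "\<dots> = (\<Sum>c\<in>K. (z c)\<^sup>2 * (LINT s:?A|lborel. (m c s)\<^sup>2))"
  proof -
    have "set_integrable lborel ?A (\<lambda>s. (z c)\<^sup>2 * (m c s)\<^sup>2)" if "c \<in> K" for c
    proof -
      have c: "c \<in> HH" using that K by blast
      obtain C where C: "\<And>s. s \<in> ?A \<Longrightarrow> \<bar>m c s\<bar> \<le> C" using mb[OF c] by blast
      have "(m c s)\<^sup>2 \<le> C\<^sup>2" if "s \<in> ?A" for s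
        using power_mono[OF C[OF that], of 2] by simp
      then have "set_integrable lborel ?A (\<lambda>s. (m c s)\<^sup>2)"
        unfolding set_integrable_def using T_pos m[OF c]
        by (intro integrableI_bounded_set_indicator[where B="C\<^sup>2"]) auto
      then show ?thesis by (rule set_integrable_mult_right)
    qed
    then have "(LINT s:?A|lborel. (\<Sum>c\<in>K. (z c)\<^sup>2 * (m c s)\<^sup>2)) = (\<Sum>c\<in>K. LINT s:?A|lborel. (z c)\<^sup>2 * (m c s)\<^sup>2)"
      unfolding set_lebesgue_integral_def set_integrable_def scaleR_sum_right
      by (rule Bochner_Integration.integral_sum)
    then show ?thesis by simp
  qed
  finally show ?thesis by (simp add: v_def)
qed

end

section \<open>Gaussian series\<close>

lemma std_normal_iexp: "(CLINT x|std_normal_distribution. iexp (sqrt 2 * x * y)) = exp (- y\<^sup>2)"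
proof -
  have "char std_normal_distribution (sqrt 2 * y) = exp (- y\<^sup>2)"
    unfolding char_std_normal_distribution by (simp add: power_mult_distrib)
  then show ?thesis by (simp add: char_def mult.commute mult.left_commute)
qed

text \<open>The product of the standard normal density and this exponential is \<sigma> times the
  normal density of variance \<sigma>^2 = 1 / (1 + 2 q).\<close>

lemma std_normal_exp_square:
  assumes q: "q \<ge> 0"
  shows "(LINT x|std_normal_distribution. exp (- q * x\<^sup>2)) = 1 / sqrt (1 + 2 * q)"
proof -
  define \<sigma> where "\<sigma> = 1 / sqrt (1 + 2 * q)"
  have s: "\<sigma> > 0" "\<sigma>\<^sup>2 = 1 / (1 + 2 * q)" using q by (simp_all add: \<sigma>_def power_divide)
  have "std_normal_density x * exp (- q * x\<^sup>2) = \<sigma> * normal_density 0 \<sigma> x" for x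
  proof -
    have "- (x\<^sup>2) / 2 + - q * x\<^sup>2 = - (x\<^sup>2) / (2 * \<sigma>\<^sup>2)"
      using q by (simp add: s field_simps)
    moreover have "1 / sqrt (2 * pi) = \<sigma> * (1 / sqrt (2 * pi * \<sigma>\<^sup>2))"
      using s(1) by (simp add: real_sqrt_mult)
    ultimately show ?thesis
      by (simp add: normal_density_def mult.assoc flip: exp_add)
  qed
  then have "(LINT x|std_normal_distribution. exp (- q * x\<^sup>2)) = (LINT x|lborel. \<sigma> * normal_density 0 \<sigma> x)"
    by (subst integral_density) (auto intro: AE_I2)
  also have "\<dots> = \<sigma>"
    using s(1) by (simp add: integral_normal_density)
  finally show ?thesis by (simp add: \<sigma>_def)
qed

context prob_space
begin

text \<open>
  The induction integrates out one standard normal variable per step: it converts the factor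
  exp(-(Y n)^2) into a shift of the n-th coordinate of z, which is why the characteristic factor
  is carried along.
\<close>

lemma gaussian_laplace_aux:
  fixes Y :: "nat \<Rightarrow> 'a \<Rightarrow> real"
  assumes Y [measurable]: "\<And>k. Y k \<in> borel_measurable M"
    and q: "\<And>k. q k \<ge> 0"
    and char: "\<And>z. (CLINT \<omega>|M. iexp (\<Sum>k<N. z k * Y k \<omega>)) = exp (- (\<Sum>k<N. (z k)\<^sup>2 * q k) / 2)"
    and "n \<le> N" "\<And>k. k < n \<Longrightarrow> z k = 0"
  shows "(CLINT \<omega>|M. iexp (\<Sum>k<N. z k * Y k \<omega>) * exp (- (\<Sum>k<n. (Y k \<omega>)\<^sup>2))) =
    exp (- (\<Sum>k<N. (z k)\<^sup>2 * q k) / 2) * (\<Prod>k<n. 1 / sqrt (1 + 2 * q k))"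
  using assms(4,5)
proof (induction n arbitrary: z)
  case 0
  show ?case using char[of z] by simp
next
  case (Suc n)
  let ?N = std_normal_distribution
  interpret N: prob_space ?N by (rule prob_space_normal_density) simp
  interpret P: pair_prob_space M ?N ..
  define z' where "z' = (\<lambda>\<zeta>. z(n := sqrt 2 * \<zeta>))"
  define E where "E = (\<lambda>\<omega>. exp (- (\<Sum>k<n. (Y k \<omega>)\<^sup>2)))"
  have [measurable]: "E \<in> borel_measurable M" unfolding E_def by measurable
  have E1: "\<bar>E \<omega>\<bar> \<le> 1" for \<omega> by (auto simp: E_def intro!: sum_nonneg)
  have zn: "z n = 0" using Suc.prems by simp
  have upd: "(\<Sum>k<N. z' \<zeta> k * f k) = sqrt 2 * \<zeta> * f n + (\<Sum>k<N. z k * f k)" for \<zeta> and f :: "nat \<Rightarrow> real"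
  proof -
    have "(\<Sum>k<N. z' \<zeta> k * f k) = (\<Sum>k<N. (if k = n then sqrt 2 * \<zeta> * f n else 0) + z k * f k)"
      by (intro sum.cong) (auto simp: z'_def zn)
    then show ?thesis using Suc.prems by (simp add: sum.distrib)
  qed
  have upd2: "(\<Sum>k<N. (z' \<zeta> k)\<^sup>2 * q k) = 2 * \<zeta>\<^sup>2 * q n + (\<Sum>k<N. (z k)\<^sup>2 * q k)" for \<zeta>
  proof -
    have "(\<Sum>k<N. (z' \<zeta> k)\<^sup>2 * q k) = (\<Sum>k<N. (if k = n then 2 * \<zeta>\<^sup>2 * q n else 0) + (z k)\<^sup>2 * q k)"
      by (intro sum.cong) (auto simp: z'_def zn power_mult_distrib)
    then show ?thesis using Suc.prems by (simp add: sum.distrib)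
  qed
  have "(CLINT \<omega>|M. iexp (\<Sum>k<N. z k * Y k \<omega>) * exp (- (\<Sum>k<Suc n. (Y k \<omega>)\<^sup>2))) =
      (CLINT \<omega>|M. CLINT \<zeta>|?N. iexp (\<Sum>k<N. z' \<zeta> k * Y k \<omega>) * E \<omega>)"
  proof (rule Bochner_Integration.integral_cong[OF refl])
    fix \<omega>
    have "iexp (\<Sum>k<N. z' \<zeta> k * Y k \<omega>) * E \<omega> =
        (iexp (\<Sum>k<N. z k * Y k \<omega>) * E \<omega>) * iexp (sqrt 2 * \<zeta> * Y n \<omega>)" for \<zeta>
      unfolding upd by (simp add: exp_add algebra_simps)
    then have "(CLINT \<zeta>|?N. iexp (\<Sum>k<N. z' \<zeta> k * Y k \<omega>) * E \<omega>) =
        (iexp (\<Sum>k<N. z k * Y k \<omega>) * E \<omega>) * exp (- (Y n \<omega>)\<^sup>2)"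
      by (simp only: integral_mult_right_zero std_normal_iexp)
    moreover have "exp (- (\<Sum>k<Suc n. (Y k \<omega>)\<^sup>2)) = E \<omega> * exp (- (Y n \<omega>)\<^sup>2)"
      by (simp add: E_def flip: exp_add)
    ultimately show "iexp (\<Sum>k<N. z k * Y k \<omega>) * exp (- (\<Sum>k<Suc n. (Y k \<omega>)\<^sup>2)) =
        (CLINT \<zeta>|?N. iexp (\<Sum>k<N. z' \<zeta> k * Y k \<omega>) * E \<omega>)"
      by (simp only: of_real_mult mult.assoc)
  qed
  \<comment> \<open>Fubini moves the auxiliary normal variable outside, so that the induction
    hypothesis applies for each fixed value of it. The integrand has norm at most 1.\<close>
  also have "\<dots> = (CLINT \<zeta>|?N. CLINT \<omega>|M. iexp (\<Sum>k<N. z' \<zeta> k * Y k \<omega>) * E \<omega>)"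
  proof (rule P.Fubini_integral[symmetric], rule P.integrable_const_bound[where B=1])
    show "AE x in M \<Otimes>\<^sub>M ?N. norm (case x of (\<omega>, \<zeta>) \<Rightarrow> iexp (\<Sum>k<N. z' \<zeta> k * Y k \<omega>) * E \<omega>) \<le> 1"
      using E1 by (auto simp: norm_mult)
    show "(\<lambda>(\<omega>, \<zeta>). iexp (\<Sum>k<N. z' \<zeta> k * Y k \<omega>) * complex_of_real (E \<omega>)) \<in> borel_measurable (M \<Otimes>\<^sub>M ?N)"
      unfolding upd by measurable
  qed
  also have "\<dots> = (CLINT \<zeta>|?N. exp (- (\<Sum>k<N. (z' \<zeta> k)\<^sup>2 * q k) / 2) * (\<Prod>k<n. 1 / sqrt (1 + 2 * q k)))"
  proof (rule Bochner_Integration.integral_cong[OF refl])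
    fix \<zeta>
    show "(CLINT \<omega>|M. iexp (\<Sum>k<N. z' \<zeta> k * Y k \<omega>) * E \<omega>) =
        exp (- (\<Sum>k<N. (z' \<zeta> k)\<^sup>2 * q k) / 2) * (\<Prod>k<n. 1 / sqrt (1 + 2 * q k))"
      unfolding E_def using Suc.prems by (intro Suc.IH) (auto simp: z'_def)
  qed
  \<comment> \<open>The occupied coordinate leaves behind exp(- q n \<zeta>^2), whose standard
    normal mean is the new factor of the product.\<close>
  also have "\<dots> = (CLINT \<zeta>|?N. of_real (exp (- (\<Sum>k<N. (z k)\<^sup>2 * q k) / 2) * (\<Prod>k<n. 1 / sqrt (1 + 2 * q k)) * exp (- q n * \<zeta>\<^sup>2)))"
  proof (rule Bochner_Integration.integral_cong[OF refl])
    fix \<zeta>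
    have "exp (- (\<Sum>k<N. (z' \<zeta> k)\<^sup>2 * q k) / 2) = exp (- (\<Sum>k<N. (z k)\<^sup>2 * q k) / 2) * exp (- q n * \<zeta>\<^sup>2)"
      unfolding upd2 by (simp add: field_simps flip: exp_add)
    then show "complex_of_real (exp (- (\<Sum>k<N. (z' \<zeta> k)\<^sup>2 * q k) / 2) * (\<Prod>k<n. 1 / sqrt (1 + 2 * q k))) =
      of_real (exp (- (\<Sum>k<N. (z k)\<^sup>2 * q k) / 2) * (\<Prod>k<n. 1 / sqrt (1 + 2 * q k)) * exp (- q n * \<zeta>\<^sup>2))"
      by (simp only: of_real_mult mult_ac)
  qed
  also have "\<dots> = of_real (exp (- (\<Sum>k<N. (z k)\<^sup>2 * q k) / 2) * (\<Prod>k<n. 1 / sqrt (1 + 2 * q k)) * (1 / sqrt (1 + 2 * q n)))"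
    unfolding integral_complex_of_real
    using std_normal_exp_square[OF q[of n]] by simp
  finally show ?case by simp
qed

lemma gaussian_laplace:
  fixes Y :: "nat \<Rightarrow> 'a \<Rightarrow> real"
  assumes Y: "\<And>k. Y k \<in> borel_measurable M"
    and q: "\<And>k. q k \<ge> 0"
    and char: "\<And>z. (CLINT \<omega>|M. iexp (\<Sum>k<N. z k * Y k \<omega>)) = exp (- (\<Sum>k<N. (z k)\<^sup>2 * q k) / 2)"
  shows "(LINT \<omega>|M. exp (- (\<Sum>k<N. (Y k \<omega>)\<^sup>2))) = (\<Prod>k<N. 1 / sqrt (1 + 2 * q k))"
proof -
  have "(CLINT \<omega>|M. of_real (exp (- (\<Sum>k<N. (Y k \<omega>)\<^sup>2)))) = of_real (\<Prod>k<N. 1 / sqrt (1 + 2 * q k))"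
    using gaussian_laplace_aux[OF Y q char, of N "\<lambda>_. 0"] by simp
  then show ?thesis
    unfolding integral_complex_of_real of_real_eq_iff .
qed

text \<open>After division by \<open>sqrt q\<close> the characteristic function is the standard
  normal one; Levy's uniqueness theorem then transfers the second moment together with its
  integrability.\<close>

lemma gaussian_second_moment:
  assumes Y [measurable]: "Y \<in> borel_measurable M" and q: "q > 0"
    and char: "\<And>t. (CLINT \<omega>|M. iexp (t * Y \<omega>)) = exp (- (t\<^sup>2 * q) / 2)"
  shows "integrable M (\<lambda>\<omega>. (Y \<omega>)\<^sup>2)" "(LINT \<omega>|M. (Y \<omega>)\<^sup>2) = q"
proof -
  let ?N = std_normal_distribution
  let ?Z = "\<lambda>\<omega>. Y \<omega> / sqrt q"
  have d: "real_distribution (distr M borel ?Z)"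
    by (rule real_distribution_distr) simp
  have "char (distr M borel ?Z) t = char ?N t" for t
  proof -
    have "char (distr M borel ?Z) t = (CLINT \<omega>|M. iexp (t / sqrt q * Y \<omega>))"
      unfolding char_def by (simp add: integral_distr)
    also have "\<dots> = exp (- (t\<^sup>2) / 2)"
      unfolding char using q by (simp add: power_divide)
    finally show ?thesis by (simp add: char_std_normal_distribution)
  qed
  then have eq: "distr M borel ?Z = ?N"
    using Levy_uniqueness[OF d real_dist_normal_dist] by blast
  have i: "integrable ?N (\<lambda>x. x\<^sup>2)" and v: "(LINT x|?N. x\<^sup>2) = 1"
    using std_normal_distribution_even_moments[of 1] by (simp_all add: fact_numeral power2_eq_square)
  have "integrable M (\<lambda>\<omega>. (?Z \<omega>)\<^sup>2)" and "(LINT \<omega>|M. (?Z \<omega>)\<^sup>2) = 1"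
    using i v unfolding eq[symmetric] by (simp_all add: integrable_distr_eq integral_distr)
  moreover have "(\<lambda>\<omega>. (Y \<omega>)\<^sup>2) = (\<lambda>\<omega>. q * (?Z \<omega>)\<^sup>2)"
    using q by (simp add: fun_eq_iff power_divide)
  ultimately show "integrable M (\<lambda>\<omega>. (Y \<omega>)\<^sup>2)" "(LINT \<omega>|M. (Y \<omega>)\<^sup>2) = q"
    by (simp_all only: integrable_mult_right integral_mult_right_zero mult_1_right)
qed

lemma gaussian_series_mean:
  fixes Y :: "nat \<Rightarrow> 'a \<Rightarrow> real"
  assumes Y [measurable]: "\<And>k. Y k \<in> borel_measurable M"
    and q: "\<And>k. q k > 0" and qs: "summable q"
    and char: "\<And>N z. (CLINT \<omega>|M. iexp (\<Sum>k<N. z k * Y k \<omega>)) = exp (- (\<Sum>k<N. (z k)\<^sup>2 * q k) / 2)"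
    and R: "\<And>\<omega>. (\<lambda>k. (Y k \<omega>)\<^sup>2) sums R \<omega>"
  shows "(LINT \<omega>|M. R \<omega>) = suminf q"
proof -
  have R_eq: "R \<omega> = (\<Sum>k. (Y k \<omega>)\<^sup>2)" for \<omega> using R sums_unique by blast
  have R_meas [measurable]: "R \<in> borel_measurable M"
    unfolding R_eq[abs_def] by measurable
  have R0: "R \<omega> \<ge> 0" for \<omega>
    unfolding R_eq using R by (intro suminf_nonneg) (auto simp: sums_iff)
  \<comment> \<open>A multiple of the k-th unit vector as z isolates one coordinate.\<close>
  have char1: "(CLINT \<omega>|M. iexp (t * Y k \<omega>)) = exp (- (t\<^sup>2 * q k) / 2)" for t k
  proof -
    have "(\<Sum>i<Suc k. (if i = k then t else 0) * f i) = t * f k" for f :: "nat \<Rightarrow> real"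
      by (simp add: if_distrib if_distribR cong: if_cong)
    moreover have "(\<Sum>i<Suc k. (if i = k then t else 0)\<^sup>2 * f i) = t\<^sup>2 * f k" for f :: "nat \<Rightarrow> real"
      by (simp add: if_distrib if_distribR cong: if_cong)
    moreover have "(CLINT \<omega>|M. iexp (\<Sum>i<Suc k. (if i = k then t else 0) * Y i \<omega>)) =
        exp (- (\<Sum>i<Suc k. (if i = k then t else 0)\<^sup>2 * q i) / 2)"
      by (rule char)
    ultimately show ?thesis by (simp only:)
  qed
  note m = gaussian_second_moment[OF Y q char1]
  have "(\<integral>\<^sup>+\<omega>. ennreal (R \<omega>) \<partial>M) = (\<integral>\<^sup>+\<omega>. (\<Sum>k. ennreal ((Y k \<omega>)\<^sup>2)) \<partial>M)"
    by (intro nn_integral_cong suminf_ennreal_eq[symmetric] R) simp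
  also have "\<dots> = (\<Sum>k. \<integral>\<^sup>+\<omega>. ennreal ((Y k \<omega>)\<^sup>2) \<partial>M)"
    by (rule nn_integral_suminf) simp
  also have "\<dots> = (\<Sum>k. ennreal (q k))"
    by (intro arg_cong[where f=suminf] ext) (simp add: nn_integral_eq_integral m)
  also have "\<dots> = ennreal (suminf q)"
    using q qs by (intro suminf_ennreal_eq summable_sums) (auto intro: less_imp_le)
  finally have nn: "(\<integral>\<^sup>+\<omega>. ennreal (R \<omega>) \<partial>M) = ennreal (suminf q)" .
  have "suminf q \<ge> 0" using q qs by (intro suminf_nonneg) (auto intro: less_imp_le)
  then show "(LINT \<omega>|M. R \<omega>) = suminf q"
    using nn R0 by (subst integral_eq_nn_integral) auto
qed

lemma gaussian_series_laplace:
  fixes Y :: "nat \<Rightarrow> 'a \<Rightarrow> real"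
  assumes Y [measurable]: "\<And>k. Y k \<in> borel_measurable M"
    and q: "\<And>k. q k \<ge> 0"
    and char: "\<And>N z. (CLINT \<omega>|M. iexp (\<Sum>k<N. z k * Y k \<omega>)) = exp (- (\<Sum>k<N. (z k)\<^sup>2 * q k) / 2)"
    and R: "\<And>\<omega>. (\<lambda>k. (Y k \<omega>)\<^sup>2) sums R \<omega>"
  shows "(\<lambda>N. \<Prod>k<N. 1 / sqrt (1 + 2 * q k)) \<longlonglongrightarrow> (LINT \<omega>|M. exp (- R \<omega>))"
proof -
  have R_eq: "R \<omega> = (\<Sum>k. (Y k \<omega>)\<^sup>2)" for \<omega> using R sums_unique by blast
  have R_meas [measurable]: "R \<in> borel_measurable M"
    unfolding R_eq[abs_def] by measurable
  have "(\<lambda>N. LINT \<omega>|M. exp (- (\<Sum>k<N. (Y k \<omega>)\<^sup>2))) \<longlonglongrightarrow> (LINT \<omega>|M. exp (- R \<omega>))"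
  proof (rule integral_dominated_convergence[where w="\<lambda>_. 1"])
    show "AE \<omega> in M. (\<lambda>N. exp (- (\<Sum>k<N. (Y k \<omega>)\<^sup>2))) \<longlonglongrightarrow> exp (- R \<omega>)"
      using R by (intro AE_I2 tendsto_intros) (simp add: sums_def)
    show "AE \<omega> in M. norm (exp (- (\<Sum>k<N. (Y k \<omega>)\<^sup>2))) \<le> 1" for N
      by (intro AE_I2) (simp add: sum_nonneg)
  qed simp_all
  then show "(\<lambda>N. \<Prod>k<N. 1 / sqrt (1 + 2 * q k)) \<longlonglongrightarrow> (LINT \<omega>|M. exp (- R \<omega>))"
    using gaussian_laplace[OF Y q char] by simp
qed

end

section \<open>Estimates for infinite products and sums\<close>

lemma ln_diff_lower:
  fixes x y :: real
  assumes "0 < x" "0 < y"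
  shows "(x - y) / x \<le> ln x - ln y"
  using ln_le_minus_one[of "y / x"] assms by (simp add: ln_div diff_divide_distrib)

text \<open>With D the difference of the logarithmic sums, the gap is the q-product times exp(D/2) -
  1, which is at least D/2. The exponent 3 splits: exp(-S) bounds the q-product from below by ln(1 +
  2 q) <= 2 q, and exp(-2 S) bounds the slope 1 / (1 + 2 q k) of the logarithm. As all gaps are
  nonnegative, any finite number m of them may be kept.\<close>

lemma product_gap:
  fixes p q :: "nat \<Rightarrow> real"
  assumes p: "\<And>k. 0 \<le> p k" and pq: "\<And>k. p k \<le> q k" and q: "summable q"
    and x: "(\<lambda>N. \<Prod>k<N. 1 / sqrt (1 + 2 * q k)) \<longlonglongrightarrow> x"
    and y: "(\<lambda>N. \<Prod>k<N. 1 / sqrt (1 + 2 * p k)) \<longlonglongrightarrow> y"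
  shows "exp (- 3 * suminf q) * (\<Sum>k<m. q k - p k) \<le> y - x"
proof (rule LIMSEQ_le_const[OF tendsto_diff[OF y x]], intro exI allI impI)
  fix N assume N: "m \<le> N"
  let ?S = "suminf q"
  have q0: "0 \<le> q k" for k using p[of k] pq[of k] by simp
  have sum_le: "sum q A \<le> ?S" if "finite A" for A
    using q q0 that by (intro sum_le_suminf) auto
  have S0: "0 \<le> ?S" using sum_le[of "{}"] by simp
  have prod_eq: "(\<Prod>k<N. 1 / sqrt (1 + 2 * f k)) = exp (- (\<Sum>k<N. ln (1 + 2 * f k)) / 2)"
    if "\<And>k. 0 \<le> f k" for f :: "nat \<Rightarrow> real"
  proof -
    have "1 / sqrt (1 + 2 * f k) = exp (- ln (1 + 2 * f k) / 2)" for k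
    proof -
      have pos: "1 + 2 * f k > 0" using that[of k] by simp
      then have "exp (ln (sqrt (1 + 2 * f k))) = sqrt (1 + 2 * f k)" by simp
      then have "sqrt (1 + 2 * f k) = exp (ln (1 + 2 * f k) / 2)"
        using pos by (simp add: ln_sqrt)
      show ?thesis
        unfolding \<open>sqrt (1 + 2 * f k) = _\<close> by (simp add: exp_minus inverse_eq_divide)
    qed
    then show ?thesis by (simp add: sum_negf sum_divide_distrib flip: exp_sum)
  qed
  let ?D = "\<Sum>k<N. ln (1 + 2 * q k) - ln (1 + 2 * p k)"
  have gap: "2 * exp (- 2 * ?S) * (q k - p k) \<le> ln (1 + 2 * q k) - ln (1 + 2 * p k)" for k
  proof -
    have "1 + 2 * q k \<le> 1 + 2 * ?S" using sum_le[of "{k}"] by simp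
    also have "\<dots> \<le> exp (2 * ?S)" by (rule exp_ge_add_one_self)
    finally have "exp (- 2 * ?S) \<le> 1 / (1 + 2 * q k)"
      using q0[of k] by (simp add: exp_minus field_simps)
    then have "exp (- 2 * ?S) * (2 * (q k - p k)) \<le> 1 / (1 + 2 * q k) * (2 * (q k - p k))"
      using pq[of k] by (intro mult_right_mono) auto
    also have "\<dots> = ((1 + 2 * q k) - (1 + 2 * p k)) / (1 + 2 * q k)"
      by (simp add: algebra_simps diff_divide_distrib)
    also have "\<dots> \<le> ln (1 + 2 * q k) - ln (1 + 2 * p k)"
      using p[of k] q0[of k] by (intro ln_diff_lower) auto
    finally show ?thesis by (simp only: mult_ac)
  qed
  have "exp (- 2 * ?S) * (\<Sum>k<m. q k - p k) \<le> exp (- 2 * ?S) * (\<Sum>k<N. q k - p k)"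
    using N pq by (intro mult_left_mono sum_mono2) auto
  also have "\<dots> = (\<Sum>k<N. 2 * exp (- 2 * ?S) * (q k - p k)) / 2"
    by (simp add: sum_distrib_left sum_divide_distrib)
  also have "\<dots> \<le> ?D / 2"
    using gap by (intro divide_right_mono sum_mono) auto
  also have "\<dots> \<le> exp (?D / 2) - 1"
    using exp_ge_add_one_self[of "?D / 2"] by linarith
  finally have 1: "exp (- 2 * ?S) * (\<Sum>k<m. q k - p k) \<le> exp (?D / 2) - 1" .
  have "(\<Sum>k<N. ln (1 + 2 * q k)) \<le> (\<Sum>k<N. 2 * q k)"
    using q0 by (intro sum_mono ln_add_one_self_le_self) auto
  also have "\<dots> = 2 * (\<Sum>k<N. q k)" by (simp add: sum_distrib_left)
  also have "\<dots> \<le> 2 * ?S" using sum_le[of "{..<N}"] by simp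
  finally have 2: "exp (- ?S) \<le> exp (- (\<Sum>k<N. ln (1 + 2 * q k)) / 2)" by simp
  have "exp (- 3 * ?S) * (\<Sum>k<m. q k - p k) = exp (- ?S) * (exp (- 2 * ?S) * (\<Sum>k<m. q k - p k))"
    by (simp add: mult.assoc[symmetric] flip: exp_add)
  also have "\<dots> \<le> exp (- (\<Sum>k<N. ln (1 + 2 * q k)) / 2) * (exp (?D / 2) - 1)"
    using 1 2 pq by (intro mult_mono mult_nonneg_nonneg sum_nonneg) auto
  also have "\<dots> = exp (- (\<Sum>k<N. ln (1 + 2 * p k)) / 2) - exp (- (\<Sum>k<N. ln (1 + 2 * q k)) / 2)"
    by (simp add: right_diff_distrib sum_subtractf flip: exp_add) (simp add: field_simps)
  also have "\<dots> = (\<Prod>k<N. 1 / sqrt (1 + 2 * p k)) - (\<Prod>k<N. 1 / sqrt (1 + 2 * q k))"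
    using prod_eq[OF p] prod_eq[OF q0] by simp
  finally show "exp (- 3 * ?S) * (\<Sum>k<m. q k - p k) \<le>
    (\<Prod>k<N. 1 / sqrt (1 + 2 * p k)) - (\<Prod>k<N. 1 / sqrt (1 + 2 * q k))" .
qed

text \<open>Here x is the damping of one mode per time step. The largest admissible value is the
  implicit Euler factor y = 1 / (1 + a h), with y^2 / (1 - y^2) = 1 / (a h (2 + a h)). Finally y >=
  exp(- a h) restores the factor 1 - exp(- 2 a N h) of the exact variance, so that both variances
  can be subtracted.\<close>

lemma geometric_variance_bound:
  fixes a h x :: real
  assumes a: "a > 0" and h: "h > 0" and x: "0 \<le> x" "x \<le> 1 / (1 + a * h)"
  shows "h * (\<Sum>i<N. (x ^ (N - i))\<^sup>2) \<le> (1 - exp (- 2 * a * (real N * h))) / (a * (2 + a * h))"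
proof -
  define y where "y = 1 / (1 + a * h)"
  have ah: "a * h > 0" using a h by simp
  have y: "0 < y" "y < 1" using ah by (simp_all add: y_def)
  have "(\<Sum>i<N. (x ^ (N - i))\<^sup>2) \<le> (\<Sum>i<N. (y ^ (N - i))\<^sup>2)"
    using x by (intro sum_mono power_mono) (auto simp: y_def)
  also have "\<dots> = (\<Sum>i<N. y\<^sup>2 * (y\<^sup>2) ^ (N - Suc i))"
  proof (intro sum.cong refl)
    fix i assume "i \<in> {..<N}"
    then have "N - i = Suc (N - Suc i)" by auto
    then show "(y ^ (N - i))\<^sup>2 = y\<^sup>2 * (y\<^sup>2) ^ (N - Suc i)"
      by (simp only: power_Suc power_mult_distrib power_mult[symmetric] mult.commute[of 2])
  qed
  also have "\<dots> = y\<^sup>2 * (\<Sum>i<N. (y\<^sup>2) ^ i)"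
    unfolding sum_distrib_left[symmetric] by (simp only: sum.nat_diff_reindex)
  also have "\<dots> = y\<^sup>2 * ((1 - (y\<^sup>2) ^ N) / (1 - y\<^sup>2))"
    using y by (subst sum_gp_strict) (auto simp: power2_eq_1_iff)
  finally have 1: "h * (\<Sum>i<N. (x ^ (N - i))\<^sup>2) \<le> h * (y\<^sup>2 * ((1 - (y\<^sup>2) ^ N) / (1 - y\<^sup>2)))"
    using h by (intro mult_left_mono) auto
  have "y\<^sup>2 / (1 - y\<^sup>2) = 1 / ((1 + a * h)\<^sup>2 - 1)"
    using ah by (simp add: y_def power_divide field_simps)
  also have "\<dots> = 1 / (h * (a * (2 + a * h)))"
    by (simp add: power2_eq_square algebra_simps)
  finally have y_frac: "y\<^sup>2 / (1 - y\<^sup>2) = 1 / (h * (a * (2 + a * h)))" .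
  have "h * (y\<^sup>2 * ((1 - (y\<^sup>2) ^ N) / (1 - y\<^sup>2))) = h * (1 - (y\<^sup>2) ^ N) * (y\<^sup>2 / (1 - y\<^sup>2))"
    by simp
  also have "\<dots> = (1 - (y\<^sup>2) ^ N) / (a * (2 + a * h))"
    unfolding y_frac using h by simp
  finally have 2: "h * (y\<^sup>2 * ((1 - (y\<^sup>2) ^ N) / (1 - y\<^sup>2))) = (1 - (y\<^sup>2) ^ N) / (a * (2 + a * h))" .
  have "exp (- (a * h)) \<le> y"
    using exp_ge_add_one_self[of "a * h"] ah by (simp add: y_def exp_minus field_simps)
  then have "exp (- (a * h)) ^ (2 * N) \<le> y ^ (2 * N)"
    by (intro power_mono) auto
  then have "exp (- 2 * a * (real N * h)) \<le> (y\<^sup>2) ^ N"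
    by (simp add: power_mult[symmetric] mult_ac flip: exp_of_nat_mult)
  then have "(1 - (y\<^sup>2) ^ N) / (a * (2 + a * h)) \<le> (1 - exp (- 2 * a * (real N * h))) / (a * (2 + a * h))"
    using a ah by (intro divide_right_mono) auto
  then show ?thesis using 1 2 by linarith
qed

text \<open>Of the mirrored indices k + 1 and m - k, one is at least m/2. Pairing them costs a
  factor 2, and 2^s <= 2 costs another.\<close>

lemma power_sum_lower:
  fixes s :: real
  assumes s: "0 \<le> s" "s \<le> 1"
  shows "real m powr (1 + s) / 4 \<le> (\<Sum>k<m. real (Suc k) powr s)"
proof (cases "m = 0")
  case False
  let ?f = "\<lambda>k. real (Suc k) powr s"
  have "(real m / 2) powr s \<le> ?f k + ?f (m - Suc k)" if "k < m" for k
  proof (cases "real m / 2 \<le> real (Suc k)")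
    case True
    then have "(real m / 2) powr s \<le> ?f k" using s by (intro powr_mono2) auto
    then show ?thesis using powr_ge_zero[of "real (Suc (m - Suc k))" s] by linarith
  next
    case False
    then have "real m / 2 \<le> real (Suc (m - Suc k))" using that by (simp add: of_nat_diff field_simps)
    then have "(real m / 2) powr s \<le> ?f (m - Suc k)" using s by (intro powr_mono2) auto
    then show ?thesis using powr_ge_zero[of "real (Suc k)" s] by linarith
  qed
  then have "(\<Sum>k<m. (real m / 2) powr s) \<le> (\<Sum>k<m. ?f k + ?f (m - Suc k))"
    by (intro sum_mono) auto
  also have "\<dots> = 2 * (\<Sum>k<m. ?f k)"
    using sum.nat_diff_reindex[of ?f m] by (simp only: sum.distrib mult_2)
  finally have 1: "real m * (real m / 2) powr s \<le> 2 * (\<Sum>k<m. ?f k)" by simp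
  have "2 powr s \<le> (2::real)" using powr_mono[of s 1 "2::real"] s by simp
  then have "real m powr s / 2 \<le> real m powr s / 2 powr s"
    by (intro divide_left_mono) auto
  also have "\<dots> = (real m / 2) powr s" by (simp add: powr_divide)
  finally have "real m * (real m powr s / 2) \<le> real m * (real m / 2) powr s"
    by (intro mult_left_mono) auto
  with 1 have "real m * real m powr s / 4 \<le> (\<Sum>k<m. ?f k)" by linarith
  with False show ?thesis by (simp only: powr_add) simp
qed simp

text \<open>The factor with \<open>neg_part\<close> enters through its lower bound 12. With p = 1/2
  + 2 \<delta>, the exponential pays for (12 pi^2 T)^p; of 12 = 3 * 4, the 4 covers rounding the
  cut-off down to an integer and the 3 is kept for the case \<delta> >= 0.\<close>

lemma rate_sum_lower:
  fixes \<delta> h T :: real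
  assumes \<delta>: "\<delta> < 1 / 4" and h: "0 < h" "h \<le> T"
  shows "\<exists>m. (1 - exp (- 1)) * T powr pos_part (1 / 2 + 2 * \<delta>) * h powr min (1 / 2 - 2 * \<delta>) 1 /
      (4 powr (1 + 2 * neg_part \<delta>) * (3 + 4 * neg_part \<delta>) * exp (12 * pi\<^sup>2 * T))
    \<le> h / 2 * (\<Sum>k<m. real (Suc k) powr (4 * \<delta>) / (2 + pi\<^sup>2 * (real (Suc k))\<^sup>2 * h))"
proof -
  let ?c = "1 - exp (- 1) :: real" and ?E = "exp (12 * pi\<^sup>2 * T)"
  let ?D = "4 powr (1 + 2 * neg_part \<delta>) * (3 + 4 * neg_part \<delta>)"
  let ?f = "\<lambda>k. real (Suc k) powr (4 * \<delta>) / (2 + pi\<^sup>2 * (real (Suc k))\<^sup>2 * h)"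
  let ?P = "T powr pos_part (1 / 2 + 2 * \<delta>) * h powr min (1 / 2 - 2 * \<delta>) 1"
  have T: "T > 0" using h by simp
  \<comment> \<open>The value 2/3 comes from exp 1 <= 3; the case \<delta> >= 0 relies on
    it.\<close>
  have c: "0 \<le> ?c" "?c \<le> 2 / 3" "?c \<le> 1"
    using exp_le by (simp_all add: exp_minus field_simps)
  have np: "neg_part \<delta> \<ge> 0" by (simp add: neg_part_def)
  have "4 powr 1 * 3 \<le> ?D"
    using np by (intro mult_mono powr_mono) auto
  then have D: "12 \<le> ?D" by simp
  have E: "1 + 12 * (pi\<^sup>2 * T) \<le> ?E"
    using exp_ge_add_one_self[of "12 * pi\<^sup>2 * T"] by (simp only: mult.assoc)
  have pi0: "pi\<^sup>2 > 0" by simp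
  have red: "?c * T powr pos_part (1 / 2 + 2 * \<delta>) * h powr min (1 / 2 - 2 * \<delta>) 1 / (?D * ?E) \<le> ?c * (?P / ?E) / 12"
  proof -
    have "?c * ?P / (?D * ?E) \<le> ?c * ?P / (12 * ?E)"
      using D c np by (intro divide_left_mono mult_right_mono mult_nonneg_nonneg mult_pos_pos) auto
    then show ?thesis by (simp add: mult.assoc)
  qed
  have enough: ?thesis if "?c * (?P / ?E) / 12 \<le> h / 2 * (\<Sum>k<m. ?f k)" for m
    using order_trans[OF red that] by blast
  have P0: "?P / ?E \<ge> 0" by simp
  have cP: "?c * (?P / ?E) / 12 \<le> ?P / ?E / 12"
    using mult_right_mono[OF c(3) P0] by simp
  show ?thesis
  proof (cases "\<delta> < - 1 / 4")
    case True
    \<comment> \<open>Positive part and minimum are both saturated here: T has exponent 0 and h has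
      exponent 1.\<close>
    then have "?P = h" using T h by (simp add: pos_part_def min_def max_def)
    then have "?P / ?E / 12 \<le> h / 2 * (1 / (2 + pi\<^sup>2 * h))"
    proof -
      have "pi\<^sup>2 * h \<le> pi\<^sup>2 * T" using h by simp
      moreover have "2 * (2 + u) \<le> 12 * e" if "u \<le> t" "1 + 12 * t \<le> e" "0 < t" for u t e :: real
        using that by simp
      ultimately have "2 * (2 + pi\<^sup>2 * h) \<le> 12 * ?E" using E mult_pos_pos[OF pi0 T] by blast
      moreover have "0 < 2 + pi\<^sup>2 * h" using mult_pos_pos[OF pi0 h(1)] by linarith
      ultimately have "h / (12 * ?E) \<le> h / (2 * (2 + pi\<^sup>2 * h))"
        using h by (intro divide_left_mono) auto
      then show ?thesis using \<open>?P = h\<close> by (simp add: mult.commute)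
    qed
    then show ?thesis using cP by (intro enough[of 1]) simp
  next
    case False
    define p where "p = 1 / 2 + 2 * \<delta>"
    have p: "0 \<le> p" "p < 1" using False \<delta> by (simp_all add: p_def)
    \<comment> \<open>The exponents of T and h add up to 1, so that h <= T gives \<open>?P\<close>
      at most T when h is not small.\<close>
    have P: "?P = T powr p * h powr (1 - p)"
      using p by (simp add: p_def pos_part_def min_def)
    show ?thesis
    proof (cases "1 \<le> pi\<^sup>2 * h")
      case True
      have "?P \<le> T powr p * T powr (1 - p)"
        unfolding P using h p by (intro mult_left_mono powr_mono2) auto
      also have "\<dots> = T" using T by (simp flip: powr_add)
      finally have "?P / ?E / 12 \<le> T / ?E / 12" by (intro divide_right_mono) auto
      also have "\<dots> \<le> 1 / (6 * pi\<^sup>2)"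
      proof -
        have "6 * (pi\<^sup>2 * T) \<le> 12 * ?E" using E mult_pos_pos[OF pi0 T] by linarith
        then show ?thesis by (simp add: field_simps)
      qed
      also have "\<dots> \<le> h / 2 * (1 / (2 + pi\<^sup>2 * h))"
      proof -
        have "2 + pi\<^sup>2 * h \<le> 3 * (pi\<^sup>2 * h)" using True by linarith
        moreover have "0 < 2 + pi\<^sup>2 * h" using mult_pos_pos[OF pi0 h(1)] by linarith
        ultimately have "h / 2 * (1 / (3 * (pi\<^sup>2 * h))) \<le> h / 2 * (1 / (2 + pi\<^sup>2 * h))"
          using h by (intro mult_left_mono divide_left_mono) auto
        then show ?thesis using h by simp
      qed
      finally show ?thesis using cP by (intro enough[of 1]) simp
    next
      case False
      \<comment> \<open>With y = pi sqrt h, the condition a h <= 1 on the eigenvalue pi^2 n^2 reads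
        n y <= 1, which suggests the cut-off m below. As m >= 1, also 1 / y < m + 1 <= 2 m.\<close>
      define y where "y = pi * sqrt h"
      have y0: "0 < y" using h by (simp add: y_def)
      have y2: "y\<^sup>2 = pi\<^sup>2 * h" using h by (simp add: y_def power_mult_distrib)
      have y1: "y < 1" using False y2 y0 by (smt (verit) power_le_one_iff one_le_power)
      define m where "m = nat \<lfloor>1 / y\<rfloor>"
      have m: "1 \<le> m" "real m \<le> 1 / y" "1 / y < real m + 1"
        using y0 y1 by (simp_all add: m_def le_nat_floor le_floor_iff)
      have m2: "1 / (2 * y) \<le> real m"
        using m by simp
      have den: "2 + pi\<^sup>2 * (real (Suc k))\<^sup>2 * h \<le> 3" if "k < m" for k
      proof -
        have "real (Suc k) \<le> 1 / y" using that m(2) by linarith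
        then have "real (Suc k) * y \<le> 1" using y0 by (simp add: field_simps)
        then have "(real (Suc k) * y)\<^sup>2 \<le> 1" using y0 by (intro power_le_one) auto
        then show ?thesis by (simp add: power_mult_distrib y2 mult_ac)
      qed
      have "(\<Sum>k<m. real (Suc k) powr (4 * \<delta>)) / 3 \<le> (\<Sum>k<m. ?f k)"
        unfolding sum_divide_distrib
      proof (rule sum_mono)
        fix k assume "k \<in> {..<m}"
        moreover have "0 < 2 + pi\<^sup>2 * (real (Suc k))\<^sup>2 * h"
          using h by (intro add_pos_nonneg) auto
        ultimately show "real (Suc k) powr (4 * \<delta>) / 3 \<le> ?f k"
          using den[of k] by (intro divide_left_mono) auto
      qed
      then have LHS: "h / 6 * (\<Sum>k<m. real (Suc k) powr (4 * \<delta>)) \<le> h / 2 * (\<Sum>k<m. ?f k)"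
        using h mult_left_mono[of "(\<Sum>k<m. real (Suc k) powr (4 * \<delta>)) / 3" "\<Sum>k<m. ?f k" "h / 2"] by simp
      have "(4 * pi\<^sup>2 * h) powr (- p) = (1 / (2 * y)) powr (2 * p)"
      proof -
        have "4 * pi\<^sup>2 * h = (2 * y) powr 2" using y0 y2 by (simp add: power_mult_distrib)
        then have "(4 * pi\<^sup>2 * h) powr (- p) = (2 * y) powr (2 * - p)" by (simp only: powr_powr)
        also have "\<dots> = 1 / (2 * y) powr (2 * p)" by (simp add: powr_minus_divide)
        also have "\<dots> = (1 / (2 * y)) powr (2 * p)" by (simp only: powr_divide powr_one_eq_one)
        finally show ?thesis .
      qed
      also have "\<dots> \<le> real m powr (2 * p)"
        using m2 y0 p by (intro powr_mono2) auto
      finally have mp: "(4 * pi\<^sup>2) powr (- p) * h powr (- p) \<le> real m powr (1 + 4 * \<delta>)"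
        by (simp add: powr_mult p_def)
      have hp: "h * h powr (- p) = h powr (1 - p)"
        using h powr_add[of h 1 "- p"] by simp
      have "(12 * pi\<^sup>2 * T) powr p \<le> ?E"
        using powr_le_one_plus[of "12 * pi\<^sup>2 * T" p] p T E by auto
      then have "(12 * pi\<^sup>2) powr p * T powr p \<le> ?E"
        by (simp add: powr_mult)
      then have "T powr p / ?E \<le> (12 * pi\<^sup>2) powr (- p)"
        by (simp add: powr_minus field_simps)
      also have "\<dots> = 3 powr (- p) * (4 * pi\<^sup>2) powr (- p)"
        by (simp flip: powr_mult)
      finally have "T powr p / ?E * h powr (1 - p) \<le> 3 powr (- p) * (4 * pi\<^sup>2) powr (- p) * h powr (1 - p)"
        by (intro mult_right_mono) auto
      then have PE: "?P / ?E \<le> 3 powr (- p) * ((4 * pi\<^sup>2) powr (- p) * h powr (1 - p))"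
        unfolding P by (simp add: mult_ac)
      have H: "(4 * pi\<^sup>2) powr (- p) * h powr (1 - p) \<le> h * real m powr (1 + 4 * \<delta>)"
        using mult_left_mono[OF mp, of h] h by (simp add: hp[symmetric] mult_ac)
      show ?thesis
      proof (cases "\<delta> \<ge> 0")
        case False
        \<comment> \<open>For a negative exponent the last term of the sum is the smallest.\<close>
        have "real m powr (1 + 4 * \<delta>) = (\<Sum>k<m. real m powr (4 * \<delta>))"
          using m by (simp add: powr_add)
        also have "\<dots> \<le> (\<Sum>k<m. real (Suc k) powr (4 * \<delta>))"
          using False by (intro sum_mono powr_mono2') auto
        finally have "h / 6 * real m powr (1 + 4 * \<delta>) \<le> h / 2 * (\<Sum>k<m. ?f k)"
          using LHS mult_left_mono[of "real m powr (1 + 4 * \<delta>)" _ "h / 6"] h by (smt (verit) divide_nonneg_nonneg)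
        moreover have "3 powr (- p) \<le> (1::real)" using p powr_mono[of "- p" 0 "3::real"] by simp
        then have "?P / ?E \<le> 1 * ((4 * pi\<^sup>2) powr (- p) * h powr (1 - p))"
          by (intro order_trans[OF PE] mult_right_mono) auto
        ultimately have "?P / ?E \<le> h * real m powr (1 + 4 * \<delta>)" and
          low: "h / 6 * real m powr (1 + 4 * \<delta>) \<le> h / 2 * (\<Sum>k<m. ?f k)"
          using H by (simp_all only: mult_1 order_trans[OF _ H])
        moreover have "x / 12 \<le> h / 6 * M" if "0 \<le> x" "x \<le> h * M" for x M :: real
          using that by simp
        ultimately have "?P / ?E / 12 \<le> h / 6 * real m powr (1 + 4 * \<delta>)"
          using P0 by blast
        then show ?thesis
          by (intro enough[of m] order_trans[OF cP] order_trans[OF _ low])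
      next
        case True
        have "real m powr (1 + 4 * \<delta>) / 4 \<le> (\<Sum>k<m. real (Suc k) powr (4 * \<delta>))"
          using True \<delta> by (intro power_sum_lower) auto
        then have low: "h / 6 * (real m powr (1 + 4 * \<delta>) / 4) \<le> h / 2 * (\<Sum>k<m. ?f k)"
          using LHS mult_left_mono[of "real m powr (1 + 4 * \<delta>) / 4" _ "h / 6"] h by (smt (verit) divide_nonneg_nonneg)
        \<comment> \<open>Here p >= 1/2, so the reserved 3^(-p) is at most 3/4. Together with the
          bound 2/3 for \<open>?c\<close> this fits exactly: 3/4 * 2/3 / 12 = 1/6 * 1/4, the last
          factor being the loss in \<open>power_sum_lower\<close>.\<close>
        have "(4 / 3 :: real) \<le> sqrt 3" by (rule real_le_rsqrt) (simp add: power2_eq_square)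
        also have "\<dots> = 3 powr (1 / 2)" by (simp add: powr_half_sqrt)
        also have "\<dots> \<le> 3 powr p" using True by (intro powr_mono) (auto simp: p_def)
        finally have "3 powr (- p) \<le> (3 / 4 :: real)" by (simp add: powr_minus field_simps)
        then have "?P / ?E \<le> 3 / 4 * ((4 * pi\<^sup>2) powr (- p) * h powr (1 - p))"
          by (intro order_trans[OF PE] mult_right_mono) auto
        also have "\<dots> \<le> 3 / 4 * (h * real m powr (1 + 4 * \<delta>))"
          using H by (intro mult_left_mono) auto
        finally have "?P / ?E \<le> 3 / 4 * (h * real m powr (1 + 4 * \<delta>))" .
        moreover have "?c * (?P / ?E) \<le> 2 / 3 * (?P / ?E)"
          using c P0 by (intro mult_right_mono) auto
        moreover have "z / 12 \<le> h / 6 * (M / 4)" if "x \<le> 3 / 4 * (h * M)" "z \<le> 2 / 3 * x" for x z M :: real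
          using that by simp
        ultimately have "?c * (?P / ?E) / 12 \<le> h / 6 * (real m powr (1 + 4 * \<delta>) / 4)"
          by blast
        then show ?thesis
          by (intro enough[of m] order_trans[OF _ low])
      qed
    qed
  qed
qed

section \<open>Coordinates of the stochastic integrals\<close>

lemma set_integral_exp_square:
  fixes l T :: real
  assumes T: "T > 0" and l: "l \<noteq> 0"
  shows "(LINT s:{0<..T}|lborel. (c * exp ((T - s) * l))\<^sup>2) = c\<^sup>2 * (exp (2 * T * l) - 1) / (2 * l)"
proof -
  have "(LINT s:{0<..T}|lborel. (c * exp ((T - s) * l))\<^sup>2) = (LINT s|lborel. (c * exp ((T - s) * l))\<^sup>2 * indicator {0..T} s)"
    unfolding set_lebesgue_integral_def
  proof (rule integral_cong_AE)
    show "AE s in lborel. indicator {0<..T} s *\<^sub>R (c * exp ((T - s) * l))\<^sup>2 = (c * exp ((T - s) * l))\<^sup>2 * indicator {0..T} s"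
      using AE_lborel_singleton[of 0] by eventually_elim (auto simp: indicator_def)
  qed simp_all
  also have "\<dots> = - c\<^sup>2 / (2 * l) * exp (2 * (T - T) * l) - (- c\<^sup>2 / (2 * l) * exp (2 * (T - 0) * l))"
  proof (rule integral_FTC_Icc_real)
    fix s
    have "((\<lambda>s. - c\<^sup>2 / (2 * l) * exp (2 * (T - s) * l)) has_real_derivative c\<^sup>2 * exp (2 * (T - s) * l)) (at s)"
      using l by (auto intro!: derivative_eq_intros simp: field_simps)
    moreover have "(c * exp ((T - s) * l))\<^sup>2 = c\<^sup>2 * exp (2 * (T - s) * l)"
      by (simp add: power_mult_distrib mult.assoc flip: exp_double)
    ultimately show "((\<lambda>s. - c\<^sup>2 / (2 * l) * exp (2 * (T - s) * l)) has_real_derivative (c * exp ((T - s) * l))\<^sup>2) (at s)"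
      by simp
  qed (use T in auto)
  also have "\<dots> = c\<^sup>2 * (exp (2 * T * l) - 1) / (2 * l)"
    using l by (simp add: field_simps)
  finally show ?thesis .
qed

section \<open>Integrals of functions that are constant on the cells of the time grid\<close>

lemma nat_floor_grid:
  fixes h s :: real
  assumes h: "h > 0" and s: "0 \<le> s"
  shows "nat \<lfloor>s / h\<rfloor> = i \<longleftrightarrow> s \<in> {real i * h..<real (Suc i) * h}"
proof -
  have "nat \<lfloor>s / h\<rfloor> = i \<longleftrightarrow> \<lfloor>s / h\<rfloor> = int i"
    using h s by (simp add: nat_eq_iff)
  also have "\<dots> \<longleftrightarrow> real i \<le> s / h \<and> s / h < real i + 1"
    by (simp add: floor_eq_iff)
  finally show ?thesis using h by (auto simp: field_simps)
qed

lemma set_integral_grid: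
  fixes G :: "nat \<Rightarrow> real"
  assumes h: "h > 0"
  shows "(LINT s:{0<..real N * h}|lborel. G (nat \<lfloor>s / h\<rfloor>)) = h * (\<Sum>i<N. G i)"
proof -
  let ?I = "\<lambda>i. {real i * h..<real (Suc i) * h}"
  have "(LINT s:{0<..real N * h}|lborel. G (nat \<lfloor>s / h\<rfloor>)) = (LINT s|lborel. (\<Sum>i<N. G i * indicator (?I i) s))"
    unfolding set_lebesgue_integral_def
  proof (rule integral_cong_AE)
    \<comment> \<open>The domain is open on the left and closed on the right, the cells are the
      other way round; they disagree only at the two end points.\<close>
    have "AE s in lborel. s \<noteq> real N * h" by (rule AE_lborel_singleton)
    moreover have "AE s in lborel. s \<noteq> 0" by (rule AE_lborel_singleton)
    ultimately show "AE s in lborel. indicator {0<..real N * h} s *\<^sub>R G (nat \<lfloor>s / h\<rfloor>) = (\<Sum>i<N. G i * indicator (?I i) s)"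
    proof eventually_elim
      case (elim s)
      show ?case
      proof (cases "0 < s")
        case True
        have "G i * indicator (?I i) s = (if i = nat \<lfloor>s / h\<rfloor> then G i else 0)" for i
          using True nat_floor_grid[OF h, of s i] by (simp only: indicator_def less_imp_le) auto
        then have "(\<Sum>i<N. G i * indicator (?I i) s) = (\<Sum>i<N. if i = nat \<lfloor>s / h\<rfloor> then G i else 0)"
          by simp
        also have "\<dots> = (if nat \<lfloor>s / h\<rfloor> < N then G (nat \<lfloor>s / h\<rfloor>) else 0)"
          by simp
        also have "nat \<lfloor>s / h\<rfloor> < N \<longleftrightarrow> s / h < real N"
          using True h by (simp add: nat_less_iff floor_less_iff)
        also have "\<dots> \<longleftrightarrow> s \<le> real N * h"
          using elim h by (auto simp: pos_divide_less_eq)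
        finally show ?thesis using True by (simp add: indicator_def)
      next
        case False
        have "0 \<le> real i * h" for i using h by simp
        then have "s \<notin> ?I i" for i using False elim by (smt (verit) atLeastLessThan_iff)
        then show ?thesis using False by simp
      qed
    qed
    show "(\<lambda>s. \<Sum>i<N. G i * indicator (?I i) s) \<in> borel_measurable lborel"
      by (intro borel_measurable_sum borel_measurable_times borel_measurable_const borel_measurable_indicator) simp
  qed simp
  also have "\<dots> = (\<Sum>i<N. G i * h)"
  proof -
    have i: "integrable lborel (\<lambda>s. G i * indicator (?I i) s)" for i
      by (intro integrable_mult_right integrable_real_indicator) (use h in \<open>auto simp: algebra_simps\<close>)
    have meas: "measure lborel (?I i) = h" for i
      using h by (simp add: algebra_simps)
    have "(LINT s|lborel. G i * indicator (?I i) s) = G i * h" for i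
      by (simp only: integral_mult_right_zero Bochner_Integration.integral_indicator space_lborel space_borel Int_UNIV_right meas)
    then show ?thesis
      by (simp only: Bochner_Integration.integral_sum[OF i])
  qed
  finally show ?thesis by (simp add: sum_distrib_left mult.commute)
qed

lemma (in onb) scaled_basis_dom: "c \<in> HH \<Longrightarrow> a *\<^sub>R c \<in> diag_dom HH g"
  using diag_dom_linear[OF diag_dom_basis[of c g] diag_dom_basis[of c g], of "a - 1"] by (simp add: algebra_simps)

lemma (in onb) diag_op_scaled_basis: "c \<in> HH \<Longrightarrow> diag_op HH g (a *\<^sub>R c) = (a * g c) *\<^sub>R c"
  by (rule eqI) (auto simp: inner_diag_op[OF scaled_basis_dom] inner_basis)

section \<open>The three integrands on basis vectors\<close>

context hilbert_scale
begin

lemma exact_integrand_basis: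
  assumes B: "B \<in> hilbert_schmidt HH (Hr (- \<beta>)) (nr (- \<beta>))"
    and B_diag: "\<And>v. has_sum_wrt (nr (- \<beta>)) (\<lambda>c. (mu c * (c \<bullet> v)) *\<^sub>R j c) HH (B v)"
    and \<beta>: "0 \<le> \<beta>" "\<beta> \<le> 1" and s: "s < T" and c: "c \<in> HH"
  shows "exact_integrand HH lam j (nr (- \<beta>)) B T s c = (mu c * exp ((T - s) * lam c)) *\<^sub>R c"
  unfolding exact_integrand_def diag_on_basis[OF B B_diag c]
  using \<beta> s c by (simp add: cont_extension_exp diag_op_scaled_basis)

text \<open>As s < T, the cell index of s is below N. So at least one full step remains, which is a
  positive time for the extension. The power of the one-step factor is the form shared with the
  implicit scheme.\<close>

lemma exp_euler_integrand_basis: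
  assumes B: "B \<in> hilbert_schmidt HH (Hr (- \<beta>)) (nr (- \<beta>))"
    and B_diag: "\<And>v. has_sum_wrt (nr (- \<beta>)) (\<lambda>c. (mu c * (c \<bullet> v)) *\<^sub>R j c) HH (B v)"
    and \<beta>: "0 \<le> \<beta>" "\<beta> \<le> 1" and h: "h > 0" and s: "0 \<le> s" "s < real N * h" and c: "c \<in> HH"
  shows "exp_euler_integrand HH lam j (nr (- \<beta>)) B h (real N * h) s c =
    (mu c * exp (h * lam c) ^ (N - nat \<lfloor>s / h\<rfloor>)) *\<^sub>R c"
proof -
  define i where "i = nat \<lfloor>s / h\<rfloor>"
  have "s \<in> {real i * h..<real (Suc i) * h}"
    using nat_floor_grid[OF h s(1)] i_def by blast
  then have "real i * h < real N * h" using s(2) by simp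
  then have iN: "i < N" using h by simp
  have "of_int \<lfloor>s / h\<rfloor> = real i" using h s(1) by (simp add: i_def)
  then have t: "real N * h - grid_floor h s = real (N - i) * h"
    using iN by (simp add: grid_floor_eq[OF h] of_nat_diff left_diff_distrib)
  moreover have "exp (real (N - i) * h * lam c) = exp (h * lam c) ^ (N - i)"
    by (simp add: mult.assoc exp_of_nat_mult)
  ultimately show ?thesis
    unfolding exp_euler_integrand_def diag_on_basis[OF B B_diag c] i_def[symmetric]
    using \<beta> c h iN by (simp add: cont_extension_exp diag_op_scaled_basis)
qed

lemma impl_euler_integrand_basis:
  assumes B: "B \<in> hilbert_schmidt HH (Hr (- \<beta>)) (nr (- \<beta>))"
    and B_diag: "\<And>v. has_sum_wrt (nr (- \<beta>)) (\<lambda>c. (mu c * (c \<bullet> v)) *\<^sub>R j c) HH (B v)"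
    and \<beta>: "0 \<le> \<beta>" "\<beta> \<le> 1" and h: "h > 0" and s: "0 \<le> s" "s < real N * h" and c: "c \<in> HH"
  shows "impl_euler_integrand HH lam j (nr (- \<beta>)) B h (real N * h) s c =
    (mu c * (1 / (1 - h * lam c)) ^ (N - nat \<lfloor>s / h\<rfloor>)) *\<^sub>R c"
proof -
  define i where "i = nat \<lfloor>s / h\<rfloor>"
  have "s \<in> {real i * h..<real (Suc i) * h}"
    using nat_floor_grid[OF h s(1)] i_def by blast
  then have "real i * h < real N * h" using s(2) by simp
  then have iN: "i < N" using h by simp
  have "of_int \<lfloor>s / h\<rfloor> = real i" using h s(1) by (simp add: i_def)
  then have "(real N * h - grid_floor h s) / h = real (N - i)"
    using iN h by (simp add: grid_floor_eq[OF h] of_nat_diff field_simps)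
  then have "nat \<lfloor>(real N * h - grid_floor h s) / h\<rfloor> = N - i" by simp
  then show ?thesis
    unfolding impl_euler_integrand_def diag_on_basis[OF B B_diag c] i_def[symmetric]
    using \<beta> c h iN by (simp add: cont_extension_resolvent diag_op_scaled_basis)
qed

end

context wiener_onb
begin

text \<open>The number q k is the variance of the k-th coordinate. Parseval makes the squared norm
  the series of squared coordinates at every sample point, so the results on Gaussian series
  apply.\<close>

lemma stochastic_integral_norm:
  fixes e :: "nat \<Rightarrow> 'a" and m :: "'a \<Rightarrow> real \<Rightarrow> real"
  defines "q \<equiv> \<lambda>k. LINT s:{0<..T}|lborel. (m (e k) s)\<^sup>2"
  assumes SI: "has_stochastic_integral HH M W T \<Phi> X"
    and \<Phi>: "\<And>s c. 0 \<le> s \<Longrightarrow> s < T \<Longrightarrow> c \<in> HH \<Longrightarrow> \<Phi> s c = m c s *\<^sub>R c"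
    and m: "\<And>c. c \<in> HH \<Longrightarrow> m c \<in> borel_measurable borel"
    and mb: "\<And>c. c \<in> HH \<Longrightarrow> \<exists>C. \<forall>s\<in>{0<..T}. \<bar>m c s\<bar> \<le> C"
    and e: "bij_betw e UNIV HH"
  shows "(\<lambda>N. \<Prod>k<N. 1 / sqrt (1 + 2 * q k)) \<longlonglongrightarrow> (LINT \<omega>|M. exp (- (norm (X \<omega>))\<^sup>2))"
    and "(\<And>k. q k > 0) \<Longrightarrow> summable q \<Longrightarrow> (LINT \<omega>|M. (norm (X \<omega>))\<^sup>2) = suminf q"
proof -
  have X [measurable]: "X \<in> borel_measurable M"
    using SI by (simp add: has_stochastic_integral_def)
  have q0: "q k \<ge> 0" for k
    unfolding q_def set_lebesgue_integral_def by (intro integral_nonneg_AE) auto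
  have Y: "(\<lambda>\<omega>. X \<omega> \<bullet> e k) \<in> borel_measurable M" for k by simp
  have inj: "inj_on e A" for A
    using e by (meson bij_betw_imp_inj_on inj_on_subset subset_UNIV)
  have char: "(CLINT \<omega>|M. iexp (\<Sum>k<N. z k * (X \<omega> \<bullet> e k))) = exp (- (\<Sum>k<N. (z k)\<^sup>2 * q k) / 2)" for N z
  proof -
    define z' where "z' = z \<circ> the_inv e"
    have z': "z' (e k) = z k" for k
      using inj[of UNIV] by (simp add: z'_def the_inv_f_f)
    have "e ` {..<N} \<subseteq> HH" using e by (auto simp: bij_betw_def)
    then have "(CLINT \<omega>|M. iexp (X \<omega> \<bullet> (\<Sum>c\<in>e ` {..<N}. z' c *\<^sub>R c))) =
        exp (- (\<Sum>c\<in>e ` {..<N}. (z' c)\<^sup>2 * (LINT s:{0<..T}|lborel. (m c s)\<^sup>2)) / 2)"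
      by (intro stochastic_integral_char[OF SI \<Phi> m mb]) auto
    then show ?thesis
      by (simp add: sum.reindex[OF inj] z' inner_sum_right q_def)
  qed
  have R: "(\<lambda>k. (X \<omega> \<bullet> e k)\<^sup>2) sums (norm (X \<omega>))\<^sup>2" for \<omega>
  proof -
    have "((\<lambda>k. (e k \<bullet> X \<omega>)\<^sup>2) has_sum (norm (X \<omega>))\<^sup>2) UNIV"
      using parseval[of "X \<omega>"] has_sum_reindex_bij_betw[OF e, of "\<lambda>c. (c \<bullet> X \<omega>)\<^sup>2"] by simp
    then show ?thesis using has_sum_imp_sums by (simp add: inner_commute)
  qed
  show "(\<lambda>N. \<Prod>k<N. 1 / sqrt (1 + 2 * q k)) \<longlonglongrightarrow> (LINT \<omega>|M. exp (- (norm (X \<omega>))\<^sup>2))"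
    by (rule gaussian_series_laplace[OF Y q0 char R])
  show "(\<And>k. q k > 0) \<Longrightarrow> summable q \<Longrightarrow> (LINT \<omega>|M. (norm (X \<omega>))\<^sup>2) = suminf q"
    by (rule gaussian_series_mean[OF Y _ _ char R])
qed

end

theorem corollary9p8:
  fixes HH :: "'a::{real_inner,banach,second_countable_topology} set"
    and lam mu :: "'a \<Rightarrow> real"
    and h T \<beta> :: real
    and j :: "'a \<Rightarrow> 'v::real_vector"
    and Hr :: "real \<Rightarrow> 'v set"
    and nr :: "real \<Rightarrow> 'v \<Rightarrow> real"
    and M :: "'w measure"
    and F :: "real \<Rightarrow> 'w measure"
    and W :: "real \<Rightarrow> 'a \<Rightarrow> 'w \<Rightarrow> real"
    and B :: "'a \<Rightarrow> 'v"
    and X :: "'w \<Rightarrow> 'a"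
    and Y :: "nat \<Rightarrow> 'w \<Rightarrow> 'a"
    and b :: "nat \<Rightarrow> 'a"
    and \<delta> :: real
    and i :: nat
    and \<phi> :: "'a \<Rightarrow> real"
  assumes nontrivial: "(UNIV :: 'a set) \<noteq> {0}"
    and basis: "orthonormal_basis HH"
    and h: "h > 0"
    and T: "\<exists>k::nat. k \<ge> 1 \<and> T = real k * h"
    and beta: "0 \<le> \<beta>" "\<beta> < 1 / 2"
    and lam_neg: "bdd_above (lam ` HH)" "(SUP c\<in>HH. lam c) < 0"
    and mu_lam: "(\<lambda>c. \<bar>mu c\<bar>\<^sup>2 * \<bar>lam c\<bar> powr (- 2 * \<beta>)) summable_on HH"
    and interp: "interpolation_spaces HH lam j Hr nr"
    and stoch_basis: "stochastic_basis M F T"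
    and wiener: "cylindrical_wiener_process M F T W"
    and B_HS: "B \<in> hilbert_schmidt HH (Hr (- \<beta>)) (nr (- \<beta>))"
    and B_diag: "\<And>v. has_sum_wrt (nr (- \<beta>)) (\<lambda>c. (mu c * (c \<bullet> v)) *\<^sub>R j c) HH (B v)"
    and X: "has_stochastic_integral HH M W T
              (exact_integrand HH lam j (nr (- \<beta>)) B T) X"
    and Y1: "has_stochastic_integral HH M W T
              (exp_euler_integrand HH lam j (nr (- \<beta>)) B h T) (Y 1)"
    and Y2: "has_stochastic_integral HH M W T
              (impl_euler_integrand HH lam j (nr (- \<beta>)) B h T) (Y 2)"
    and b: "bij_betw b {1..} HH"
    and i: "i \<in> {1, 2}"
    and lam_b: "\<And>n. n \<ge> 1 \<Longrightarrow> lam (b n) = - (pi\<^sup>2 * (real n)\<^sup>2)"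
    and mu_b: "\<And>n. n \<ge> 1 \<Longrightarrow> mu (b n) = \<bar>lam (b n)\<bar> powr \<delta>"
    and phi: "\<And>v. \<phi> v = exp (- (norm v)\<^sup>2)"
  shows "\<phi> \<in> C5b \<and>
    B \<in> (\<Inter>r\<in>{..< - \<delta> - 1 / 4}. hilbert_schmidt HH (Hr r) (nr r)) \<and>
    (let K = ((1 - exp (- T)) * (1 - exp (- 1)) * T powr pos_part (1 / 2 + 2 * \<delta>)
                * pi powr (4 * \<delta>)) /
             (4 powr (1 + 2 * neg_part \<delta>) * (3 + 4 * neg_part \<delta>)
                * exp (12 * pi\<^sup>2 * T + 6 * (LINT \<omega>|M. (norm (X \<omega>))\<^sup>2)))
     in (LINT \<omega>|M. \<phi> (Y i \<omega>)) - (LINT \<omega>|M. \<phi> (X \<omega>))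
          \<ge> K * h powr min (1 / 2 - 2 * \<delta>) 1 \<and>
        K * h powr min (1 / 2 - 2 * \<delta>) 1 > 0)"
proof -
  \<comment> \<open>The smallest eigenvalue of -A is pi^2, attained at n = 1.\<close>
  interpret hilbert_scale HH lam j Hr nr "pi\<^sup>2"
  proof
    show "orthonormal_basis HH" "interpolation_spaces HH lam j Hr nr" by fact+
    fix c assume "c \<in> HH"
    then obtain n where n: "n \<ge> 1" "c = b n" using b by (auto simp: bij_betw_def)
    then have "1 \<le> (real n)\<^sup>2" by simp
    then have "pi\<^sup>2 * 1 \<le> pi\<^sup>2 * (real n)\<^sup>2" by (intro mult_left_mono) auto
    then show "lam c \<le> - pi\<^sup>2" using n by (simp add: lam_b)
  qed simp
  obtain N where N: "N \<ge> 1" "T = real N * h" using T by blast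
  have T_pos: "T > 0" and hT: "h \<le> T" using N h by simp_all
  interpret wiener_onb M F T W HH
    by unfold_locales (fact stoch_basis wiener T_pos)+

  \<comment> \<open>The enumeration b starts at 1, whereas series and products are indexed from
    0.\<close>
  define e where "e = (\<lambda>k. b (Suc k))"
  define a where "a = (\<lambda>k. pi\<^sup>2 * (real (Suc k))\<^sup>2)"
  have "bij_betw Suc UNIV {1..}"
    by (auto simp: bij_betw_def inj_def image_iff intro: Suc_pred[symmetric]) (metis Suc_le_D)
  from bij_betw_trans[OF this b] have e: "bij_betw e UNIV HH"
    by (simp only: e_def comp_def)
  then have e_mem: "e k \<in> HH" for k by (auto simp: bij_betw_def)
  have a_pos: "a k > 0" for k by (simp add: a_def)
  have lam_e: "lam (e k) = - a k" and mu_e: "mu (e k) = a k powr \<delta>" for k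
    using lam_b[of "Suc k"] mu_b[of "Suc k"] by (simp_all add: e_def a_def)
  have a_powr: "a k powr x = pi powr (2 * x) * real (Suc k) powr (2 * x)" for k x
  proof -
    have "a k = (pi * real (Suc k)) powr 2" by (simp add: a_def power_mult_distrib)
    then have "a k powr x = (pi * real (Suc k)) powr (2 * x)" by (simp only: powr_powr)
    then show ?thesis by (simp only: powr_mult)
  qed
  have summable_a: "summable (\<lambda>k. a k powr x) \<longleftrightarrow> 2 * x < - 1" for x
  proof -
    have "summable (\<lambda>k. a k powr x) \<longleftrightarrow> summable (\<lambda>k. real (Suc k) powr (2 * x))"
      unfolding a_powr by (subst summable_cmult_iff) simp
    also have "\<dots> \<longleftrightarrow> summable (\<lambda>k. real k powr (2 * x))"
      by (rule summable_Suc_iff)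
    finally show ?thesis by (simp add: summable_real_powr_iff)
  qed
  have mu_sq: "(mu (e k) * (- lam (e k)) powr r)\<^sup>2 = a k powr (2 * (\<delta> + r))" for k r
    unfolding mu_e lam_e by (simp add: power2_eq_square algebra_simps flip: powr_add)
  have "(\<lambda>k. \<bar>mu (e k)\<bar>\<^sup>2 * \<bar>lam (e k)\<bar> powr (- 2 * \<beta>)) summable_on UNIV"
    using mu_lam by (subst summable_on_reindex_bij_betw[OF e])
  moreover have "\<bar>mu (e k)\<bar>\<^sup>2 * \<bar>lam (e k)\<bar> powr (- 2 * \<beta>) = a k powr (2 * (\<delta> - \<beta>))" for k
    unfolding mu_e lam_e using a_pos[of k] by (simp add: power2_eq_square algebra_simps flip: powr_add)
  ultimately have "summable (\<lambda>k. a k powr (2 * (\<delta> - \<beta>)))"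
    using summable_on_UNIV_nonneg_real_iff[of "\<lambda>k. a k powr (2 * (\<delta> - \<beta>))"] by simp
  \<comment> \<open>The summability says 4 (\<delta> - \<beta>) < -1, so \<delta> < \<beta> - 1/4 <
    1/4.\<close>
  then have \<delta>: "\<delta> < 1 / 4" using beta by (simp add: summable_a)

  have part1: "\<phi> \<in> C5b"
  proof -
    have "\<phi> = gauss 1" by (simp add: fun_eq_iff phi gauss_def)
    then show ?thesis using gauss_in_C5b[of 1] by simp
  qed

  have part2: "B \<in> hilbert_schmidt HH (Hr r) (nr r)" if "r < - \<delta> - 1 / 4" for r
  proof (rule hilbert_schmidt_diag[OF B_HS B_diag])
    \<comment> \<open>The bound on r is precisely the threshold 4 (\<delta> + r) < -1.\<close>
    have "summable (\<lambda>k. a k powr (2 * (\<delta> + r)))" using that by (simp add: summable_a)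
    then have "(\<lambda>k. (mu (e k) * (- lam (e k)) powr r)\<^sup>2) summable_on UNIV"
      unfolding mu_sq by (subst summable_on_UNIV_nonneg_real_iff) auto
    then show "(\<lambda>c. (mu c * (- lam c) powr r)\<^sup>2) summable_on HH"
      by (subst (asm) summable_on_reindex_bij_betw[OF e])
  qed

  define qX where "qX = (\<lambda>k. LINT s:{0<..T}|lborel. (mu (e k) * exp ((T - s) * lam (e k)))\<^sup>2)"
  have qX: "qX k = a k powr (2 * \<delta>) * (1 - exp (- 2 * a k * T)) / (2 * a k)" for k
  proof -
    have "(mu (e k))\<^sup>2 = a k powr (2 * \<delta>)"
      using mu_sq[of k 0] a_pos[of k] by (simp add: lam_e)
    then show ?thesis
      unfolding qX_def using a_pos[of k]
      by (subst set_integral_exp_square[OF T_pos]) (auto simp: lam_e field_simps)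
  qed
  have exp_lt: "exp (- 2 * a k * T) < 1" for k using a_pos[of k] T_pos by simp
  have qX_pos: "qX k > 0" for k
    unfolding qX using a_pos[of k] exp_lt[of k] by (intro divide_pos_pos mult_pos_pos) auto
  have qX_summable: "summable qX"
  proof (rule summable_comparison_test')
    \<comment> \<open>The exponent of k is 4 \<delta> - 2, which is below -1 since \<delta> <
      1/4.\<close>
    show "summable (\<lambda>k. a k powr (2 * \<delta> - 1))" using \<delta> by (simp add: summable_a)
    fix k
    have "a k powr (2 * \<delta>) * (1 - exp (- 2 * a k * T)) / (2 * a k) \<le> a k powr (2 * \<delta>) * 2 / (2 * a k)"
      using a_pos[of k] by (intro divide_right_mono mult_left_mono) (auto intro: order_trans[OF _ exp_ge_zero])
    also have "\<dots> = a k powr (2 * \<delta> - 1)"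
      using a_pos[of k] by (simp add: powr_diff)
    finally show "norm (qX k) \<le> a k powr (2 * \<delta> - 1)"
      using qX_pos[of k] by (simp add: qX)
  qed
  have X_ex: "exact_integrand HH lam j (nr (- \<beta>)) B T s c = (mu c * exp ((T - s) * lam c)) *\<^sub>R c"
    if "0 \<le> s" "s < T" "c \<in> HH" for s c
    using that beta by (intro exact_integrand_basis[OF B_HS B_diag]) auto
  have X_bd: "\<exists>C. \<forall>s\<in>{0<..T}. \<bar>mu c * exp ((T - s) * lam c)\<bar> \<le> C" if "c \<in> HH" for c
  proof (intro exI ballI)
    fix s assume "s \<in> {0<..T}"
    then have "(T - s) * lam c \<le> 0" using lam_neg[OF that] by (intro mult_nonneg_nonpos) auto
    then have "\<bar>mu c\<bar> * exp ((T - s) * lam c) \<le> \<bar>mu c\<bar> * 1" by (intro mult_left_mono) auto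
    then show "\<bar>mu c * exp ((T - s) * lam c)\<bar> \<le> \<bar>mu c\<bar>" by (simp add: abs_mult)
  qed
  have limX: "(\<lambda>n. \<Prod>k<n. 1 / sqrt (1 + 2 * qX k)) \<longlonglongrightarrow> (LINT \<omega>|M. exp (- (norm (X \<omega>))\<^sup>2))"
    unfolding qX_def by (rule stochastic_integral_norm(1)[OF X X_ex _ X_bd e]) simp_all
  have normX: "(LINT \<omega>|M. (norm (X \<omega>))\<^sup>2) = suminf qX"
    unfolding qX_def
    by (rule stochastic_integral_norm(2)[OF X X_ex _ X_bd e]) (use qX_pos qX_summable in \<open>simp_all add: qX_def\<close>)

  \<comment> \<open>Both schemes damp the mode c by a factor x c per step, exp(h lam c) or 1 / (1 -
    h lam c). The rest of the argument treats them together through the common bound on x.\<close>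
  have "\<exists>x. (\<forall>c\<in>HH. 0 \<le> x c \<and> x c \<le> 1 / (1 - h * lam c)) \<and>
      (\<lambda>n. \<Prod>k<n. 1 / sqrt (1 + 2 * (LINT s:{0<..T}|lborel. (mu (e k) * x (e k) ^ (N - nat \<lfloor>s / h\<rfloor>))\<^sup>2)))
        \<longlonglongrightarrow> (LINT \<omega>|M. exp (- (norm (Y i \<omega>))\<^sup>2))"
  proof -
    have lim: "(\<lambda>n. \<Prod>k<n. 1 / sqrt (1 + 2 * (LINT s:{0<..T}|lborel. (mu (e k) * x (e k) ^ (N - nat \<lfloor>s / h\<rfloor>))\<^sup>2)))
        \<longlonglongrightarrow> (LINT \<omega>|M. exp (- (norm (U \<omega>))\<^sup>2))"
      if U: "has_stochastic_integral HH M W T \<Phi> U"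
        and ex: "\<And>s c. 0 \<le> s \<Longrightarrow> s < T \<Longrightarrow> c \<in> HH \<Longrightarrow> \<Phi> s c = (mu c * x c ^ (N - nat \<lfloor>s / h\<rfloor>)) *\<^sub>R c"
        and x: "\<And>c. c \<in> HH \<Longrightarrow> 0 \<le> x c \<and> x c \<le> 1" for \<Phi> U x
    proof (rule stochastic_integral_norm(1)[OF U ex _ _ e])
      fix c assume c: "c \<in> HH"
      show "(\<lambda>s. mu c * x c ^ (N - nat \<lfloor>s / h\<rfloor>)) \<in> borel_measurable borel" by measurable
      have "\<bar>mu c\<bar> * \<bar>x c ^ n\<bar> \<le> \<bar>mu c\<bar> * 1" for n
        using x[OF c] by (intro mult_left_mono) (auto simp: power_le_one)
      then show "\<exists>C. \<forall>s\<in>{0<..T}. \<bar>mu c * x c ^ (N - nat \<lfloor>s / h\<rfloor>)\<bar> \<le> C"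
        by (intro exI[of _ "\<bar>mu c\<bar>"]) (simp add: abs_mult)
    qed
    have pos: "1 \<le> 1 - h * lam c" if "c \<in> HH" for c
      using mult_pos_neg[OF h lam_neg[OF that]] by simp
    from i consider "i = 1" | "i = 2" by auto
    then show ?thesis
    proof cases
      case 1
      have "exp (h * lam c) \<le> 1 / (1 - h * lam c)" if "c \<in> HH" for c
        using exp_ge_add_one_self[of "- (h * lam c)"] pos[OF that] by (simp add: exp_minus field_simps)
      moreover have "(\<lambda>n. \<Prod>k<n. 1 / sqrt (1 + 2 * (LINT s:{0<..T}|lborel. (mu (e k) * exp (h * lam (e k)) ^ (N - nat \<lfloor>s / h\<rfloor>))\<^sup>2)))
          \<longlonglongrightarrow> (LINT \<omega>|M. exp (- (norm (Y 1 \<omega>))\<^sup>2))"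
        using h beta lam_neg
        by (intro lim[OF Y1]) (auto simp: N(2) intro!: exp_euler_integrand_basis[OF B_HS B_diag] mult_pos_neg less_imp_le)
      ultimately show ?thesis
        using 1 by (intro exI[of _ "\<lambda>c. exp (h * lam c)"]) simp
    next
      case 2
      have "(\<lambda>n. \<Prod>k<n. 1 / sqrt (1 + 2 * (LINT s:{0<..T}|lborel. (mu (e k) * (1 / (1 - h * lam (e k))) ^ (N - nat \<lfloor>s / h\<rfloor>))\<^sup>2)))
          \<longlonglongrightarrow> (LINT \<omega>|M. exp (- (norm (Y 2 \<omega>))\<^sup>2))"
      proof (rule lim[OF Y2])
        fix s c assume "0 \<le> s" "s < T" "c \<in> HH"
        then show "impl_euler_integrand HH lam j (nr (- \<beta>)) B h T s c = (mu c * (1 / (1 - h * lam c)) ^ (N - nat \<lfloor>s / h\<rfloor>)) *\<^sub>R c"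
          unfolding N(2) using h beta by (intro impl_euler_integrand_basis[OF B_HS B_diag]) auto
      next
        fix c assume "c \<in> HH"
        then show "0 \<le> 1 / (1 - h * lam c) \<and> 1 / (1 - h * lam c) \<le> 1" using pos[of c] by simp
      qed
      moreover have "0 \<le> 1 / (1 - h * lam c)" if "c \<in> HH" for c using pos[OF that] by simp
      ultimately show ?thesis
        using 2 by (intro exI[of _ "\<lambda>c. 1 / (1 - h * lam c)"]) simp
    qed
  qed
  then obtain x where x: "\<And>c. c \<in> HH \<Longrightarrow> 0 \<le> x c" "\<And>c. c \<in> HH \<Longrightarrow> x c \<le> 1 / (1 - h * lam c)"
    and limY: "(\<lambda>n. \<Prod>k<n. 1 / sqrt (1 + 2 * (LINT s:{0<..T}|lborel. (mu (e k) * x (e k) ^ (N - nat \<lfloor>s / h\<rfloor>))\<^sup>2)))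
        \<longlonglongrightarrow> (LINT \<omega>|M. exp (- (norm (Y i \<omega>))\<^sup>2))"
    by blast
  define qY where "qY = (\<lambda>k. LINT s:{0<..T}|lborel. (mu (e k) * x (e k) ^ (N - nat \<lfloor>s / h\<rfloor>))\<^sup>2)"
  have qY_eq: "qY k = (LINT s:{0<..T}|lborel. (mu (e k) * x (e k) ^ (N - nat \<lfloor>s / h\<rfloor>))\<^sup>2)" for k
    by (simp only: qY_def)
  have qY: "qY k = a k powr (2 * \<delta>) * (h * (\<Sum>i<N. (x (e k) ^ (N - i))\<^sup>2))" for k
  proof -
    have "(mu (e k))\<^sup>2 = a k powr (2 * \<delta>)"
      using mu_sq[of k 0] a_pos[of k] by (simp add: lam_e)
    then show ?thesis
      unfolding qY_def N(2)
      using set_integral_grid[OF h, of N "\<lambda>i. (x (e k) ^ (N - i))\<^sup>2"]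
      by (simp only: power_mult_distrib set_integral_mult_right)
  qed
  have qY0: "0 \<le> qY k" for k
    unfolding qY using h by (intro mult_nonneg_nonneg sum_nonneg) auto
  \<comment> \<open>Both variances carry the factor 1 - exp(- 2 a T), at least 1 - exp(- T) because
    2 a >= 1. What remains is the identity 1 / (2 a) - 1 / (a (2 + a h)) = h / (2 (2 + a
    h)).\<close>
  have gap: "(1 - exp (- T)) * (h / 2 * (a k powr (2 * \<delta>) / (2 + a k * h))) \<le> qX k - qY k" for k
  proof -
    let ?E = "1 - exp (- 2 * a k * T)"
    have ah: "0 < a k * h" using a_pos[of k] h by simp
    have "qY k \<le> a k powr (2 * \<delta>) * (?E / (a k * (2 + a k * h)))"
      unfolding qY N(2) using geometric_variance_bound[OF a_pos[of k] h x(1)[OF e_mem[of k]], of N] x(2)[OF e_mem[of k]]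
      by (intro mult_left_mono) (auto simp: lam_e mult.commute)
    then have "a k powr (2 * \<delta>) * ?E / (2 * a k) - a k powr (2 * \<delta>) * (?E / (a k * (2 + a k * h))) \<le> qX k - qY k"
      unfolding qX by linarith
    moreover have "a k powr (2 * \<delta>) * ?E / (2 * a k) - a k powr (2 * \<delta>) * (?E / (a k * (2 + a k * h))) =
        ?E * (h / 2 * (a k powr (2 * \<delta>) / (2 + a k * h)))"
    proof -
      have "p * E / (2 * u) - p * (E / (u * (2 + u * h))) = E * (h / 2 * (p / (2 + u * h)))"
        if "u > 0" "0 < u * h" for p E u
      proof -
        have "2 + u * h \<noteq> 0" using that by linarith
        then show ?thesis using that by (simp add: divide_simps) (simp add: algebra_simps)
      qed
      from this[OF a_pos[of k] ah] show ?thesis .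
    qed
    moreover have "1 - exp (- T) \<le> ?E"
    proof -
      have "1 * 1 \<le> pi\<^sup>2 * (real (Suc k))\<^sup>2"
        using pi_ge_two by (intro mult_mono one_le_power) auto
      then have "1 * T \<le> 2 * a k * T" using T_pos by (intro mult_right_mono) (auto simp: a_def)
      then show ?thesis by simp
    qed
    then have "(1 - exp (- T)) * (h / 2 * (a k powr (2 * \<delta>) / (2 + a k * h))) \<le> ?E * (h / 2 * (a k powr (2 * \<delta>) / (2 + a k * h)))"
      using h ah by (intro mult_right_mono) auto
    ultimately show ?thesis by linarith
  qed
  have T1: "0 < 1 - exp (- T)" using T_pos by simp
  have "qY k \<le> qX k" for k
  proof -
    have "0 \<le> (1 - exp (- T)) * (h / 2 * (a k powr (2 * \<delta>) / (2 + a k * h)))"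
      using T1 h a_pos[of k] by (intro mult_nonneg_nonneg divide_nonneg_nonneg) auto
    then show ?thesis using gap[of k] by linarith
  qed
  note main = product_gap[OF qY0 this qX_summable limX limY[folded qY_eq]]

  define S where "S = suminf qX"
  have S0: "0 \<le> S" unfolding S_def using qX_pos by (intro suminf_nonneg qX_summable) (auto intro: less_imp_le)
  define R where "R = (1 - exp (- 1)) * T powr pos_part (1 / 2 + 2 * \<delta>) * h powr min (1 / 2 - 2 * \<delta>) 1 /
      (4 powr (1 + 2 * neg_part \<delta>) * (3 + 4 * neg_part \<delta>) * exp (12 * pi\<^sup>2 * T))"
  obtain m where m: "R \<le> h / 2 * (\<Sum>k<m. real (Suc k) powr (4 * \<delta>) / (2 + pi\<^sup>2 * (real (Suc k))\<^sup>2 * h))"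
    using rate_sum_lower[OF \<delta> h hT] unfolding R_def by blast
  have np: "neg_part \<delta> \<ge> 0" by (simp add: neg_part_def)
  have R_pos: "R > 0"
    unfolding R_def using T_pos h np by (intro divide_pos_pos mult_pos_pos) auto
  \<comment> \<open>The factor pi^(4 \<delta>) splits off from the powers a^(2 \<delta>) of the
    eigenvalues; what is left are the powers of k in \<open>rate_sum_lower\<close>.\<close>
  let ?C = "(1 - exp (- T)) * pi powr (4 * \<delta>)"
  have C: "?C > 0" using T1 by simp
  define K where "K = ((1 - exp (- T)) * (1 - exp (- 1)) * T powr pos_part (1 / 2 + 2 * \<delta>) * pi powr (4 * \<delta>)) /
     (4 powr (1 + 2 * neg_part \<delta>) * (3 + 4 * neg_part \<delta>) * exp (12 * pi\<^sup>2 * T + 6 * S))"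
  have K: "K * h powr min (1 / 2 - 2 * \<delta>) 1 = exp (- 6 * S) * (?C * R)"
  proof -
    have "u * c * t * p / (d * d' * (E * E')) * z = inverse E' * (u * p * (c * t * z / (d * d' * E)))"
      for u c t p d d' E E' z :: real
      by (simp add: divide_inverse)
    moreover have "exp (- 6 * S) = inverse (exp (6 * S))" by (simp add: exp_minus)
    ultimately show ?thesis unfolding K_def R_def exp_add by (simp only:)
  qed
  have "?C * R \<le> ?C * (h / 2 * (\<Sum>k<m. real (Suc k) powr (4 * \<delta>) / (2 + pi\<^sup>2 * (real (Suc k))\<^sup>2 * h)))"
    using m C by (intro mult_left_mono) auto
  also have "\<dots> = (\<Sum>k<m. (1 - exp (- T)) * (h / 2 * (a k powr (2 * \<delta>) / (2 + a k * h))))"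
    by (simp add: sum_distrib_left a_powr) (simp add: a_def mult_ac)
  also have "\<dots> \<le> (\<Sum>k<m. qX k - qY k)"
    by (intro sum_mono gap)
  finally have CR: "?C * R \<le> (\<Sum>k<m. qX k - qY k)" .
  \<comment> \<open>The product comparison gives the exponent 3 S; the stated 6 S is a weaker bound
    since S >= 0.\<close>
  have "exp (- 6 * S) * (?C * R) \<le> exp (- 3 * S) * (?C * R)"
    using S0 C R_pos by (intro mult_right_mono) auto
  also have "\<dots> \<le> exp (- 3 * S) * (\<Sum>k<m. qX k - qY k)"
    using CR by (intro mult_left_mono) auto
  also have "\<dots> \<le> (LINT \<omega>|M. exp (- (norm (Y i \<omega>))\<^sup>2)) - (LINT \<omega>|M. exp (- (norm (X \<omega>))\<^sup>2))"
    unfolding S_def by (rule main)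
  finally have lower: "K * h powr min (1 / 2 - 2 * \<delta>) 1 \<le> (LINT \<omega>|M. \<phi> (Y i \<omega>)) - (LINT \<omega>|M. \<phi> (X \<omega>))"
    unfolding K phi .
  have "0 < K * h powr min (1 / 2 - 2 * \<delta>) 1"
    unfolding K by (intro mult_pos_pos[OF exp_gt_zero] mult_pos_pos[OF C R_pos])
  with part1 part2 lower show ?thesis
    unfolding Let_def normX S_def[symmetric] K_def[symmetric] by blast
qed

end
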